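(* Let $\mu>0$, $f_0\in(0,1)$. If $0<\omega<1$ and $\lambda\in(\lambda_1,\lambda_2]$, then the stationary monotone solution $\underline{u}_{\lambda,\mu}$ of $P(\lambda,f)$ with free boundary in $[0,r^* )$ is unstable in $L^\infty(0,1)$, as a stationary solution of the parabolic problem $PP^*(\lambda,\beta,u_0)$.
   Context: Let $f(v)=f_0+(1-f_0)H(v-\mu)$, where $H(s)=0$ for $s<0$ and $H(s)=1$ for $s\ge 0$. Let $\beta$ be the maximal monotone graph with $\beta(r)=\{f(r)\}$ for $r\neq\mu$ and $\beta(\mu)=[f_0,1]$. Problem $P(\lambda,f)$ is $-u''+\omega^2u=\lambda f(u)$ in $(0,1)$, $u'(0)=0$, $u(1)=0$. A solution of $P(\lambda,f)$ with free boundary $x_{\lambda,\mu}\in[0,1)$ is a function $u\in C^2((0,1)\setminus\{x_{\lambda,\mu}\})\cap C^1([0,1))$ (continuous up to $x=1$) with $u(x_{\lambda,\mu})=\mu$, $u\ge0$, $u\ne0$, satisfying the equation for every $x\in(0,1)\setminus\{x_{\lambda,\mu}\}$ and the boundary conditions; it is monotone if $u'\le0$ on $(0,1)$. Set $$g(r)=\frac{\omega^2\cosh\omega}{\sinh(\omega r)\sinh(\omega-\omega r)-f_0\cosh(\omega r)+f_0\cosh(\omega r)\cosh(\omega-\omega r)},\qquad r\in[0,1).$$ The number $r^*\in(0,1)$ is the unique solution in $(0,1)$ of $r^*=\frac12\Big(1+\frac1\omega\sinh^{-1}\big(\frac{f_0}{f_0-1}\sinh(\omega r^* )\big)\Big)$;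 it is the minimum point of $g$. Put $\lambda_1:=\mu g(r^* )$ and $\lambda_2:=\mu g(0)=\mu\frac{\omega^2\cosh\omega}{f_0(\cosh\omega-1)}$. For $\lambda\in(\lambda_1,\lambda_2]$, $\underline{u}_{\lambda,\mu}$ denotes the monotone solution of $P(\lambda,f)$ whose free boundary $\underline{x}_{\lambda,\mu}\in[0,r^* )$ is the root in $[0,r^* )$ of $g(r)=\lambda/\mu$. Problem $PP^*(\lambda,\beta,u_0)$ is $$u_t-u_{xx}+\omega^2u\in\lambda\beta(u),\ x\in(0,1),\ t>0,\qquad u_x(0,t)=0,\ u(1,t)=0,\ t>0,\qquad u(x,0)=u_0(x),\ x\in(0,1),$$ with (weak) solutions understood in the usual sense: there is a bounded measurable $h$ with $h(x,t)\in\beta(u(x,t))$ a.e. such that $u_t-u_{xx}+\omega^2u=\lambda h$ with these boundary and initial conditions. A solution $u$ is non-degenerate if there are $C>0$, $\theta_0>0$ such that $\mathrm{meas}\{x\in(0,1):|u(t,x:u_0)-\mu|\le\theta\}\le C\theta$ for all $\theta\in(0,\theta_0)$ and all $t>0$; uniqueness holds in this class. Unstable in $L^\infty(0,1)$ means not Lyapunov stable: there is $\varepsilon>0$ such that for every $\delta>0$ there are $u_0$ with $\|u_0-\underline{u}_{\lambda,\mu}\|_{L^\infty(0,1)}<\delta$ and a solution of $PP^*(\lambda,\beta,u_0)$ with $\|u(t,\cdot:u_0)-\underline{u}_{\lambda,\mu}\|_{L^\infty(0,1)}\ge\varepsilon$ for some $t>0$. *)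

theory Defs
  imports "HOL-Analysis.Analysis" "HOL-Probability.Essential_Supremum"
begin

definition heaviside :: "real \<Rightarrow> real" where
  "heaviside s = (if s < 0 then 0 else 1)"

definition reaction :: "real \<Rightarrow> real \<Rightarrow> real \<Rightarrow> real" where
  "reaction f0 \<mu> v = f0 + (1 - f0) * heaviside (v - \<mu>)"

definition reaction_graph :: "real \<Rightarrow> real \<Rightarrow> real \<Rightarrow> real set" where
  "reaction_graph f0 \<mu> r = (if r = \<mu> then {f0..1} else {reaction f0 \<mu> r})"

definition g :: "real \<Rightarrow> real \<Rightarrow> real \<Rightarrow> real" where
  "g f0 \<omega> r = \<omega>\<^sup>2 * cosh \<omega> /
     (sinh (\<omega> * r) * sinh (\<omega> - \<omega> * r) - f0 * cosh (\<omega> * r)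
        + f0 * cosh (\<omega> * r) * cosh (\<omega> - \<omega> * r))"

text \<open>Solutions of \<open>- u'' + \<omega>\<^sup>2 u = lam f(u)\<close>, \<open>u'(0) = 0\<close>, \<open>u(1) = 0\<close> with free boundary \<open>\<xi>\<close>.
  Only the values of \<open>u\<close> on \<open>[0,1]\<close> matter; the derivative at \<open>0\<close> is one-sided.\<close>

definition free_boundary_solution ::
    "real \<Rightarrow> real \<Rightarrow> (real \<Rightarrow> real) \<Rightarrow> real \<Rightarrow> real \<Rightarrow> (real \<Rightarrow> real) \<Rightarrow> bool" where
  "free_boundary_solution \<omega> lam f \<mu> \<xi> u \<longleftrightarrow>
     \<xi> \<in> {0..<1} \<and> continuous_on {0..1} u \<and>
     u \<xi> = \<mu> \<and> (\<forall>x\<in>{0..1}. 0 \<le> u x) \<and> (\<exists>x\<in>{0..1}. u x \<noteq> 0) \<and>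
     (\<exists>u' u''.
        (\<forall>x\<in>{0..<1}. (u has_real_derivative u' x) (at x within {0..<1})) \<and>
        continuous_on {0..<1} u' \<and>
        (\<forall>x\<in>{0<..<1} - {\<xi>}. (u' has_real_derivative u'' x) (at x)) \<and>
        continuous_on ({0<..<1} - {\<xi>}) u'' \<and>
        (\<forall>x\<in>{0<..<1} - {\<xi>}. - u'' x + \<omega>\<^sup>2 * u x = lam * f (u x)) \<and>
        u' 0 = 0) \<and>
     u 1 = 0"

definition monotone_solution ::
    "real \<Rightarrow> real \<Rightarrow> (real \<Rightarrow> real) \<Rightarrow> real \<Rightarrow> real \<Rightarrow> (real \<Rightarrow> real) \<Rightarrow> bool" where
  "monotone_solution \<omega> lam f \<mu> \<xi> u \<longleftrightarrow>
     free_boundary_solution \<omega> lam f \<mu> \<xi> u \<and> (\<forall>x\<in>{0<..<1}. deriv u x \<le> 0)"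

definition in_L2 :: "'a::euclidean_space set \<Rightarrow> ('a \<Rightarrow> real) \<Rightarrow> bool" where
  "in_L2 S v \<longleftrightarrow> v \<in> borel_measurable (lebesgue_on S) \<and>
     integrable (lebesgue_on S) (\<lambda>x. (v x)\<^sup>2)"

text \<open>\<open>v\<close> belongs to \<open>V = {v \<in> H\<^sup>1(0,1). v(1) = 0}\<close> and has weak derivative \<open>w\<close>:
  in dimension one, \<open>H\<^sup>1(0,1)\<close> consists of the (a.e. classes of) primitives of
  \<open>L\<^sup>2\<close> functions.\<close>

definition weak_deriv_V :: "(real \<Rightarrow> real) \<Rightarrow> (real \<Rightarrow> real) \<Rightarrow> bool" where
  "weak_deriv_V v w \<longleftrightarrow> in_L2 {0<..<1} w \<and>
     (AE x in lebesgue_on {0<..<1}. v x = - (\<integral>y. w y \<partial>lebesgue_on {x<..<1}))"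

text \<open>Test functions: \<open>\<phi> \<in> C\<^sup>1\<close> with partial derivatives \<open>\<phi>t\<close>, \<open>\<phi>x\<close>, vanishing at \<open>x = 1\<close> and
  for large times; no condition at \<open>t = 0\<close> or \<open>x = 0\<close>.\<close>

definition test_function ::
    "(real \<Rightarrow> real \<Rightarrow> real) \<Rightarrow> (real \<Rightarrow> real \<Rightarrow> real) \<Rightarrow> (real \<Rightarrow> real \<Rightarrow> real) \<Rightarrow> bool" where
  "test_function \<phi> \<phi>t \<phi>x \<longleftrightarrow>
     (\<forall>t x. ((\<lambda>(s, y). \<phi> s y) has_derivative (\<lambda>(s, y). \<phi>t t x * s + \<phi>x t x * y)) (at (t, x))) \<and>
     continuous_on UNIV (\<lambda>(t, x). \<phi>t t x) \<and> continuous_on UNIV (\<lambda>(t, x). \<phi>x t x) \<and>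
     (\<forall>t\<ge>0. \<phi> t 1 = 0) \<and> (\<exists>T>0. \<forall>t\<ge>T. \<forall>x\<in>{0..1}. \<phi> t x = 0)"

text \<open>Weak (energy) solutions of \<open>u\<^sub>t - u\<^sub>x\<^sub>x + \<omega>\<^sup>2 u \<in> lam \<beta>(u)\<close> on \<open>t > 0\<close>, \<open>0 < x < 1\<close>, with
  \<open>u\<^sub>x(0,t) = 0\<close>, \<open>u(1,t) = 0\<close>, \<open>u(x,0) = u0(x)\<close>, written \<open>u t x\<close>:
  \<open>u \<in> C([0,\<infinity>); L\<^sup>2(0,1))\<close> and \<open>u \<in> L\<^sup>2(0,T; V)\<close> for every \<open>T\<close>, with \<open>w = u\<^sub>x\<close>. The Dirichlet
  condition is contained in \<open>V\<close>, the Neumann condition is the natural one of the weak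
  identity. Continuity in time gives \<open>u t\<close> a meaning for every single \<open>t\<close>.\<close>

definition parabolic_solution ::
    "real \<Rightarrow> real \<Rightarrow> (real \<Rightarrow> real set) \<Rightarrow> (real \<Rightarrow> real) \<Rightarrow> (real \<Rightarrow> real \<Rightarrow> real) \<Rightarrow> bool" where
  "parabolic_solution \<omega> lam \<beta> u0 u \<longleftrightarrow>
     (let Q = {0<..} \<times> {0<..<1} in
      (\<lambda>(t, x). u t x) \<in> borel_measurable (lebesgue_on Q) \<and>
      (\<forall>t\<ge>0. in_L2 {0<..<1} (u t)) \<and>
      (\<forall>s\<ge>0. ((\<lambda>t. \<integral>x. (u t x - u s x)\<^sup>2 \<partial>lebesgue_on {0<..<1}) \<longlongrightarrow> 0) (at s within {0..})) \<and>
      (AE x in lebesgue_on {0<..<1}. u 0 x = u0 x) \<and>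
      (\<exists>w h.
         (\<forall>T>0. in_L2 ({0<..<T} \<times> {0<..<1}) (\<lambda>(t, x). w t x)) \<and>
         (AE t in lebesgue_on {0<..}. weak_deriv_V (u t) (w t)) \<and>
         (\<lambda>(t, x). h t x) \<in> borel_measurable (lebesgue_on Q) \<and>
         bounded ((\<lambda>(t, x). h t x) ` Q) \<and>
         (AE (t, x) in lebesgue_on Q. h t x \<in> \<beta> (u t x)) \<and>
         (\<forall>\<phi> \<phi>t \<phi>x. test_function \<phi> \<phi>t \<phi>x \<longrightarrow>
            (\<integral>(t, x). - u t x * \<phi>t t x + w t x * \<phi>x t x + \<omega>\<^sup>2 * u t x * \<phi> t x \<partial>lebesgue_on Q)
            = (\<integral>(t, x). lam * h t x * \<phi> t x \<partial>lebesgue_on Q)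
              + (\<integral>x. u0 x * \<phi> 0 x \<partial>lebesgue_on {0<..<1}))))"

definition Linf_norm :: "(real \<Rightarrow> real) \<Rightarrow> ereal" where
  "Linf_norm v = esssup (lebesgue_on {0<..<1}) (\<lambda>x. ereal \<bar>v x\<bar>)"

definition unstable_Linf :: "real \<Rightarrow> real \<Rightarrow> (real \<Rightarrow> real set) \<Rightarrow> (real \<Rightarrow> real) \<Rightarrow> bool" where
  "unstable_Linf \<omega> lam \<beta> v \<longleftrightarrow>
     (\<exists>\<epsilon>>0. \<forall>\<delta>>0. \<exists>u0 u.
        u0 \<in> borel_measurable (lebesgue_on {0<..<1}) \<and>
        Linf_norm (\<lambda>x. u0 x - v x) < ereal \<delta> \<and>
        parabolic_solution \<omega> lam \<beta> u0 u \<and>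
        (\<exists>t>0. Linf_norm (\<lambda>x. u t x - v x) \<ge> ereal \<epsilon>))"

end

theory Submission
  imports Defs "HOL-Probability.Distributions" "HOL-Real_Asymp.Real_Asymp"
begin

text \<open>
  The profile \<open>U\<^sub>s\<close> solves the linear stationary problem in which the jump of the reaction is frozen
  at \<open>s\<close>; it takes the value \<open>lam / g s\<close> at \<open>s\<close>, and \<open>u_low\<close> is \<open>U\<^sub>\<xi>\<close>. As \<open>g\<close> decreases up to \<open>r_star\<close>,
  \<open>U\<^sub>s(s) > \<mu>\<close> for every \<open>s\<close> in \<open>(\<xi>, r_star]\<close>, so \<open>U\<^sub>s\<close> is a subsolution, and it is as close to \<open>u_low\<close>
  as we like. Monotone iteration from \<open>U\<^sub>s\<close> gives a solution that increases in time. Its limit for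
  \<open>t \<rightarrow> \<infinity>\<close> lies above \<open>U\<^sub>R\<close> as soon as it lies above \<open>\<mu>\<close> on \<open>[0, R)\<close>, hence it lies above \<open>\<mu>\<close>
  beyond any such \<open>R < r_star\<close> and finally above \<open>U\<^bsub>r_star\<^esub>\<close>, at a distance from \<open>u_low\<close> independent of \<open>s\<close>.

  The linear problem is solved by convolution on \<open>\<real>\<^sup>2\<close> of the heat kernel with a source that is
  extended evenly about \<open>0\<close> and oddly about \<open>1\<close>.
\<close>

section \<open>Convolution of integrable with bounded functions\<close>

text \<open>The damping \<open>\<omega>\<^sup>2\<close> makes the heat kernel integrable over all of
  space-time, so a bounded measurable source has a potential even if it has no beginning in time.
  Stationary states and evolutions are thus objects of one kind, and the passage to large times is a
  shift of the source followed by dominated convergence, with no compactness or regularity theory.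
  The jump of the reaction is the obstacle: sources are discontinuous, potentials need not have
  classical second derivatives, and comparison has to be proved on the level of integrals. Every
  comparison is reduced to one sign statement: an even-odd source that is nonnegative on
  \<open>(-1, 1)\<close> has a potential that is nonnegative there. The jump is also the reason why
  the limit of the iteration solves the inclusion: where the iterates reach \<open>\<mu>\<close>
  only in the limit, the limiting reaction is \<open>f0\<close>, although \<open>reaction\<close>
  takes the value \<open>1\<close> at \<open>\<mu>\<close>. The weak identity is obtained by
  duality: the kernel is moved to the test function, and the boundary term at \<open>0\<close>
  cancels by symmetry.\<close>

definition convol :: "('a::euclidean_space \<Rightarrow> real) \<Rightarrow> ('a \<Rightarrow> real) \<Rightarrow> 'a \<Rightarrow> real" where
  "convol q K z = (LBINT y. q y * K (z - y))"

lemma lborel_integral_shift: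
  fixes f :: "'a::euclidean_space \<Rightarrow> real"
  assumes "f \<in> borel_measurable borel"
  shows "(LBINT x. f (c + x)) = (LBINT x. f x)"
    and "integrable lborel (\<lambda>x. f (c + x)) \<longleftrightarrow> integrable lborel f"
proof -
  have "(LBINT x. f x) = (\<integral>x. f x \<partial>distr lborel borel ((+) c))"
    by (simp only: lborel_distr_plus)
  also have "\<dots> = (LBINT x. f (c + x))"
    using assms by (intro integral_distr) auto
  finally show "(LBINT x. f (c + x)) = (LBINT x. f x)" ..
  have "integrable lborel f \<longleftrightarrow> integrable (distr lborel borel ((+) c)) f"
    by (simp only: lborel_distr_plus)
  also have "\<dots> \<longleftrightarrow> integrable lborel (\<lambda>x. f (c + x))"
    using assms by (intro integrable_distr_eq) auto
  finally show "integrable lborel (\<lambda>x. f (c + x)) \<longleftrightarrow> integrable lborel f" ..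
qed

lemma lborel_distr_reflect:
  "distr lborel borel (\<lambda>x. c - x) = (lborel :: 'a::euclidean_space measure)"
  by (subst lborel_affine[of "-1" c]) (auto simp: density_1)

lemma lborel_integral_reflect:
  fixes f :: "'a::euclidean_space \<Rightarrow> real"
  assumes "f \<in> borel_measurable borel"
  shows "(LBINT x. f (c - x)) = (LBINT x. f x)"
    and "integrable lborel (\<lambda>x. f (c - x)) \<longleftrightarrow> integrable lborel f"
proof -
  have "(LBINT x. f x) = (\<integral>x. f x \<partial>distr lborel borel (\<lambda>x. c - x))"
    by (simp only: lborel_distr_reflect)
  also have "\<dots> = (LBINT x. f (c - x))"
    using assms by (intro integral_distr) auto
  finally show "(LBINT x. f (c - x)) = (LBINT x. f x)" ..
  have "integrable lborel f \<longleftrightarrow> integrable (distr lborel borel (\<lambda>x. c - x)) f"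
    by (simp only: lborel_distr_reflect)
  also have "\<dots> \<longleftrightarrow> integrable lborel (\<lambda>x. f (c - x))"
    using assms by (intro integrable_distr_eq) auto
  finally show "integrable lborel (\<lambda>x. f (c - x)) \<longleftrightarrow> integrable lborel f" ..
qed

lemma integrable_mult_bounded:
  fixes q K :: "'a \<Rightarrow> real"
  assumes "integrable M q" "K \<in> borel_measurable M" "\<And>x. \<bar>K x\<bar> \<le> B"
  shows "integrable M (\<lambda>x. q x * K x)"
proof (rule Bochner_Integration.integrable_bound)
  show "integrable M (\<lambda>x. B * \<bar>q x\<bar>)" using assms by auto
  show "AE x in M. norm (q x * K x) \<le> norm (B * \<bar>q x\<bar>)"
  proof (intro AE_I2)
    fix x
    have "\<bar>K x\<bar> \<le> \<bar>B\<bar>" using assms(3)[of x] by linarith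
    then show "norm (q x * K x) \<le> norm (B * \<bar>q x\<bar>)"
      by (simp add: abs_mult mult.commute mult_right_mono)
  qed
qed (use assms in auto)

lemma integral_mult_bounded:
  fixes q K :: "'a \<Rightarrow> real"
  assumes "integrable M q" "K \<in> borel_measurable M" "\<And>x. \<bar>K x\<bar> \<le> B"
  shows "\<bar>\<integral>x. q x * K x \<partial>M\<bar> \<le> B * (\<integral>x. \<bar>q x\<bar> \<partial>M)"
proof -
  have "\<bar>\<integral>x. q x * K x \<partial>M\<bar> \<le> (\<integral>x. \<bar>q x * K x\<bar> \<partial>M)"
    using integral_norm_bound[of M "\<lambda>x. q x * K x"] by simp
  also have "\<dots> \<le> (\<integral>x. B * \<bar>q x\<bar> \<partial>M)"
  proof (rule integral_mono)
    show "integrable M (\<lambda>x. \<bar>q x * K x\<bar>)"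
      using integrable_mult_bounded[OF assms] by auto
    show "\<bar>q x * K x\<bar> \<le> B * \<bar>q x\<bar>" for x
      using assms(3)[of x] by (simp add: abs_mult mult.commute mult_right_mono)
  qed (use assms in auto)
  finally show ?thesis by simp
qed

lemma integrable_convol:
  fixes q K :: "'a::euclidean_space \<Rightarrow> real"
  assumes "integrable lborel q" "K \<in> borel_measurable borel" "\<And>x. \<bar>K x\<bar> \<le> B"
  shows "integrable lborel (\<lambda>y. q y * K (z - y))"
  using assms by (intro integrable_mult_bounded[where B=B]) auto

lemma convol_bound:
  fixes q K :: "'a::euclidean_space \<Rightarrow> real"
  assumes "integrable lborel q" "K \<in> borel_measurable borel" "\<And>x. \<bar>K x\<bar> \<le> B"
  shows "\<bar>convol q K z\<bar> \<le> B * (LBINT x. \<bar>q x\<bar>)"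
  unfolding convol_def using assms by (intro integral_mult_bounded) auto

lemma convol_commute:
  assumes "q \<in> borel_measurable borel" "K \<in> borel_measurable borel"
  shows "convol q K z = (LBINT y. q (z - y) * K y)"
  using lborel_integral_reflect(1)[of "\<lambda>y. q (z - y) * K y" z] assms
  by (simp add: convol_def)

lemma borel_measurable_convol:
  assumes [measurable]: "q \<in> borel_measurable borel" "K \<in> borel_measurable borel"
  shows "convol q K \<in> borel_measurable borel"
proof -
  have "(\<lambda>z. LBINT y. q y * K (z - y)) \<in> borel_measurable borel"
    by (rule lborel.borel_measurable_lebesgue_integral) measurable
  then show ?thesis by (simp add: convol_def[abs_def])
qed

lemma convol_diff:
  fixes q K L :: "'a::euclidean_space \<Rightarrow> real"
  assumes "integrable lborel q" "K \<in> borel_measurable borel" "\<And>x. \<bar>K x\<bar> \<le> B"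
    "L \<in> borel_measurable borel" "\<And>x. \<bar>L x\<bar> \<le> B"
  shows "convol q (\<lambda>x. K x - L x) z = convol q K z - convol q L z"
  unfolding convol_def
  using integrable_convol[OF assms(1-3)] integrable_convol[OF assms(1,4,5)]
  by (simp add: right_diff_distrib)

text \<open>Dominated convergence with the majorant \<open>B * \<bar>q y\<bar>\<close>. Three limits
  go through it: sources cut off in the remote past, the monotone iteration, and large
  times.\<close>

lemma convol_LIMSEQ:
  fixes q L :: "'a::euclidean_space \<Rightarrow> real"
  assumes q: "integrable lborel q" and K: "\<And>n. K n \<in> borel_measurable borel"
    and L: "L \<in> borel_measurable borel"
    and B: "\<And>n x. \<bar>K n x\<bar> \<le> B" and lim: "\<And>x. (\<lambda>n. K n x) \<longlonglongrightarrow> L x"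
  shows "(\<lambda>n. convol q (K n) z) \<longlonglongrightarrow> convol q L z"
  unfolding convol_def
proof (rule integral_dominated_convergence[where w="\<lambda>y. B * \<bar>q y\<bar>"])
  show "AE y in lborel. (\<lambda>n. q y * K n (z - y)) \<longlonglongrightarrow> q y * L (z - y)"
    by (intro AE_I2 tendsto_intros lim)
  show "AE y in lborel. norm (q y * K n (z - y)) \<le> B * \<bar>q y\<bar>" for n
    by (intro AE_I2) (simp add: abs_mult mult.commute[of "\<bar>q _\<bar>"] mult_right_mono B)
  have [measurable]: "q \<in> borel_measurable borel" using q by auto
  note [measurable] = K L
  show "(\<lambda>y. q y * L (z - y)) \<in> borel_measurable lborel"
    "\<And>n. (\<lambda>y. q y * K n (z - y)) \<in> borel_measurable lborel" by measurable
qed (use q in auto)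

text \<open>Scheffe's argument: since \<open>\<integral>p(c + x) dx\<close> does not depend on \<open>c\<close>, the \<open>L\<^sup>1\<close> distance of
  two translates is \<open>2 \<integral>p - 2 \<integral>min\<close>, and the minimum is dominated by \<open>p\<close>.\<close>

lemma translation_continuous_L1:
  fixes p :: "'a::euclidean_space \<Rightarrow> real"
  assumes p: "integrable lborel p" and nonneg: "\<And>x. 0 \<le> p x"
    and cont: "AE x in lborel. isCont p x" and c: "c \<longlonglongrightarrow> 0"
  shows "(\<lambda>n. LBINT x. \<bar>p (c n + x) - p x\<bar>) \<longlonglongrightarrow> 0"
proof -
  have [measurable]: "p \<in> borel_measurable borel" using p by auto
  have shift: "integrable lborel (\<lambda>x. p (c n + x))" for n
    using lborel_integral_shift(2)[of p "c n"] p by simp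
  have min: "integrable lborel (\<lambda>x. min (p (c n + x)) (p x))" for n
    using p shift by auto
  have lim: "(\<lambda>n. LBINT x. min (p (c n + x)) (p x)) \<longlonglongrightarrow> (LBINT x. p x)"
  proof (rule integral_dominated_convergence[where w=p])
    show "AE x in lborel. (\<lambda>n. min (p (c n + x)) (p x)) \<longlonglongrightarrow> p x"
      using cont
    proof eventually_elim
      case (elim x)
      have "(\<lambda>n. c n + x) \<longlonglongrightarrow> 0 + x" by (intro tendsto_intros c)
      then have "(\<lambda>n. p (c n + x)) \<longlonglongrightarrow> p x"
        using isCont_tendsto_compose[OF elim] by simp
      then have "(\<lambda>n. min (p (c n + x)) (p x)) \<longlonglongrightarrow> min (p x) (p x)"
        by (intro tendsto_intros)
      then show ?case by simp
    qed
  qed (use p nonneg in auto)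
  have "(LBINT x. \<bar>p (c n + x) - p x\<bar>)
      = 2 * (LBINT x. p x) - 2 * (LBINT x. min (p (c n + x)) (p x))" for n
  proof -
    have "(LBINT x. \<bar>p (c n + x) - p x\<bar>)
        = (LBINT x. p (c n + x) + p x - 2 * min (p (c n + x)) (p x))"
      by (intro Bochner_Integration.integral_cong) (auto simp: min_def)
    also have "\<dots> = (LBINT x. p (c n + x)) + (LBINT x. p x)
        - 2 * (LBINT x. min (p (c n + x)) (p x))"
      using p shift min by simp
    finally show ?thesis using lborel_integral_shift(1)[of p "c n"] by simp
  qed
  moreover have "(\<lambda>n. 2 * (LBINT x. p x) - 2 * (LBINT x. min (p (c n + x)) (p x)))
      \<longlonglongrightarrow> 2 * (LBINT x. p x) - 2 * (LBINT x. p x)"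
    by (intro tendsto_intros lim)
  ultimately show ?thesis by simp
qed

text \<open>The translation is put on \<open>p\<close>: two values of the convolution differ by at
  most \<open>B\<close> times the \<open>L^1\<close> distance of two translates of \<open>p\<close>.
  Hence \<open>K\<close> can be a discontinuous reaction.\<close>

lemma isCont_convol:
  fixes p :: "'a::euclidean_space \<Rightarrow> real"
  assumes p: "integrable lborel p" and nonneg: "\<And>x. 0 \<le> p x"
    and cont: "AE x in lborel. isCont p x"
    and K[measurable]: "K \<in> borel_measurable borel" and B: "\<And>x. \<bar>K x\<bar> \<le> B"
  shows "isCont (convol p K) z"
  unfolding continuous_at_sequentially
proof (intro allI impI)
  fix x :: "nat \<Rightarrow> 'a" assume "x \<longlonglongrightarrow> z"
  then have c: "(\<lambda>n. x n - z) \<longlonglongrightarrow> 0"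
    using tendsto_diff[of x z sequentially "\<lambda>_. z" z] by simp
  have [measurable]: "p \<in> borel_measurable borel" using p by auto
  have le: "\<bar>convol p K (x n) - convol p K z\<bar> \<le> B * (LBINT y. \<bar>p (x n - z + y) - p y\<bar>)" for n
  proof -
    have "convol p K (x n) = (LBINT y. p (x n - z + y) * K (z - y))"
      unfolding convol_def using lborel_integral_shift(1)[of "\<lambda>y. p y * K (x n - y)" "x n - z"]
      by (simp add: algebra_simps)
    moreover have shift: "integrable lborel (\<lambda>y. p (x n - z + y))"
      using lborel_integral_shift(2)[of p "x n - z"] p by simp
    then have "integrable lborel (\<lambda>y. p (x n - z + y) * K (z - y))"
      using B by (intro integrable_mult_bounded[where B=B]) auto
    moreover have "integrable lborel (\<lambda>y. p y * K (z - y))"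
      using p B by (intro integrable_mult_bounded[where B=B]) auto
    ultimately have "convol p K (x n) - convol p K z
        = (LBINT y. (p (x n - z + y) - p y) * K (z - y))"
      by (simp add: convol_def left_diff_distrib)
    then show ?thesis
      using p shift B by (simp only:) (intro integral_mult_bounded, auto)
  qed
  have "(\<lambda>n. B * (LBINT y. \<bar>p (x n - z + y) - p y\<bar>)) \<longlonglongrightarrow> B * 0"
    by (intro tendsto_intros translation_continuous_L1[OF p nonneg cont c])
  then have "(\<lambda>n. convol p K (x n) - convol p K z) \<longlonglongrightarrow> 0"
    using le by (intro Lim_null_comparison[of "\<lambda>n. convol p K (x n) - convol p K z"]) auto
  then show "(convol p K \<circ> x) \<longlonglongrightarrow> convol p K z"
    by (simp add: LIM_zero_iff o_def)
qed

text \<open>Domination for the Fubini arguments on potentials. The map \<open>T\<close> embeds the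
  first variable into the space of the second: the identity for duality,
  \<open>\<lambda>x. (t, x)\<close> for integration at constant time,
  \<open>\<lambda>y. (h, y)\<close> for the semigroup law.\<close>

lemma integrable_product_shift:
  fixes f :: "'a::euclidean_space \<Rightarrow> real" and q :: "'b::euclidean_space \<Rightarrow> real"
  assumes f: "integrable lborel f" and q: "integrable lborel q"
    and T[measurable]: "T \<in> borel_measurable borel"
    and h[measurable]: "h \<in> borel_measurable (borel \<Otimes>\<^sub>M borel)" and B: "\<And>x. \<bar>h x\<bar> \<le> B"
  shows "integrable (lborel \<Otimes>\<^sub>M lborel) (\<lambda>(x, y). f x * q (y - T x) * h (x, y))"
proof -
  have [measurable]: "f \<in> borel_measurable borel" "q \<in> borel_measurable borel"
    using f q by auto
  have *: "integrable lborel (\<lambda>y. q (y - c))" "(LBINT y. norm (q (y - c))) = (LBINT y. norm (q y))" for c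
    using lborel_integral_shift(2)[of q "-c"] q lborel_integral_shift(1)[of "\<lambda>y. norm (q y)" "-c"]
    by simp_all
  have "integrable (lborel \<Otimes>\<^sub>M lborel) (\<lambda>z. f (fst z) * q (snd z - T (fst z)))"
  proof (rule lborel_pair.Fubini_integrable)
    show "(\<lambda>z. f (fst z) * q (snd z - T (fst z))) \<in> borel_measurable (lborel \<Otimes>\<^sub>M lborel)"
      by measurable
    have "integrable lborel (\<lambda>x. \<bar>f x\<bar> * (LBINT y. norm (q y)))"
      using f by auto
    then show "integrable lborel (\<lambda>x. LBINT y. norm (f (fst (x, y)) * q (snd (x, y) - T (fst (x, y)))))"
      using * by (simp add: abs_mult)
    show "AE x in lborel. integrable lborel (\<lambda>y. f (fst (x, y)) * q (snd (x, y) - T (fst (x, y))))"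
      using * by simp
  qed
  then have "integrable (lborel \<Otimes>\<^sub>M lborel) (\<lambda>z. (f (fst z) * q (snd z - T (fst z))) * h z)"
    by (rule integrable_mult_bounded[OF _ _ B]) auto
  then show ?thesis by (simp add: case_prod_beta')
qed

text \<open>Fubini moves the kernel from \<open>K\<close> to \<open>\<psi>\<close>. With
  \<open>\<psi>\<close> built from a test function, the weak identity for a potential reduces to an
  identity for each single source point \<open>y\<close>.\<close>

lemma integral_mult_convol:
  fixes \<psi> q K :: "'a::euclidean_space \<Rightarrow> real"
  assumes \<psi>: "integrable lborel \<psi>" and q: "integrable lborel q"
    and K[measurable]: "K \<in> borel_measurable borel" and B: "\<And>x. \<bar>K x\<bar> \<le> B"
  shows "(LBINT x. \<psi> x * convol q K x) = (LBINT y. K y * (LBINT x. \<psi> x * q (x - y)))"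
    and "integrable lborel (\<lambda>y. K y * (LBINT x. \<psi> x * q (x - y)))"
    and "integrable lborel (\<lambda>x. \<psi> x * convol q K x)"
proof -
  have [measurable]: "\<psi> \<in> borel_measurable borel" "q \<in> borel_measurable borel"
    using \<psi> q by auto
  have "integrable lborel (\<lambda>x. q (- x))"
    using q lborel_integral_reflect(2)[of q 0] by simp
  from integrable_product_shift[OF \<psi> this, where T="\<lambda>x. x" and h="\<lambda>z. K (snd z)" and B=B]
  have i: "integrable (lborel \<Otimes>\<^sub>M lborel) (\<lambda>(x, y). \<psi> x * q (x - y) * K y)"
    using B by simp
  have "(LBINT x. \<psi> x * convol q K x) = (LBINT x. LBINT y. \<psi> x * q (x - y) * K y)"
    by (simp add: convol_commute mult.assoc)
  also have "\<dots> = (LBINT y. LBINT x. \<psi> x * q (x - y) * K y)"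
    by (rule lborel_pair.Fubini_integral[symmetric, OF i])
  also have "\<dots> = (LBINT y. K y * (LBINT x. \<psi> x * q (x - y)))"
    by (simp add: mult.commute)
  finally show "(LBINT x. \<psi> x * convol q K x) = (LBINT y. K y * (LBINT x. \<psi> x * q (x - y)))" .
  show "integrable lborel (\<lambda>y. K y * (LBINT x. \<psi> x * q (x - y)))"
    using lborel_pair.integrable_snd[OF i] by (simp add: mult.commute)
  show "integrable lborel (\<lambda>x. \<psi> x * convol q K x)"
    using lborel_pair.integrable_fst[OF i] by (simp add: convol_commute mult.assoc)
qed

section \<open>The heat kernel\<close>

text \<open>The variance \<open>2 * s\<close> makes this the fundamental solution of
  \<open>u_t = u_xx\<close>; the value \<open>0\<close> for \<open>s \<le> 0\<close> lets a
  convolution over the whole plane look only into the past.\<close>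

definition gauss :: "real \<Rightarrow> real \<Rightarrow> real" where
  "gauss s r = (if 0 < s then normal_density 0 (sqrt (2 * s)) r else 0)"

definition heat_kernel :: "real \<Rightarrow> real \<times> real \<Rightarrow> real" where
  "heat_kernel \<omega> = (\<lambda>(s, r). exp (- \<omega>\<^sup>2 * s) * gauss s r)"

definition heat_kernel_dx :: "real \<Rightarrow> real \<times> real \<Rightarrow> real" where
  "heat_kernel_dx \<omega> = (\<lambda>(s, r). - (r / (2 * s)) * heat_kernel \<omega> (s, r))"

definition heat_kernel_dxx :: "real \<Rightarrow> real \<times> real \<Rightarrow> real" where
  "heat_kernel_dxx \<omega> = (\<lambda>(s, r). (r\<^sup>2 / (4 * s\<^sup>2) - 1 / (2 * s)) * heat_kernel \<omega> (s, r))"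

lemma gauss_eq: "0 < s \<Longrightarrow> gauss s r = exp (- r\<^sup>2 / (4 * s)) / sqrt (4 * pi * s)"
  by (simp add: gauss_def normal_density_def mult.assoc mult.left_commute)

lemma gauss_nonneg [simp]: "0 \<le> gauss s r"
  by (simp add: gauss_def)

lemma gauss_minus [simp]: "gauss s (- r) = gauss s r"
  by (simp add: gauss_def normal_density_def)

lemma borel_measurable_gauss [measurable]:
  "(\<lambda>z. gauss (fst z) (snd z)) \<in> borel_measurable (borel \<Otimes>\<^sub>M borel)"
  unfolding gauss_def normal_density_def by measurable

lemma borel_measurable_gauss2 [measurable]: "gauss s \<in> borel_measurable borel"
  unfolding gauss_def[abs_def] by (cases "0 < s") simp_all

lemma integrable_gauss [simp]: "integrable lborel (gauss s)"
  unfolding gauss_def[abs_def] by (cases "0 < s") auto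

lemma integral_gauss: "0 < s \<Longrightarrow> (LBINT r. gauss s r) = 1"
  by (simp add: gauss_def)

lemma gauss_fourth_moment:
  assumes "0 < s"
  shows "integrable lborel (\<lambda>r. gauss s r * r ^ 4)" "(LBINT r. gauss s r * r ^ 4) = 12 * s\<^sup>2"
proof -
  have *: "gauss s r * r ^ 4 = normal_density 0 (sqrt (2 * s)) r * (r - 0) ^ (2 * 2)" for r
    using assms by (simp add: gauss_def)
  have "fact (2 * 2) / ((2 / (sqrt (2 * s))\<^sup>2)\<^sup>2 * fact 2) = 12 * s\<^sup>2"
    using assms by (simp add: fact_numeral field_simps power2_eq_square)
  then show "(LBINT r. gauss s r * r ^ 4) = 12 * s\<^sup>2"
    unfolding * using assms by (subst integral_normal_moment_even) auto
  show "integrable lborel (\<lambda>r. gauss s r * r ^ 4)"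
    unfolding * using assms by (intro integrable_normal_moment) auto
qed

text \<open>Chebyshev's inequality with the fourth moment, because order \<open>s^2\<close> is
  wanted: the second moment would give order \<open>s\<close>, which the gain
  \<open>\<eta> * h\<close> in the minimum principle could not beat.\<close>

lemma gauss_tail:
  assumes "0 < s" "0 < d"
  shows "(LBINT r. gauss s r * indicator {r. d \<le> \<bar>r\<bar>} r) \<le> 12 * s\<^sup>2 / d ^ 4"
proof -
  have "(LBINT r. gauss s r * indicator {r. d \<le> \<bar>r\<bar>} r) \<le> (LBINT r. gauss s r * r ^ 4 / d ^ 4)"
  proof (rule integral_mono)
    show "integrable lborel (\<lambda>r. gauss s r * indicator {r. d \<le> \<bar>r\<bar>} r)"
      by (rule integrable_mult_bounded[where B=1]) (auto simp: indicator_def)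
    show "integrable lborel (\<lambda>r. gauss s r * r ^ 4 / d ^ 4)"
      using gauss_fourth_moment(1)[OF assms(1)] by simp
    show "gauss s r * indicator {r. d \<le> \<bar>r\<bar>} r \<le> gauss s r * r ^ 4 / d ^ 4" for r
    proof (cases "d \<le> \<bar>r\<bar>")
      case True
      then have "d ^ 4 \<le> r ^ 4"
        using power_mono[of d "\<bar>r\<bar>" 4] assms by (simp add: power_even_abs)
      then have "gauss s r * d ^ 4 \<le> gauss s r * r ^ 4"
        by (simp add: mult_left_mono)
      then show ?thesis using True assms by (simp add: field_simps)
    qed (use assms in \<open>auto simp: zero_le_even_power\<close>)
  qed
  then show ?thesis using gauss_fourth_moment(2)[OF assms(1)] by simp
qed

lemma gauss_semigroup:
  assumes "0 < s" "0 < h"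
  shows "gauss (s + h) r = (LBINT y. gauss h y * gauss s (r - y))"
proof -
  have sq: "sqrt ((sqrt (2 * s))\<^sup>2 + (sqrt (2 * h))\<^sup>2) = sqrt (2 * (s + h))"
    using assms by simp
  have "(\<integral>\<^sup>+y. ennreal (gauss h y * gauss s (r - y)) \<partial>lborel) = ennreal (gauss (s + h) r)"
    using fun_cong[OF conv_normal_density_zero_mean[of "sqrt (2 * s)" "sqrt (2 * h)"], of r] assms
    unfolding sq by (simp add: gauss_def mult.commute)
  then show ?thesis by (simp add: integral_eq_nn_integral)
qed

lemma heat_kernel_nonneg [simp]: "0 \<le> heat_kernel \<omega> z"
  by (simp add: heat_kernel_def split_beta)

lemma heat_kernel_nonpos: "s \<le> 0 \<Longrightarrow> heat_kernel \<omega> (s, r) = 0"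
  by (simp add: heat_kernel_def gauss_def)

lemma heat_kernel_dx_nonpos: "s \<le> 0 \<Longrightarrow> heat_kernel_dx \<omega> (s, r) = 0"
  by (simp add: heat_kernel_dx_def heat_kernel_nonpos)

lemma heat_kernel_minus: "heat_kernel \<omega> (s, - r) = heat_kernel \<omega> (s, r)"
  by (simp add: heat_kernel_def)

lemma heat_kernel_dx_minus: "heat_kernel_dx \<omega> (s, - r) = - heat_kernel_dx \<omega> (s, r)"
  by (simp add: heat_kernel_dx_def heat_kernel_minus)

lemma borel_measurable_heat_kernel [measurable]: "heat_kernel \<omega> \<in> borel_measurable borel"
proof -
  have "heat_kernel \<omega> \<in> borel_measurable (borel \<Otimes>\<^sub>M borel)"
    unfolding heat_kernel_def split_beta by measurable
  then show ?thesis by (simp add: borel_prod)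
qed

lemma borel_measurable_heat_kernel_dx [measurable]: "heat_kernel_dx \<omega> \<in> borel_measurable borel"
proof -
  have "heat_kernel \<omega> \<in> borel_measurable (borel \<Otimes>\<^sub>M borel)"
    by (simp add: borel_prod)
  then have "heat_kernel_dx \<omega> \<in> borel_measurable (borel \<Otimes>\<^sub>M borel)"
    unfolding heat_kernel_dx_def split_beta by measurable
  then show ?thesis by (simp add: borel_prod)
qed

lemma has_real_derivative_heat_kernel_x:
  assumes "0 < s"
  shows "((\<lambda>r. heat_kernel \<omega> (s, r)) has_real_derivative heat_kernel_dx \<omega> (s, r)) (at r within A)"
  using assms
  by (auto simp: heat_kernel_def heat_kernel_dx_def gauss_eq intro!: derivative_eq_intros)
    (simp add: field_simps)

lemma has_real_derivative_heat_kernel_xx: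
  assumes "0 < s"
  shows "((\<lambda>r. heat_kernel_dx \<omega> (s, r)) has_real_derivative heat_kernel_dxx \<omega> (s, r)) (at r within A)"
  using assms unfolding heat_kernel_dx_def heat_kernel_dxx_def
  by (auto intro!: derivative_eq_intros has_real_derivative_heat_kernel_x)
    (simp add: heat_kernel_dx_def field_simps power2_eq_square)

text \<open>This is the heat equation, with the time derivative already expressed by
  \<open>heat_kernel_dxx\<close> as the integration by parts uses it. The root is isolated in
  \<open>c\<close>, where \<open>c s * c s = 4 * pi * s\<close> replaces all computation with square
  roots.\<close>

lemma has_real_derivative_heat_kernel_t:
  assumes "0 < s"
  shows "((\<lambda>s. heat_kernel \<omega> (s, r)) has_real_derivative
    heat_kernel_dxx \<omega> (s, r) - \<omega>\<^sup>2 * heat_kernel \<omega> (s, r)) (at s)"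
proof -
  define A where "A = (\<lambda>s. exp (- \<omega>\<^sup>2 * s) * exp (- r\<^sup>2 / (4 * s)))"
  define c where "c = (\<lambda>s. sqrt (4 * pi * s))"
  define q where "q = (\<lambda>s. A s / c s)"
  have c: "0 < c s" "c s * c s = 4 * pi * s" using assms by (simp_all add: c_def)
  have "(c has_real_derivative 4 * pi / c s / 2) (at s)"
    unfolding c_def using mult_pos_pos[OF pi_gt_zero assms]
    by (auto intro!: derivative_eq_intros simp: inverse_eq_divide)
  moreover have "4 * pi / c s / 2 = c s / (2 * s)"
    using c assms by (simp add: field_simps)
  ultimately have dc: "(c has_real_derivative c s / (2 * s)) (at s)" by simp
  have "(A has_real_derivative (r\<^sup>2 / (4 * s\<^sup>2) - \<omega>\<^sup>2) * A s) (at s)"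
    unfolding A_def using assms
    by (auto intro!: derivative_eq_intros) (simp add: field_simps power2_eq_square)
  from DERIV_divide[OF this dc less_imp_neq[OF c(1), symmetric]]
  have "(q has_real_derivative (r\<^sup>2 / (4 * s\<^sup>2) - 1 / (2 * s)) * q s - \<omega>\<^sup>2 * q s) (at s)"
    unfolding q_def by (rule DERIV_cong) (use c(1) assms in \<open>simp add: field_simps\<close>)
  moreover have "\<forall>\<^sub>F t in nhds s. heat_kernel \<omega> (t, r) = q t"
    using eventually_nhds_in_open[of "{0<..}" s] assms
    by (auto elim!: eventually_mono simp: heat_kernel_def gauss_eq q_def A_def c_def)
  ultimately have "((\<lambda>s. heat_kernel \<omega> (s, r)) has_real_derivative
      (r\<^sup>2 / (4 * s\<^sup>2) - 1 / (2 * s)) * q s - \<omega>\<^sup>2 * q s) (at s)"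
    by (subst DERIV_cong_ev[OF refl _ refl]) auto
  moreover have "q s = heat_kernel \<omega> (s, r)"
    using assms by (simp add: heat_kernel_def gauss_eq q_def A_def c_def)
  ultimately show ?thesis by (simp add: heat_kernel_dxx_def)
qed

lemma isCont_heat_kernel:
  assumes "s \<noteq> 0"
  shows "isCont (heat_kernel \<omega>) (s, r)"
proof (cases "0 < s")
  case True
  have "\<forall>\<^sub>F z in nhds (s, r). heat_kernel \<omega> z
      = exp (- \<omega>\<^sup>2 * fst z) * (exp (- (snd z)\<^sup>2 / (4 * fst z)) / sqrt (4 * pi * fst z))"
    using eventually_nhds_in_open[of "{0<..} \<times> UNIV" "(s, r)"] True
    by (auto elim!: eventually_mono simp: heat_kernel_def gauss_eq open_Times)
  moreover have "isCont (\<lambda>z::real \<times> real.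
      exp (- \<omega>\<^sup>2 * fst z) * (exp (- (snd z)\<^sup>2 / (4 * fst z)) / sqrt (4 * pi * fst z))) (s, r)"
    using True by (intro continuous_intros) auto
  ultimately show ?thesis by (subst isCont_cong)
next
  case False
  have "\<forall>\<^sub>F z in nhds (s, r). heat_kernel \<omega> z = 0"
    using eventually_nhds_in_open[of "{..<0} \<times> UNIV" "(s, r)"] False assms
    by (auto elim!: eventually_mono simp: heat_kernel_nonpos open_Times)
  then show ?thesis by (subst isCont_cong) auto
qed

text \<open>The line \<open>s = 0\<close> is a null set of the plane, and the kernel is continuous
  off it; \<open>isCont_convol\<close> asks for continuity in this form.\<close>

lemma AE_isCont_heat_kernel: "AE z in lborel. isCont (heat_kernel \<omega>) z"
proof -
  have "AE z::real \<times> real in lborel \<Otimes>\<^sub>M lborel. fst z \<noteq> 0"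
  proof (rule lborel_pair.AE_pair_measure)
    show "AE s in lborel. AE r in lborel. fst (s::real, r::real) \<noteq> 0"
      using AE_lborel_singleton[of "0::real"] by eventually_elim simp
  qed measurable
  then have "AE z::real \<times> real in lborel. fst z \<noteq> 0" unfolding lborel_prod .
  then show ?thesis
    by eventually_elim (metis isCont_heat_kernel prod.collapse)
qed

text \<open>The Gamma integral. It serves the kernel with \<open>z = 1\<close> and its space
  derivative with \<open>z = 1/2\<close>, since the \<open>L^1\<close> norm of the latter in space
  behaves like \<open>s powr (-1/2)\<close> for small times.\<close>

lemma integrable_exp_powr:
  assumes "0 < z" "0 < a"
  shows "integrable lborel (\<lambda>s::real. indicator {0<..} s * (s powr (z - 1) / exp (a * s)))"
proof -
  have "(\<lambda>t. complex_of_real t powr (of_real z - 1) / of_real (exp (a * t))) absolutely_integrable_on {0<..}"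
    using assms by (intro absolutely_integrable_Gamma_integral) auto
  from absolutely_integrable_norm[OF this]
  have "integrable lebesgue (\<lambda>t. indicator {0<..} t *\<^sub>R norm (complex_of_real t powr (of_real z - 1) / of_real (exp (a * t))))"
    by (simp add: o_def set_integrable_def)
  moreover have "indicator {0<..} t *\<^sub>R norm (complex_of_real t powr (of_real z - 1) / of_real (exp (a * t)))
      = indicator {0<..} t * (t powr (z - 1) / exp (a * t))" for t
    by (auto simp: indicator_def norm_divide norm_powr_real_powr)
  ultimately have "integrable lebesgue (\<lambda>s::real. indicator {0<..} s * (s powr (z - 1) / exp (a * s)))"
    by simp
  then show ?thesis by (subst (asm) integrable_completion) auto
qed

lemma integrable_heat_kernel:
  assumes "0 < \<omega>"
  shows "integrable lborel (heat_kernel \<omega>)"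
proof -
  have "integrable (lborel \<Otimes>\<^sub>M lborel) (heat_kernel \<omega>)"
  proof (rule lborel_pair.Fubini_integrable)
    have "integrable lborel (\<lambda>s::real. indicator {0<..} s * (s powr (1 - 1) / exp (\<omega>\<^sup>2 * s)))"
      using assms by (intro integrable_exp_powr) auto
    moreover have "indicator {0<..} s * (s powr (1 - 1) / exp (\<omega>\<^sup>2 * s))
        = (LBINT r. norm (heat_kernel \<omega> (s, r)))" for s
      by (cases "0 < s") (auto simp: heat_kernel_def integral_gauss exp_minus field_simps gauss_def)
    ultimately show "integrable lborel (\<lambda>s. LBINT r. norm (heat_kernel \<omega> (s, r)))" by simp
  qed (auto simp: heat_kernel_def split_beta)
  then show ?thesis by (simp add: lborel_prod)
qed

text \<open>The first absolute moment of the Gaussian turns the factor \<open>1 / (2 * s)\<close>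
  into \<open>1 / sqrt (pi * s)\<close>, which is integrable at \<open>0\<close>. A second space
  derivative would cost \<open>1 / s\<close>, so potentials are differentiated only once.\<close>

lemma integrable_heat_kernel_dx:
  assumes "0 < \<omega>"
  shows "integrable lborel (heat_kernel_dx \<omega>)"
proof -
  have odd: "0 < s \<Longrightarrow> integrable lborel (\<lambda>r. gauss s r * \<bar>r\<bar>)" for s
    using integrable_normal_moment_abs[of "sqrt (2 * s)" 0 1] by (simp add: gauss_def)
  have mom: "0 < s \<Longrightarrow> (LBINT r. gauss s r * \<bar>r\<bar>) = sqrt (2 * s) * sqrt (2 / pi)" for s
    using integral_normal_moment_abs_odd[of "sqrt (2 * s)" 0 0] by (simp add: gauss_def)
  have eq: "\<bar>heat_kernel_dx \<omega> (s, r)\<bar> = exp (- \<omega>\<^sup>2 * s) / (2 * s) * (gauss s r * \<bar>r\<bar>)" if "0 < s" for s r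
    using that by (simp add: heat_kernel_dx_def heat_kernel_def abs_mult)
  have "integrable (lborel \<Otimes>\<^sub>M lborel) (heat_kernel_dx \<omega>)"
  proof (rule lborel_pair.Fubini_integrable)
    have "integrable lborel (\<lambda>s::real. sqrt (1 / pi) * (indicator {0<..} s * (s powr (1/2 - 1) / exp (\<omega>\<^sup>2 * s))))"
      using assms by (intro integrable_exp_powr integrable_mult_right) auto
    moreover have "sqrt (1 / pi) * (indicator {0<..} s * (s powr (1/2 - 1) / exp (\<omega>\<^sup>2 * s)))
        = (LBINT r. norm (heat_kernel_dx \<omega> (s, r)))" for s
    proof (cases "0 < s")
      case True
      have "s powr (1/2 - 1) = 1 / sqrt s"
        using True by (simp add: powr_minus powr_half_sqrt[symmetric] field_simps)
      moreover have "sqrt (2 * s) * sqrt (2 / pi) / (2 * s) = sqrt (1 / pi) * (1 / sqrt s)"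
        using True real_sqrt_mult_self[of s] by (simp add: real_sqrt_mult real_sqrt_divide field_simps)
      moreover have "(LBINT r. norm (heat_kernel_dx \<omega> (s, r)))
          = exp (- \<omega>\<^sup>2 * s) * (sqrt (2 * s) * sqrt (2 / pi) / (2 * s))"
        using True by (simp add: eq mom)
      ultimately have "(LBINT r. norm (heat_kernel_dx \<omega> (s, r)))
          = exp (- \<omega>\<^sup>2 * s) * (sqrt (1 / pi) * s powr (1/2 - 1))" by simp
      moreover have "exp (- \<omega>\<^sup>2 * s) = inverse (exp (\<omega>\<^sup>2 * s))" by (simp add: exp_minus)
      ultimately show ?thesis using True by (simp only: indicator_simps greaterThan_iff if_True divide_inverse) simp
    qed (simp add: heat_kernel_dx_nonpos)
    ultimately show "integrable lborel (\<lambda>s. LBINT r. norm (heat_kernel_dx \<omega> (s, r)))" by simp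
    show "AE s in lborel. integrable lborel (\<lambda>r. heat_kernel_dx \<omega> (s, r))"
    proof (intro AE_I2)
      fix s :: real
      show "integrable lborel (\<lambda>r. heat_kernel_dx \<omega> (s, r))"
      proof (cases "0 < s")
        case True
        show ?thesis
          by (rule Bochner_Integration.integrable_bound[OF integrable_mult_right[OF odd[OF True], of "exp (- \<omega>\<^sup>2 * s) / (2 * s)"]])
            (use True in \<open>auto simp: eq abs_mult\<close>)
      qed (simp add: heat_kernel_dx_nonpos)
    qed
  qed (simp add: lborel_prod)
  then show ?thesis by (simp add: lborel_prod)
qed


section \<open>The integral of the heat kernel over time\<close>

lemma gaussian_antiderivative:
  obtains N :: "real \<Rightarrow> real"
  where "\<And>x. (N has_real_derivative exp (- x\<^sup>2)) (at x)"
    "(N \<longlongrightarrow> sqrt pi / 2) at_top" "(N \<longlongrightarrow> - (sqrt pi / 2)) at_bot"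
proof -
  obtain F :: "real \<Rightarrow> real" where F: "\<And>x. (F has_real_derivative exp (- x\<^sup>2)) (at x)"
    using einterval_antiderivative[of "-\<infinity>" "\<infinity>" "\<lambda>x::real. exp (- x\<^sup>2)"]
    by (auto simp: has_real_derivative_iff_has_vector_derivative)
  define N where "N = (\<lambda>x. F x - F 0)"
  have N: "(N has_real_derivative exp (- x\<^sup>2)) (at x)" for x
    unfolding N_def using F[of x] by (auto intro!: derivative_eq_intros)
  have top: "(N \<longlongrightarrow> sqrt pi / 2) at_top"
  proof -
    have "set_integrable lborel {0..} (\<lambda>x::real. exp (- x\<^sup>2))"
      using gaussian_moment_0 by (simp add: set_integrable_def has_bochner_integral_iff)
    from tendsto_set_lebesgue_integral_at_top[OF _ this]
    have "((\<lambda>b. LINT x:{0..b}|lborel. exp (- x\<^sup>2)) \<longlongrightarrow> sqrt pi / 2) at_top"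
      unfolding set_lebesgue_integral_def has_bochner_integral_integral_eq[OF gaussian_moment_0]
      by simp
    moreover have "\<forall>\<^sub>F b in at_top. (LINT x:{0..b}|lborel. exp (- x\<^sup>2)) = N b"
    proof (rule eventually_mono[OF eventually_ge_at_top[of 0]])
      fix b :: real assume "0 \<le> b"
      then have "(LINT x:{0..b}|lborel. exp (- x\<^sup>2)) = F b - F 0"
        unfolding set_lebesgue_integral_def
        by (intro integral_FTC_atLeastAtMost)
          (auto intro!: continuous_intros F[THEN has_real_derivative_iff_has_vector_derivative[THEN iffD1], THEN has_vector_derivative_at_within])
      then show "(LINT x:{0..b}|lborel. exp (- x\<^sup>2)) = N b" by (simp add: N_def)
    qed
    ultimately show ?thesis by (rule Lim_transform_eventually)
  qed
  \<comment> \<open>Evenness of the integrand makes this sum constant, so \<open>N\<close> is odd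
    and its limit at \<open>at_bot\<close> follows from the one at \<open>at_top\<close>.\<close>
  have "N x + N (- x) = N 0 + N (- 0)" for x
  proof (rule DERIV_isconst_all[of "\<lambda>x. N x + N (- x)", rule_format])
    show "((\<lambda>x. N x + N (- x)) has_real_derivative 0) (at x)" for x
    proof -
      have "((\<lambda>x. N (- x)) has_real_derivative exp (- (- x)\<^sup>2) * - 1) (at x)"
        by (rule DERIV_chain2[OF N]) (auto intro!: derivative_eq_intros)
      from DERIV_add[OF N this] show ?thesis by simp
    qed
  qed
  then have odd: "N (- x) = - N x" for x by (smt (verit) N_def)
  have "((\<lambda>x. - N (- x)) \<longlongrightarrow> - (sqrt pi / 2)) at_bot"
    by (intro tendsto_intros filterlim_compose[OF top filterlim_uminus_at_top_at_bot])
  then have "(N \<longlongrightarrow> - (sqrt pi / 2)) at_bot" by (simp add: odd)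
  with that N top show ?thesis by blast
qed

text \<open>The antiderivative comes from \<open>(\<omega> \<surd>s \<mp> r / (2 \<surd>s))\<^sup>2 = \<omega>\<^sup>2 s \<mp> \<omega> r + r\<^sup>2 / (4 s)\<close>.\<close>

lemma laplace_transform_heat_kernel:
  assumes "0 < \<omega>" "r \<noteq> 0"
  shows "integrable lborel (\<lambda>s. heat_kernel \<omega> (s, r))"
    and "(LBINT s. heat_kernel \<omega> (s, r)) = exp (- \<omega> * \<bar>r\<bar>) / (2 * \<omega>)"
proof -
  define \<rho> where "\<rho> = \<bar>r\<bar>"
  have \<rho>: "0 < \<rho>" "\<rho>\<^sup>2 = r\<^sup>2" using assms by (simp_all add: \<rho>_def)
  obtain N where N: "\<And>x. (N has_real_derivative exp (- x\<^sup>2)) (at x)"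
    and top: "(N \<longlongrightarrow> sqrt pi / 2) at_top" and bot: "(N \<longlongrightarrow> - (sqrt pi / 2)) at_bot"
    using gaussian_antiderivative by blast
  define a where "a = (\<lambda>c s. \<omega> * sqrt s + c * \<rho> / (2 * sqrt s))"
  define F where "F = (\<lambda>s. (exp (- \<omega> * \<rho>) * N (a (-1) s) + exp (\<omega> * \<rho>) * N (a 1 s)) / (2 * \<omega> * sqrt pi))"
  have deriv: "(F has_real_derivative heat_kernel \<omega> (s, r)) (at s)" if s: "0 < s" for s
  proof -
    have sq: "sqrt s * sqrt s = s" using s by simp
    have da: "(a c has_real_derivative (\<omega> / (2 * sqrt s) - c * \<rho> / (4 * s * sqrt s))) (at s)" for c
    proof -
      have "(a c has_real_derivative (\<omega> * (inverse (sqrt s) / 2)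
          + c * \<rho> / 2 * - (inverse (sqrt s) * (inverse (sqrt s) / 2) * inverse (sqrt s)))) (at s)"
      proof -
        have "a c = (\<lambda>s. \<omega> * sqrt s + c * \<rho> / 2 * inverse (sqrt s))"
          by (auto simp: a_def field_simps)
        then show ?thesis using s
          by (simp only:) (intro DERIV_add DERIV_cmult DERIV_inverse' DERIV_real_sqrt, auto)
      qed
      then show ?thesis
        by (rule DERIV_cong) (use s sq in \<open>simp add: field_simps\<close>)
    qed
    have sqa: "exp (c * \<omega> * \<rho>) * exp (- (a c s)\<^sup>2) = exp (- \<omega>\<^sup>2 * s) * exp (- r\<^sup>2 / (4 * s))"
      if "c = 1 \<or> c = -1" for c
    proof -
      have "(a c s)\<^sup>2 = \<omega>\<^sup>2 * (sqrt s * sqrt s) + c * \<omega> * \<rho> + c\<^sup>2 * \<rho>\<^sup>2 / (4 * (sqrt s * sqrt s))"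
      proof -
        have "(\<omega> * w + c * \<rho> / (2 * w))\<^sup>2 = \<omega>\<^sup>2 * (w * w) + c * \<omega> * \<rho> + c\<^sup>2 * \<rho>\<^sup>2 / (4 * (w * w))"
          if "w \<noteq> 0" for w
          using that by (simp add: power2_eq_square field_simps)
        from this[of "sqrt s"] s show ?thesis by (simp only: a_def real_sqrt_eq_zero_cancel_iff)
      qed
      then have "(a c s)\<^sup>2 = \<omega>\<^sup>2 * s + c * \<omega> * \<rho> + r\<^sup>2 / (4 * s)"
        using that \<rho> unfolding sq by auto
      then show ?thesis by (simp add: exp_add[symmetric])
    qed
    have "(F has_real_derivative
       (exp (- \<omega> * \<rho>) * (exp (- (a (-1) s)\<^sup>2) * (\<omega> / (2 * sqrt s) - (-1) * \<rho> / (4 * s * sqrt s)))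
      + exp (\<omega> * \<rho>) * (exp (- (a 1 s)\<^sup>2) * (\<omega> / (2 * sqrt s) - 1 * \<rho> / (4 * s * sqrt s)))) / (2 * \<omega> * sqrt pi)) (at s)"
      unfolding F_def by (intro DERIV_cdivide DERIV_add DERIV_cmult DERIV_chain2[OF N da])
    also have "exp (- \<omega> * \<rho>) * (exp (- (a (-1) s)\<^sup>2) * (\<omega> / (2 * sqrt s) - (-1) * \<rho> / (4 * s * sqrt s)))
      + exp (\<omega> * \<rho>) * (exp (- (a 1 s)\<^sup>2) * (\<omega> / (2 * sqrt s) - 1 * \<rho> / (4 * s * sqrt s)))
      = exp (- \<omega>\<^sup>2 * s) * exp (- r\<^sup>2 / (4 * s)) * (\<omega> / sqrt s)"
      using sqa[of 1] sqa[of "-1"]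
      by (simp add: mult.assoc[symmetric]) (simp add: algebra_simps)
    also have "exp (- \<omega>\<^sup>2 * s) * exp (- r\<^sup>2 / (4 * s)) * (\<omega> / sqrt s) / (2 * \<omega> * sqrt pi) = heat_kernel \<omega> (s, r)"
      using s assms by (simp add: heat_kernel_def gauss_eq real_sqrt_mult field_simps)
    finally show ?thesis .
  qed
  \<comment> \<open>Near \<open>0\<close> the arguments of \<open>N\<close> tend to minus and to
    plus infinity, at infinity both tend to plus infinity. The terms with
    \<open>exp (\<omega> * \<rho>)\<close> have the same limit at both ends and cancel.\<close>
  have lim0: "(F \<longlongrightarrow> (exp (- \<omega> * \<rho>) * - (sqrt pi / 2) + exp (\<omega> * \<rho>) * (sqrt pi / 2)) / (2 * \<omega> * sqrt pi)) (at_right 0)"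
  proof -
    have "filterlim (a (-1)) at_bot (at_right 0)" "filterlim (a 1) at_top (at_right 0)"
      unfolding a_def using assms(1) \<rho>(1) by real_asymp+
    then show ?thesis unfolding F_def using assms(1)
      by (intro tendsto_intros filterlim_compose[OF top] filterlim_compose[OF bot]) auto
  qed
  have liminf: "(F \<longlongrightarrow> (exp (- \<omega> * \<rho>) * (sqrt pi / 2) + exp (\<omega> * \<rho>) * (sqrt pi / 2)) / (2 * \<omega> * sqrt pi)) at_top"
  proof -
    have "filterlim (a (-1)) at_top at_top" "filterlim (a 1) at_top at_top"
      unfolding a_def using assms(1) \<rho>(1) by real_asymp+
    then show ?thesis unfolding F_def using assms(1)
      by (intro tendsto_intros filterlim_compose[OF top]) auto
  qed
  have cont: "isCont (\<lambda>s. heat_kernel \<omega> (s, r)) s" if "0 < s" for s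
    using DERIV_isCont[OF has_real_derivative_heat_kernel_t[OF that]] .
  have eq: "indicator (einterval 0 \<infinity>) s *\<^sub>R heat_kernel \<omega> (s, r) = heat_kernel \<omega> (s, r)" for s
    by (auto simp: indicator_def einterval_def heat_kernel_nonpos zero_ereal_def)
  have "set_integrable lborel (einterval 0 \<infinity>) (\<lambda>s. heat_kernel \<omega> (s, r))"
    "(LBINT s=0..\<infinity>. heat_kernel \<omega> (s, r))
      = (exp (- \<omega> * \<rho>) * (sqrt pi / 2) + exp (\<omega> * \<rho>) * (sqrt pi / 2)) / (2 * \<omega> * sqrt pi)
      - (exp (- \<omega> * \<rho>) * - (sqrt pi / 2) + exp (\<omega> * \<rho>) * (sqrt pi / 2)) / (2 * \<omega> * sqrt pi)"
    using lim0 liminf deriv cont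
    by (intro interval_integral_FTC_nonneg[where F=F]; auto simp: ereal_tendsto_simps zero_ereal_def)+
  moreover have "(exp (- \<omega> * \<rho>) * (sqrt pi / 2) + exp (\<omega> * \<rho>) * (sqrt pi / 2)) / (2 * \<omega> * sqrt pi)
      - (exp (- \<omega> * \<rho>) * - (sqrt pi / 2) + exp (\<omega> * \<rho>) * (sqrt pi / 2)) / (2 * \<omega> * sqrt pi)
      = exp (- \<omega> * \<rho>) / (2 * \<omega>)"
    using assms(1) by (simp add: field_simps)
  ultimately show "integrable lborel (\<lambda>s. heat_kernel \<omega> (s, r))"
    "(LBINT s. heat_kernel \<omega> (s, r)) = exp (- \<omega> * \<bar>r\<bar>) / (2 * \<omega>)"
    by (simp_all add: set_integrable_def interval_lebesgue_integral_def set_lebesgue_integral_def eq[unfolded real_scaleR_def] \<rho>_def zero_ereal_def[symmetric])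
qed

section \<open>Even-odd reflection\<close>

text \<open>A triangle wave of period 4, the distance of \<open>y\<close> from the nearest multiple
  of 4. Written with \<open>arccos\<close> and \<open>cos\<close>, it takes evenness, continuity and
  the point symmetry about 1 from the cosine.\<close>

definition fold_dist :: "real \<Rightarrow> real" where
  "fold_dist y = 2 / pi * arccos (cos (pi * y / 2))"

text \<open>Even about \<open>0\<close> and odd about \<open>1\<close>: this encodes the Neumann condition at \<open>0\<close> and the
  Dirichlet condition at \<open>1\<close>. Only the values of \<open>k\<close> on \<open>[0, 1)\<close> are used.\<close>

definition reflect :: "(real \<Rightarrow> real) \<Rightarrow> real \<Rightarrow> real" where
  "reflect k y = (if fold_dist y < 1 then k (fold_dist y)
     else if fold_dist y > 1 then - k (2 - fold_dist y) else 0)"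

lemma fold_dist_bounds: "0 \<le> fold_dist y" "fold_dist y \<le> 2"
  using arccos_lbound[of "cos (pi * y / 2)"] arccos_ubound[of "cos (pi * y / 2)"]
  by (auto simp: fold_dist_def field_simps)

lemma fold_dist_minus: "fold_dist (- y) = fold_dist y"
  by (simp add: fold_dist_def)

lemma fold_dist_diff: "fold_dist (2 - y) = 2 - fold_dist y"
proof -
  have "cos (pi * (2 - y) / 2) = - cos (pi * y / 2)"
  proof -
    have "pi * (2 - y) / 2 = pi - pi * y / 2" by (simp add: field_simps)
    then show ?thesis by (simp only: cos_diff) simp
  qed
  then show ?thesis
    by (simp add: fold_dist_def arccos_minus field_simps)
qed

lemma fold_dist_eq: "0 \<le> y \<Longrightarrow> y \<le> 2 \<Longrightarrow> fold_dist y = y"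
  by (simp add: fold_dist_def arccos_cos)

lemma borel_measurable_fold_dist [measurable]: "fold_dist \<in> borel_measurable borel"
proof -
  have "continuous_on UNIV (\<lambda>y. 2 / pi * arccos (cos (pi * y / 2)))"
    by (intro continuous_intros) auto
  then show ?thesis
    by (intro borel_measurable_continuous_onI) (simp add: fold_dist_def[abs_def])
qed

lemma reflect_minus: "reflect k (- y) = reflect k y"
  by (simp add: reflect_def fold_dist_minus)

lemma reflect_diff: "reflect k (2 - y) = - reflect k y"
  by (auto simp: reflect_def fold_dist_diff)

lemma reflect_eq: "0 \<le> y \<Longrightarrow> y < 1 \<Longrightarrow> reflect k y = k y"
  by (simp add: reflect_def fold_dist_eq)

lemma reflect_eq_abs: "- 1 < y \<Longrightarrow> y < 1 \<Longrightarrow> reflect k y = k \<bar>y\<bar>"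
  using reflect_eq[of y k] reflect_eq[of "- y" k] reflect_minus[of k y] by (cases "0 \<le> y") auto

lemma reflect_bounded:
  assumes "\<And>x. 0 \<le> x \<Longrightarrow> x < 1 \<Longrightarrow> \<bar>k x\<bar> \<le> B" "0 \<le> B"
  shows "\<bar>reflect k y\<bar> \<le> B"
  using assms fold_dist_bounds[of y] by (auto simp: reflect_def)

lemma reflect_LIMSEQ:
  assumes "\<And>x. 0 \<le> x \<Longrightarrow> x < 1 \<Longrightarrow> (\<lambda>n. k n x) \<longlonglongrightarrow> l x"
  shows "(\<lambda>n. reflect (k n) y) \<longlonglongrightarrow> reflect l y"
  using assms fold_dist_bounds[of y] by (auto simp: reflect_def intro!: tendsto_minus)

lemma reflect_diff_fun: "reflect k y - reflect l y = reflect (\<lambda>x. k x - l x) y"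
  by (simp add: reflect_def)

lemma borel_measurable_reflect:
  assumes "(\<lambda>z. k (fst z) (snd z)) \<in> borel_measurable (borel :: (real \<times> real) measure)"
  shows "(\<lambda>z. reflect (k (fst z)) (snd z)) \<in> borel_measurable (borel :: (real \<times> real) measure)"
proof -
  have [measurable]: "(\<lambda>z. k (fst z) (snd z)) \<in> borel_measurable (borel \<Otimes>\<^sub>M borel)"
    using assms by (simp add: borel_prod)
  have [measurable]: "(\<lambda>z. k (fst z) (fold_dist (snd z))) \<in> borel_measurable (borel \<Otimes>\<^sub>M borel)"
    using measurable_compose[of "\<lambda>z. (fst z, fold_dist (snd z))" "borel \<Otimes>\<^sub>M borel" "borel \<Otimes>\<^sub>M borel"
        "\<lambda>z. k (fst z) (snd z)" borel] by simp
  have [measurable]: "(\<lambda>z. k (fst z) (2 - fold_dist (snd z))) \<in> borel_measurable (borel \<Otimes>\<^sub>M borel)"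
    using measurable_compose[of "\<lambda>z. (fst z, 2 - fold_dist (snd z))" "borel \<Otimes>\<^sub>M borel" "borel \<Otimes>\<^sub>M borel"
        "\<lambda>z. k (fst z) (snd z)" borel] by simp
  have "(\<lambda>z. reflect (k (fst z)) (snd z)) \<in> borel_measurable (borel \<Otimes>\<^sub>M borel)"
    unfolding reflect_def by measurable
  then show ?thesis by (simp add: borel_prod)
qed

definition even_odd :: "(real \<times> real \<Rightarrow> real) \<Rightarrow> bool" where
  "even_odd K \<longleftrightarrow> (\<forall>t x. K (t, - x) = K (t, x) \<and> K (t, 2 - x) = - K (t, x))"

lemma lborel_integral_reflect_snd:
  fixes f :: "real \<times> real \<Rightarrow> real"
  assumes "integrable lborel f"
  shows "(LBINT z. f (fst z, - snd z)) = (LBINT z. f z)"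
proof -
  have d: "distr lborel borel (\<lambda>z. (fst z, - snd z)) = (lborel :: (real \<times> real) measure)"
  proof -
    have "(\<Sum>j\<in>Basis. ((if j = (0, 1) then -1 else 1) * (z \<bullet> j)) *\<^sub>R j) = (fst z, - snd z)" for z :: "real \<times> real"
      by (simp add: Basis_prod_def sum.union_disjoint inner_prod_def image_iff)
    moreover have "(\<Prod>j\<in>(Basis :: (real \<times> real) set). \<bar>if j = (0, 1) then -1 else (1::real)\<bar>) = 1"
      by (intro prod.neutral) auto
    ultimately show ?thesis
      using lborel_affine_euclidean[of "\<lambda>j::real \<times> real. if j = (0, 1) then -1 else 1" 0]
      by (simp add: density_1)
  qed
  have [measurable]: "f \<in> borel_measurable borel" using assms by auto
  have "(LBINT z. f z) = (\<integral>z. f z \<partial>distr lborel borel (\<lambda>z. (fst z, - snd z)))"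
    by (simp only: d)
  also have "\<dots> = (LBINT z. f (fst z, - snd z))"
    by (intro integral_distr) (auto intro!: borel_measurable_continuous_onI continuous_intros)
  finally show ?thesis ..
qed

text \<open>The kernel is even in space, so the substitution of \<open>- r\<close> for
  \<open>r\<close> hands both symmetries of the source to the potential. Oddness about 1 then gives
  the value \<open>0\<close> at \<open>x = 1\<close>, the Dirichlet condition, without any boundary
  estimate.\<close>

lemma even_odd_convol:
  assumes "0 < \<omega>" and K: "K \<in> borel_measurable borel" "\<And>z. \<bar>K z\<bar> \<le> B" "even_odd K"
  shows "even_odd (convol (heat_kernel \<omega>) K)"
  unfolding even_odd_def
proof (intro allI conjI)
  fix t x
  note int = integrable_convol[OF integrable_heat_kernel[OF assms(1)] K(1,2)]
  have ev: "K (t, - x) = K (t, x)" and od: "K (t, 2 - x) = - K (t, x)" for t x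
    using K(3) by (auto simp: even_odd_def)
  show "convol (heat_kernel \<omega>) K (t, - x) = convol (heat_kernel \<omega>) K (t, x)"
    unfolding convol_def
    using lborel_integral_reflect_snd[OF int[of "(t, -x)"]] ev[of _ "x - _"]
    by (simp add: heat_kernel_minus minus_prod_def algebra_simps)
  have "K (t, 2 - x - r) = - K (t, x + r)" for t r
    using od[of t "x + r"] by (simp add: algebra_simps)
  then show "convol (heat_kernel \<omega>) K (t, 2 - x) = - convol (heat_kernel \<omega>) K (t, x)"
    unfolding convol_def
    using lborel_integral_reflect_snd[OF int[of "(t, x)"]]
    by (simp add: heat_kernel_minus minus_prod_def)
qed

section \<open>Heat potentials\<close>

lemma isCont_heat_potential:
  assumes "0 < \<omega>" and K: "K \<in> borel_measurable borel" "\<And>z. \<bar>K z\<bar> \<le> B"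
  shows "isCont (convol (heat_kernel \<omega>) K) z"
  by (rule isCont_convol[OF integrable_heat_kernel[OF assms(1)] heat_kernel_nonneg
        AE_isCont_heat_kernel K])

lemma heat_potential_start:
  assumes "\<And>t x. t \<le> a \<Longrightarrow> K (t, x) = 0" "t \<le> a"
  shows "convol (heat_kernel \<omega>) K (t, x) = 0"
proof -
  have "heat_kernel \<omega> w * K ((t, x) - w) = 0" for w
    using assms(2) assms(1)[of "t - fst w" "x - snd w"]
    by (cases "0 < fst w") (auto simp: minus_prod_def heat_kernel_def gauss_def split_beta)
  then show ?thesis unfolding convol_def by (simp only: integral_zero)
qed

text \<open>The fundamental theorem of calculus is applied for each source point separately, and
  Fubini does the rest. The convolution with \<open>heat_kernel_dx\<close> is thereby the space
  derivative in the integrated sense that \<open>weak_deriv_V\<close> requires.\<close>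

lemma heat_potential_diff_eq_integral:
  assumes "0 < \<omega>" and K[measurable]: "K \<in> borel_measurable borel" and B: "\<And>z. \<bar>K z\<bar> \<le> B"
    and ab: "a \<le> b"
  shows "convol (heat_kernel \<omega>) K (t, b) - convol (heat_kernel \<omega>) K (t, a)
    = (LBINT x. indicator {a..b} x * convol (heat_kernel_dx \<omega>) K (t, x))"
proof -
  note ip = integrable_heat_kernel[OF assms(1)] and iq = integrable_heat_kernel_dx[OF assms(1)]
  have "integrable lborel (\<lambda>w. heat_kernel_dx \<omega> (- w))"
    using lborel_integral_reflect(2)[of "heat_kernel_dx \<omega>" 0] iq by simp
  moreover have "integrable lborel (indicator {a..b} :: real \<Rightarrow> real)"
    by (rule integrable_real_indicator) (auto simp: emeasure_lborel_Icc_eq)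
  ultimately have i: "integrable (lborel \<Otimes>\<^sub>M lborel)
      (\<lambda>(x, w). indicator {a..b} x * heat_kernel_dx \<omega> ((t, x) - w) * K w)"
    using integrable_product_shift[of "indicator {a..b} :: real \<Rightarrow> real" "\<lambda>w. heat_kernel_dx \<omega> (- w)" "\<lambda>x. (t, x)" "\<lambda>z. K (snd z)" B] B
    by simp
  have ftc: "(LBINT x. indicator {a..b} x * heat_kernel_dx \<omega> ((t, x) - w))
      = heat_kernel \<omega> ((t, b) - w) - heat_kernel \<omega> ((t, a) - w)" for w
  proof (cases "0 < t - fst w")
    case True
    have d: "((\<lambda>x. heat_kernel \<omega> (t - fst w, x - snd w)) has_real_derivative
        heat_kernel_dx \<omega> (t - fst w, x - snd w)) (at x within A)" for x A
    proof -
      have "((\<lambda>x. x - snd w) has_real_derivative 1) (at x within A)"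
        by (auto intro!: derivative_eq_intros)
      from DERIV_chain2[OF has_real_derivative_heat_kernel_x[OF True, of \<omega> "x - snd w" UNIV] this]
      show ?thesis by simp
    qed
    have "(LBINT x. indicator {a..b} x *\<^sub>R heat_kernel_dx \<omega> (t - fst w, x - snd w))
        = heat_kernel \<omega> (t - fst w, b - snd w) - heat_kernel \<omega> (t - fst w, a - snd w)"
    proof (rule integral_FTC_atLeastAtMost[OF ab])
      show "((\<lambda>x. heat_kernel \<omega> (t - fst w, x - snd w)) has_vector_derivative
          heat_kernel_dx \<omega> (t - fst w, x - snd w)) (at x within {a..b})" for x
        using d by (simp add: has_real_derivative_iff_has_vector_derivative)
      have "continuous_on UNIV (\<lambda>r. heat_kernel_dx \<omega> (t - fst w, r))"
        by (intro continuous_at_imp_continuous_on ballI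
            DERIV_isCont[OF has_real_derivative_heat_kernel_xx[OF True]])
      then show "continuous_on {a..b} (\<lambda>x. heat_kernel_dx \<omega> (t - fst w, x - snd w))"
        by (rule continuous_on_compose2) (auto intro!: continuous_intros)
    qed
    then show ?thesis by (simp add: minus_prod_def)
  next
    case False
    then show ?thesis
      by (simp add: minus_prod_def heat_kernel_nonpos heat_kernel_dx_nonpos)
  qed
  have "(LBINT x. indicator {a..b} x * convol (heat_kernel_dx \<omega>) K (t, x))
      = (LBINT x. LBINT w. indicator {a..b} x * heat_kernel_dx \<omega> ((t, x) - w) * K w)"
    by (simp add: convol_commute mult.assoc)
  also have "\<dots> = (LBINT w. LBINT x. indicator {a..b} x * heat_kernel_dx \<omega> ((t, x) - w) * K w)"
    by (rule lborel_pair.Fubini_integral[symmetric, OF i])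
  also have "\<dots> = (LBINT w. (heat_kernel \<omega> ((t, b) - w) - heat_kernel \<omega> ((t, a) - w)) * K w)"
    by (simp add: ftc)
  also have "\<dots> = (LBINT w. heat_kernel \<omega> ((t, b) - w) * K w) - (LBINT w. heat_kernel \<omega> ((t, a) - w) * K w)"
  proof -
    have "integrable lborel (\<lambda>w. heat_kernel \<omega> (c - w) * K w)" for c
      using lborel_integral_reflect(2)[of "heat_kernel \<omega>" c] ip B
      by (intro integrable_mult_bounded[where B=B]) auto
    then show ?thesis by (simp add: left_diff_distrib)
  qed
  finally show ?thesis by (simp add: convol_commute)
qed

text \<open>The kernel is split at age \<open>h\<close>. The older part is the potential at time
  \<open>t - h\<close> propagated by one Gaussian step; the younger part is the Duhamel term of the
  last time interval.\<close>

lemma heat_potential_semigroup: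
  assumes "0 < \<omega>" and K[measurable]: "K \<in> borel_measurable borel" and B: "\<And>z. \<bar>K z\<bar> \<le> B"
    and h: "0 < h"
  shows "convol (heat_kernel \<omega>) K (t, x)
    = exp (- \<omega>\<^sup>2 * h) * (LBINT y. gauss h y * convol (heat_kernel \<omega>) K (t - h, x - y))
      + (LBINT w. (heat_kernel \<omega> w * indicator {w. fst w \<le> h} w) * K ((t, x) - w))"
proof -
  note ip = integrable_heat_kernel[OF assms(1)]
  have m[measurable]: "{w::real \<times> real. fst w \<le> h} \<in> sets borel"
    by (intro borel_closed closed_Collect_le continuous_intros)
  have "{w::real \<times> real. h < fst w} = - {w. fst w \<le> h}" by auto
  then have m'[measurable]: "{w::real \<times> real. h < fst w} \<in> sets borel"
    using m by (simp add: sets.compl_sets)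
  \<comment> \<open>A displacement of age above \<open>h\<close> factors through an intermediate
    point; for smaller ages the right side vanishes because the kernel is \<open>0\<close> at
    nonpositive times.\<close>
  have late: "heat_kernel \<omega> w * indicator {w. h < fst w} w
      = exp (- \<omega>\<^sup>2 * h) * (LBINT y. gauss h y * heat_kernel \<omega> (w - (h, y)))" for w
  proof (cases "h < fst w")
    case True
    have "heat_kernel \<omega> w = exp (- \<omega>\<^sup>2 * fst w) * gauss ((fst w - h) + h) (snd w)"
      by (simp add: heat_kernel_def split_beta)
    also have "\<dots> = exp (- \<omega>\<^sup>2 * fst w) * (LBINT y. gauss h y * gauss (fst w - h) (snd w - y))"
      using True h by (subst gauss_semigroup) auto
    also have "\<dots> = exp (- \<omega>\<^sup>2 * h) * (exp (- \<omega>\<^sup>2 * (fst w - h)) * (LBINT y. gauss h y * gauss (fst w - h) (snd w - y)))"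
      by (simp add: mult.assoc[symmetric] exp_add[symmetric] algebra_simps)
    also have "\<dots> = exp (- \<omega>\<^sup>2 * h) * (LBINT y. gauss h y * heat_kernel \<omega> (w - (h, y)))"
      unfolding integral_mult_right_zero[symmetric]
      by (intro Bochner_Integration.integral_cong) (simp_all add: heat_kernel_def minus_prod_def)
    finally show ?thesis using True by simp
  qed (simp add: minus_prod_def heat_kernel_nonpos)
  have i: "integrable (lborel \<Otimes>\<^sub>M lborel) (\<lambda>(y, w). gauss h y * heat_kernel \<omega> (w - (h, y)) * K ((t, x) - w))"
    using integrable_product_shift[OF integrable_gauss[of h] ip, of "\<lambda>y. (h, y)" "\<lambda>z. K ((t, x) - snd z)" B] B
    by simp
  have inner: "(LBINT w. heat_kernel \<omega> (w - (h, y)) * K ((t, x) - w))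
      = convol (heat_kernel \<omega>) K (t - h, x - y)" for y
  proof -
    have "(LBINT w. heat_kernel \<omega> (w - (h, y)) * K ((t, x) - w))
        = (LBINT w. heat_kernel \<omega> ((h, y) + w - (h, y)) * K ((t, x) - ((h, y) + w)))"
      by (rule lborel_integral_shift(1)[symmetric]) measurable
    moreover have "(h, y) + w - (h, y) = w" "(t, x) - ((h, y) + w) = (t - h, x - y) - w" for w
      by (simp_all add: prod_eq_iff)
    ultimately show ?thesis by (simp add: convol_def)
  qed
  have "(LBINT w. (heat_kernel \<omega> w * indicator {w. h < fst w} w) * K ((t, x) - w))
      = exp (- \<omega>\<^sup>2 * h) * (LBINT w. LBINT y. gauss h y * heat_kernel \<omega> (w - (h, y)) * K ((t, x) - w))"
    unfolding late by (simp add: mult.assoc[of "exp _"])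
  also have "(LBINT w. LBINT y. gauss h y * heat_kernel \<omega> (w - (h, y)) * K ((t, x) - w))
      = (LBINT y. LBINT w. gauss h y * heat_kernel \<omega> (w - (h, y)) * K ((t, x) - w))"
    by (rule lborel_pair.Fubini_integral[OF i])
  also have "\<dots> = (LBINT y. gauss h y * convol (heat_kernel \<omega>) K (t - h, x - y))"
    by (simp add: mult.assoc inner)
  finally have l: "(LBINT w. (heat_kernel \<omega> w * indicator {w. h < fst w} w) * K ((t, x) - w))
      = exp (- \<omega>\<^sup>2 * h) * (LBINT y. gauss h y * convol (heat_kernel \<omega>) K (t - h, x - y))" .
  have "convol (heat_kernel \<omega>) K (t, x)
      = (LBINT w. (heat_kernel \<omega> w * indicator {w. h < fst w} w) * K ((t, x) - w)
        + (heat_kernel \<omega> w * indicator {w. fst w \<le> h} w) * K ((t, x) - w))"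
    unfolding convol_def by (intro Bochner_Integration.integral_cong) (auto simp: indicator_def)
  also have "\<dots> = (LBINT w. (heat_kernel \<omega> w * indicator {w. h < fst w} w) * K ((t, x) - w))
        + (LBINT w. (heat_kernel \<omega> w * indicator {w. fst w \<le> h} w) * K ((t, x) - w))"
    using B ip by (intro Bochner_Integration.integral_add integrable_mult_bounded[where B=B]
        integrable_real_mult_indicator) auto
  finally show ?thesis unfolding l .
qed


text \<open>In the minimum principle the sources beyond the boundary may have the wrong sign because
  of the odd reflection. Seen from a point at distance \<open>d\<close> from the boundary they
  contribute only this much, \<open>gauss_tail\<close> integrated over the ages up to
  \<open>h\<close>.\<close>

lemma short_time_tail:
  assumes "0 < \<omega>" and h: "0 < h" and d: "0 < d"
  shows "(LBINT w. heat_kernel \<omega> w * indicator {w. fst w \<le> h \<and> d \<le> \<bar>snd w\<bar>} w) \<le> 12 * h ^ 3 / d ^ 4"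
proof -
  let ?A = "{w::real \<times> real. fst w \<le> h \<and> d \<le> \<bar>snd w\<bar>}"
  have m: "?A \<in> sets borel"
    by (intro borel_closed closed_Collect_conj closed_Collect_le continuous_intros)
  have i: "integrable lborel (\<lambda>w. heat_kernel \<omega> w * indicator ?A w)"
    using m integrable_heat_kernel[OF assms(1)] by (intro integrable_real_mult_indicator) auto
  have "(LBINT w. heat_kernel \<omega> w * indicator ?A w)
      = (LBINT s. LBINT r. heat_kernel \<omega> (s, r) * indicator ?A (s, r))"
    using lborel_pair.integral_fst'[of "\<lambda>w. heat_kernel \<omega> w * indicator ?A w"] i
    by (simp add: lborel_prod)
  also have "\<dots> \<le> (LBINT s. 12 * h\<^sup>2 / d ^ 4 * indicator {0..h} s)"
  proof (rule integral_mono)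
    show "integrable lborel (\<lambda>s. LBINT r. heat_kernel \<omega> (s, r) * indicator ?A (s, r))"
      using lborel_pair.integrable_fst'[of "\<lambda>w. heat_kernel \<omega> w * indicator ?A w"] i
      by (simp add: lborel_prod)
    show "integrable lborel (\<lambda>s. 12 * h\<^sup>2 / d ^ 4 * indicator {0..h} s)"
      by (intro integrable_mult_right integrable_real_indicator) (auto simp: emeasure_lborel_Icc_eq)
    show "(LBINT r. heat_kernel \<omega> (s, r) * indicator ?A (s, r))
        \<le> 12 * h\<^sup>2 / d ^ 4 * indicator {0..h} s" for s
    proof (cases "0 < s \<and> s \<le> h")
      case True
      have "(LBINT r. heat_kernel \<omega> (s, r) * indicator ?A (s, r))
          = exp (- \<omega>\<^sup>2 * s) * (LBINT r. gauss s r * indicator {r. d \<le> \<bar>r\<bar>} r)"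
        unfolding integral_mult_right_zero[symmetric] using True
        by (intro Bochner_Integration.integral_cong) (auto simp: heat_kernel_def indicator_def)
      also have "\<dots> \<le> 1 * (12 * s\<^sup>2 / d ^ 4)"
        using True d by (intro mult_mono gauss_tail) (auto intro!: integral_nonneg_AE)
      also have "\<dots> \<le> 12 * h\<^sup>2 / d ^ 4"
        using True d by (simp add: divide_right_mono power_mono)
      finally show ?thesis using True by simp
    next
      case False
      then have "heat_kernel \<omega> (s, r) * indicator ?A (s, r) = 0" for r
        by (auto simp: indicator_def heat_kernel_nonpos)
      then show ?thesis by (simp only: integral_zero) simp
    qed
  qed
  also have "\<dots> = 12 * h ^ 3 / d ^ 4"
    using h by (simp add: power2_eq_square power3_eq_cube)
  finally show ?thesis .
qed

text \<open>A parabolic minimum principle that avoids differentiating the potential: at a negative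
  interior minimum of \<open>z(t, x) + \<eta> t\<close>, stepping back by a time \<open>h\<close> gains \<open>\<eta> h\<close>, whereas the mass
  that leaves the neighbourhood of the point is \<open>O(h\<^sup>2)\<close> by the fourth moment of the kernel.\<close>

lemma heat_potential_nonneg_aux:
  assumes \<omega>: "0 < \<omega>" and K[measurable]: "K \<in> borel_measurable borel" and B: "\<And>z. \<bar>K z\<bar> \<le> B"
    and eo: "even_odd K" and nonneg: "\<And>t x. \<bar>x\<bar> < 1 \<Longrightarrow> 0 \<le> K (t, x)"
    and start: "\<And>t x. t \<le> a \<Longrightarrow> K (t, x) = 0" and x: "\<bar>x\<bar> \<le> 1"
  shows "0 \<le> convol (heat_kernel \<omega>) K (t, x)"
proof (rule ccontr)
  define z where "z = convol (heat_kernel \<omega>) K"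
  define M where "M = B * (LBINT w. \<bar>heat_kernel \<omega> w\<bar>)"
  assume "\<not> 0 \<le> convol (heat_kernel \<omega>) K (t, x)"
  then have neg: "z (t, x) < 0" by (simp add: z_def)
  note ip = integrable_heat_kernel[OF \<omega>]
  have M: "\<bar>z w\<bar> \<le> M" for w
    unfolding z_def M_def by (rule convol_bound[OF ip K B])
  have contz: "isCont z w" for w
    unfolding z_def by (rule isCont_heat_potential[OF \<omega> K B])
  have contz_on: "continuous_on UNIV z"
    by (intro continuous_at_imp_continuous_on ballI contz)
  have B0: "0 \<le> B" using B[of undefined] by linarith
  have M0: "0 \<le> M" using M[of undefined] by linarith
  have z_start: "z (s, y) = 0" if "s \<le> a" for s y
    unfolding z_def using start that by (rule heat_potential_start)
  have z_bd: "z (s, 1) = 0" "z (s, -1) = 0" for s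
  proof -
    have "even_odd z" unfolding z_def by (rule even_odd_convol[OF \<omega> K B eo])
    then have "z (s, 2 - 1) = - z (s, 1)" "z (s, - 1) = z (s, 1)"
      unfolding even_odd_def by blast+
    then show "z (s, 1) = 0" "z (s, -1) = 0" by simp_all
  qed
  have at: "a < t" using z_start[of t x] neg by (cases "a < t") auto
  \<comment> \<open>Chosen such that \<open>m (t, x) = z (t, x) / 2\<close>: the tilted function
    keeps a negative value and hence has a negative minimum.\<close>
  define \<eta> where "\<eta> = - z (t, x) / (2 * (t - a))"
  have \<eta>: "0 < \<eta>" using neg at unfolding \<eta>_def by (intro divide_pos_pos) auto
  define m where "m = (\<lambda>w. z w + \<eta> * (fst w - a))"
  have "continuous_on ({a..t} \<times> {-1..1}) m"
    unfolding m_def using contz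
    by (intro continuous_intros continuous_at_imp_continuous_on) auto
  moreover have "compact ({a..t} \<times> {-1..1::real})"
    by (intro compact_Times) auto
  ultimately obtain w0 where w0: "w0 \<in> {a..t} \<times> {-1..1}" "\<And>w. w \<in> {a..t} \<times> {-1..1} \<Longrightarrow> m w0 \<le> m w"
    using continuous_attains_inf[of "{a..t} \<times> {-1..1::real}" m] at by force
  obtain t0 x0 where w0_eq: "w0 = (t0, x0)" by (cases w0)
  have "m (t, x) = z (t, x) / 2"
    using at by (simp add: m_def \<eta>_def field_simps)
  moreover have "(t, x) \<in> {a..t} \<times> {-1..1}" using x at by (auto simp: abs_le_iff)
  ultimately have "m w0 < 0" using w0(2)[of "(t, x)"] neg by simp
  then have m0: "z (t0, x0) + \<eta> * (t0 - a) < 0" by (simp add: m_def w0_eq)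
  have t0: "a \<le> t0" "t0 \<le> t" "\<bar>x0\<bar> \<le> 1" using w0(1) by (auto simp: w0_eq)
  have "t0 \<noteq> a" using m0 z_start[of t0 x0] by auto
  then have t0': "a < t0" using t0 by simp
  have c0: "z (t0, x0) < 0"
    using m0 \<eta> t0 mult_nonneg_nonneg[of \<eta> "t0 - a"] by linarith
  have "x0 \<noteq> 1" "x0 \<noteq> -1" using c0 z_bd by auto
  then have x0: "\<bar>x0\<bar> < 1" using t0(3) by auto
  \<comment> \<open>The distance of the minimum point from the boundary: displacements shorter than
    \<open>d\<close> stay where minimality applies and where the source is nonnegative.\<close>
  define d where "d = 1 - \<bar>x0\<bar>"
  have d: "0 < d" using x0 by (simp add: d_def)
  define c where "c = z (t0, x0)"
  have "c + \<eta> * h \<le> z (t0 - h, x0 - y)" if "0 < h" "h \<le> t0 - a" "\<bar>y\<bar> < d" for h y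
  proof -
    have "\<bar>x0 - y\<bar> \<le> 1" using that by (auto simp: d_def)
    then have "m w0 \<le> m (t0 - h, x0 - y)"
      using that t0 by (intro w0(2)) auto
    then show ?thesis by (simp add: m_def w0_eq c_def algebra_simps)
  qed
  note near = this
  \<comment> \<open>At displacements below \<open>d\<close> minimality gives at least
    \<open>c + \<eta> * h\<close>; elsewhere the bound \<open>- M\<close> on \<open>z\<close> loses
    at most \<open>2 * M\<close>, weighted by the Gaussian tail. The resulting lower bound is
    nonpositive, so the damping factor can only raise it. The last term accounts for the sources
    beyond the boundary.\<close>
  have key: "\<eta> * h \<le> (2 * M * 12 / d ^ 4) * h\<^sup>2 + B * (12 * h ^ 3 / d ^ 4)"
    if h: "0 < h" "h \<le> t0 - a" "c + \<eta> * h < 0" for h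
  proof -
    let ?far = "\<lambda>y. indicator {r. d \<le> \<bar>r\<bar>} y :: real"
    have ifar: "integrable lborel (\<lambda>y. gauss h y * ?far y)"
      by (rule integrable_mult_bounded[where B=1]) (auto simp: indicator_def)
    have "(c + \<eta> * h) - 2 * M * (12 * h\<^sup>2 / d ^ 4)
        \<le> (c + \<eta> * h) - 2 * M * (LBINT y. gauss h y * ?far y)"
      using M0 by (intro diff_left_mono mult_left_mono gauss_tail[OF h(1) d]) auto
    also have "\<dots> = (LBINT y. gauss h y * (c + \<eta> * h) - 2 * M * (gauss h y * ?far y))"
      using ifar h(1) by (simp add: integral_gauss)
    also have "\<dots> \<le> (LBINT y. gauss h y * z (t0 - h, x0 - y))"
    proof (rule integral_mono)
      show "integrable lborel (\<lambda>y. gauss h y * (c + \<eta> * h) - 2 * M * (gauss h y * ?far y))"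
        using ifar by auto
      have "continuous_on UNIV (\<lambda>y. z (t0 - h, x0 - y))"
        by (rule continuous_on_compose2[OF contz_on]) (auto intro!: continuous_intros)
      then have "(\<lambda>y. z (t0 - h, x0 - y)) \<in> borel_measurable borel"
        by (rule borel_measurable_continuous_onI)
      then show "integrable lborel (\<lambda>y. gauss h y * z (t0 - h, x0 - y))"
        using M by (intro integrable_mult_bounded[where B=M]) auto
      show "gauss h y * (c + \<eta> * h) - 2 * M * (gauss h y * ?far y) \<le> gauss h y * z (t0 - h, x0 - y)" for y
      proof (cases "\<bar>y\<bar> < d")
        case True
        then show ?thesis using near[OF h(1,2) True] by (simp add: mult_left_mono)
      next
        case False
        have "c + \<eta> * h - 2 * M \<le> z (t0 - h, x0 - y)"
          using h(3) M[of "(t0 - h, x0 - y)"] M0 by linarith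
        then have "gauss h y * (c + \<eta> * h - 2 * M) \<le> gauss h y * z (t0 - h, x0 - y)"
          by (simp add: mult_left_mono)
        then show ?thesis using False by (simp add: algebra_simps)
      qed
    qed
    finally have 1: "(c + \<eta> * h) - 2 * M * (12 * h\<^sup>2 / d ^ 4) \<le> (LBINT y. gauss h y * z (t0 - h, x0 - y))" .
    have e: "0 < exp (- \<omega>\<^sup>2 * h)" "exp (- \<omega>\<^sup>2 * h) \<le> 1" using h by auto
    have "(c + \<eta> * h) - 2 * M * (12 * h\<^sup>2 / d ^ 4) \<le> 0"
    proof -
      have "0 \<le> 2 * M * (12 * h\<^sup>2 / d ^ 4)" using M0 d by simp
      then show ?thesis using h(3) by linarith
    qed
    then have "(c + \<eta> * h) - 2 * M * (12 * h\<^sup>2 / d ^ 4)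
        \<le> exp (- \<omega>\<^sup>2 * h) * ((c + \<eta> * h) - 2 * M * (12 * h\<^sup>2 / d ^ 4))"
      using mult_right_mono_neg[OF e(2)] by fastforce
    also have "\<dots> \<le> exp (- \<omega>\<^sup>2 * h) * (LBINT y. gauss h y * z (t0 - h, x0 - y))"
      using 1 e by (simp add: mult_left_mono)
    finally have 1: "(c + \<eta> * h) - 2 * M * (12 * h\<^sup>2 / d ^ 4)
        \<le> exp (- \<omega>\<^sup>2 * h) * (LBINT y. gauss h y * z (t0 - h, x0 - y))" .
    let ?out = "{w::real \<times> real. fst w \<le> h \<and> d \<le> \<bar>snd w\<bar>}"
    have mout[measurable]: "?out \<in> sets borel"
      by (intro borel_closed closed_Collect_conj closed_Collect_le continuous_intros)
    have mle[measurable]: "{w::real \<times> real. fst w \<le> h} \<in> sets borel"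
      by (intro borel_closed closed_Collect_le continuous_intros)
    have "- B * (12 * h ^ 3 / d ^ 4) \<le> - B * (LBINT w. heat_kernel \<omega> w * indicator ?out w)"
      using short_time_tail[OF \<omega> h(1) d] B0 by (intro mult_left_mono_neg) auto
    also have "\<dots> = (LBINT w. - B * (heat_kernel \<omega> w * indicator ?out w))" by simp
    also have "\<dots> \<le> (LBINT w. (heat_kernel \<omega> w * indicator {w. fst w \<le> h} w) * K ((t0, x0) - w))"
    proof (rule integral_mono)
      show "integrable lborel (\<lambda>w. - B * (heat_kernel \<omega> w * indicator ?out w))"
        using ip by (intro integrable_mult_right integrable_real_mult_indicator) auto
      show "integrable lborel (\<lambda>w. (heat_kernel \<omega> w * indicator {w. fst w \<le> h} w) * K ((t0, x0) - w))"
        using B ip by (intro integrable_mult_bounded[where B=B] integrable_real_mult_indicator) auto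
      show "- B * (heat_kernel \<omega> w * indicator ?out w)
          \<le> (heat_kernel \<omega> w * indicator {w. fst w \<le> h} w) * K ((t0, x0) - w)" for w
      proof (cases "fst w \<le> h")
        case True
        have "- B * indicator ?out w \<le> K ((t0, x0) - w)"
        proof (cases "d \<le> \<bar>snd w\<bar>")
          case True
          then show ?thesis using \<open>fst w \<le> h\<close> B[of "(t0, x0) - w"] by (auto simp: indicator_def)
        next
          case False
          then have "0 \<le> K (t0 - fst w, x0 - snd w)" by (intro nonneg) (auto simp: d_def)
          then show ?thesis using False by (simp add: minus_prod_def)
        qed
        then have "heat_kernel \<omega> w * (- B * indicator ?out w) \<le> heat_kernel \<omega> w * K ((t0, x0) - w)"
          by (rule mult_left_mono) simp
        then show ?thesis using True by (simp add: algebra_simps)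
      qed simp
    qed
    finally have 2: "- B * (12 * h ^ 3 / d ^ 4)
        \<le> (LBINT w. (heat_kernel \<omega> w * indicator {w. fst w \<le> h} w) * K ((t0, x0) - w))" .
    have "c = exp (- \<omega>\<^sup>2 * h) * (LBINT y. gauss h y * z (t0 - h, x0 - y))
      + (LBINT w. (heat_kernel \<omega> w * indicator {w. fst w \<le> h} w) * K ((t0, x0) - w))"
      unfolding c_def z_def by (rule heat_potential_semigroup[OF \<omega> K B h(1)])
    with 1 2 show ?thesis by (simp add: algebra_simps)
  qed
  \<comment> \<open>Divided by \<open>h\<close>, the estimate bounds \<open>\<eta>\<close> by a
    quantity that tends to \<open>0\<close> with \<open>h\<close>, contrary to
    \<open>0 < \<eta>\<close>.\<close>
  define C where "C = 2 * M * 12 / d ^ 4"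
  define D where "D = B * 12 / d ^ 4"
  have "\<eta> \<le> C * h + D * h\<^sup>2" if h: "0 < h" "h \<le> t0 - a" "c + \<eta> * h < 0" for h
  proof -
    have "\<eta> * h \<le> (C * h + D * h\<^sup>2) * h"
      using key[OF h] by (simp add: C_def D_def power2_eq_square power3_eq_cube algebra_simps)
    then show ?thesis using h(1) by simp
  qed
  moreover have "\<forall>\<^sub>F h in at_right 0. 0 < h \<and> h \<le> t0 - a \<and> c + \<eta> * h < 0 \<and> C * h + D * h\<^sup>2 < \<eta>"
  proof (intro eventually_conj)
    show "\<forall>\<^sub>F h in at_right 0. (0::real) < h" by (rule eventually_at_right_less)
    show "\<forall>\<^sub>F h in at_right 0. h \<le> t0 - a"
      using eventually_at_right_field t0' by (metis diff_gt_0_iff_gt less_imp_le)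
    have "((\<lambda>h. c + \<eta> * h) \<longlongrightarrow> c + \<eta> * 0) (at_right 0)" by (intro tendsto_intros)
    then show "\<forall>\<^sub>F h in at_right 0. c + \<eta> * h < 0"
      using c0 by (intro order_tendstoD(2)[where y="c + \<eta> * 0"]) (auto simp: c_def)
    have "((\<lambda>h. C * h + D * h\<^sup>2) \<longlongrightarrow> C * 0 + D * 0\<^sup>2) (at_right 0)" by (intro tendsto_intros)
    then show "\<forall>\<^sub>F h in at_right 0. C * h + D * h\<^sup>2 < \<eta>"
      using \<eta> by (intro order_tendstoD(2)[where y="C * 0 + D * 0\<^sup>2"]) auto
  qed
  then obtain h where "0 < h" "h \<le> t0 - a" "c + \<eta> * h < 0" "C * h + D * h\<^sup>2 < \<eta>"
    using eventually_happens[OF _ ] trivial_limit_at_right_real[of 0] by (metis (mono_tags, lifting))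
  ultimately show False by force
qed

text \<open>Cut off before time \<open>- n\<close>, the source has a start and
  \<open>heat_potential_nonneg_aux\<close> applies; dominated convergence removes the cut. The gain
  is that stationary sources, which have no start, can be compared as well.\<close>

lemma heat_potential_nonneg:
  assumes \<omega>: "0 < \<omega>" and K[measurable]: "K \<in> borel_measurable borel" and B: "\<And>z. \<bar>K z\<bar> \<le> B"
    and eo: "even_odd K" and nonneg: "\<And>t x. \<bar>x\<bar> < 1 \<Longrightarrow> 0 \<le> K (t, x)" and x: "\<bar>x\<bar> \<le> 1"
  shows "0 \<le> convol (heat_kernel \<omega>) K (t, x)"
proof -
  define L where "L = (\<lambda>n::nat. \<lambda>w. K w * indicator {w. - real n < fst w} w)"
  have m: "{w::real \<times> real. - real n < fst w} \<in> sets borel" for n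
    by (intro borel_open open_Collect_less continuous_intros)
  have L[measurable]: "L n \<in> borel_measurable borel" for n
    unfolding L_def using m by measurable
  have BL: "\<bar>L n z\<bar> \<le> B" for n z using B[of z] by (auto simp: L_def indicator_def)
  have "0 \<le> convol (heat_kernel \<omega>) (L n) (t, x)" for n
  proof (rule heat_potential_nonneg_aux[OF \<omega> L BL])
    show "even_odd (L n)" using eo by (auto simp: even_odd_def L_def indicator_def)
    show "t \<le> - real n \<Longrightarrow> L n (t, x) = 0" for t x by (simp add: L_def)
  qed (use nonneg x in \<open>auto simp: L_def indicator_def\<close>)
  moreover have "(\<lambda>n. convol (heat_kernel \<omega>) (L n) (t, x)) \<longlonglongrightarrow> convol (heat_kernel \<omega>) K (t, x)"
  proof (rule convol_LIMSEQ[OF integrable_heat_kernel[OF \<omega>] L K BL])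
    fix w :: "real \<times> real"
    obtain N :: nat where "- fst w < real N" using reals_Archimedean2 by blast
    then have "\<forall>n\<ge>N. L n w = K w" by (auto simp: L_def indicator_def)
    then show "(\<lambda>n. L n w) \<longlonglongrightarrow> K w"
      by (intro tendsto_eventually) (auto simp: eventually_sequentially)
  qed
  ultimately show ?thesis by (intro LIMSEQ_le_const) auto
qed

section \<open>The weak formulation for heat potentials\<close>

lemma test_function_derivatives:
  assumes "test_function \<phi> \<phi>t \<phi>x"
  shows "((\<lambda>t. \<phi> t x) has_real_derivative \<phi>t t x) (at t within A)"
    and "((\<lambda>x. \<phi> t x) has_real_derivative \<phi>x t x) (at x within A)"
proof -
  have d: "((\<lambda>w. \<phi> (fst w) (snd w)) has_derivative (\<lambda>w. \<phi>t t x * fst w + \<phi>x t x * snd w)) (at (t, x))"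
    using assms unfolding test_function_def split_beta by blast
  have "((\<lambda>s. (s, x)) has_derivative (\<lambda>s. (s, 0))) (at t)"
    by (auto intro!: derivative_eq_intros)
  from has_derivative_compose[OF this d]
  show "((\<lambda>t. \<phi> t x) has_real_derivative \<phi>t t x) (at t within A)"
    by (auto simp: has_field_derivative_def intro: has_derivative_at_withinI)
  have "((\<lambda>y. (t, y)) has_derivative (\<lambda>y. (0, y))) (at x)"
    by (auto intro!: derivative_eq_intros)
  from has_derivative_compose[OF this d]
  show "((\<lambda>x. \<phi> t x) has_real_derivative \<phi>x t x) (at x within A)"
    by (auto simp: has_field_derivative_def intro: has_derivative_at_withinI)
qed

lemma test_function_continuous:
  assumes "test_function \<phi> \<phi>t \<phi>x"
  shows "continuous_on A (\<lambda>w. \<phi> (fst w) (snd w))"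
    "continuous_on A (\<lambda>w. \<phi>t (fst w) (snd w))" "continuous_on A (\<lambda>w. \<phi>x (fst w) (snd w))"
proof -
  have "continuous_on UNIV (\<lambda>w. \<phi> (fst w) (snd w))"
  proof (intro continuous_at_imp_continuous_on ballI)
    fix w :: "real \<times> real"
    have "((\<lambda>w. \<phi> (fst w) (snd w)) has_derivative
        (\<lambda>v. \<phi>t (fst w) (snd w) * fst v + \<phi>x (fst w) (snd w) * snd v)) (at (fst w, snd w))"
      using assms unfolding test_function_def split_beta by blast
    from has_derivative_continuous[OF this] show "isCont (\<lambda>w. \<phi> (fst w) (snd w)) w" by simp
  qed
  then show "continuous_on A (\<lambda>w. \<phi> (fst w) (snd w))"
    by (rule continuous_on_subset) simp
  have "continuous_on UNIV (\<lambda>w. \<phi>t (fst w) (snd w))" "continuous_on UNIV (\<lambda>w. \<phi>x (fst w) (snd w))"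
    using assms by (simp_all add: test_function_def split_beta)
  then show "continuous_on A (\<lambda>w. \<phi>t (fst w) (snd w))" "continuous_on A (\<lambda>w. \<phi>x (fst w) (snd w))"
    by (auto intro: continuous_on_subset)
qed

lemma continuous_on_real_pair:
  fixes f :: "real \<Rightarrow> real \<Rightarrow> real"
  assumes "continuous_on UNIV (\<lambda>w. f (fst w) (snd w))" "continuous_on A a" "continuous_on A b"
  shows "continuous_on A (\<lambda>x. f (a x) (b x))"
  using continuous_on_compose2[OF assms(1) continuous_on_Pair[OF assms(2,3)]] by simp

lemma test_function_support:
  assumes "test_function \<phi> \<phi>t \<phi>x"
  obtains T B where "0 < T" "0 \<le> B"
    "\<And>t x. T < t \<Longrightarrow> 0 \<le> x \<Longrightarrow> x \<le> 1 \<Longrightarrow> \<phi> t x = 0"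
    "\<And>t x. T < t \<Longrightarrow> 0 < x \<Longrightarrow> x < 1 \<Longrightarrow> \<phi>t t x = 0 \<and> \<phi>x t x = 0"
    "\<And>t x. 0 \<le> t \<Longrightarrow> 0 < x \<Longrightarrow> x < 1 \<Longrightarrow> \<bar>\<phi> t x\<bar> \<le> B \<and> \<bar>\<phi>t t x\<bar> \<le> B \<and> \<bar>\<phi>x t x\<bar> \<le> B"
proof -
  obtain T where T: "0 < T" "\<And>t x. T \<le> t \<Longrightarrow> 0 \<le> x \<Longrightarrow> x \<le> 1 \<Longrightarrow> \<phi> t x = 0"
    using assms unfolding test_function_def by (metis atLeastAtMost_iff)
  \<comment> \<open>Strictly after \<open>T\<close> and for interior \<open>x\<close>,
    \<open>\<phi>\<close> is zero nearby along both coordinate directions, which forces the partial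
    derivatives to vanish.\<close>
  have z: "\<phi>t t x = 0 \<and> \<phi>x t x = 0" if "T < t" "0 < x" "x < 1" for t x
  proof
    have "((\<lambda>t. \<phi> t x) has_real_derivative 0) (at t)"
      by (rule has_field_derivative_transform_within_open[of "\<lambda>_. 0" 0 t "{T<..}"])
        (use that T in auto)
    then show "\<phi>t t x = 0" using test_function_derivatives(1)[OF assms] DERIV_unique by blast
    have "((\<lambda>x. \<phi> t x) has_real_derivative 0) (at x)"
      by (rule has_field_derivative_transform_within_open[of "\<lambda>_. 0" 0 x "{0<..<1}"])
        (use that T in auto)
    then show "\<phi>x t x = 0" using test_function_derivatives(2)[OF assms] DERIV_unique by blast
  qed
  have c: "compact ({0..T} \<times> {0..1::real})" by (intro compact_Times) auto
  have bd: "\<exists>B. \<forall>w\<in>{0..T} \<times> {0..1}. \<bar>f w\<bar> \<le> B" if "continuous_on ({0..T} \<times> {0..1}) f" for f :: "real \<times> real \<Rightarrow> real"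
  proof -
    have "bounded (f ` ({0..T} \<times> {0..1}))"
      using compact_continuous_image[OF that c] by (rule compact_imp_bounded)
    then show ?thesis by (auto simp: bounded_iff)
  qed
  obtain B1 where B1: "\<forall>w\<in>{0..T} \<times> {0..1}. \<bar>\<phi> (fst w) (snd w)\<bar> \<le> B1"
    using bd[OF test_function_continuous(1)[OF assms]] by blast
  obtain B2 where B2: "\<forall>w\<in>{0..T} \<times> {0..1}. \<bar>\<phi>t (fst w) (snd w)\<bar> \<le> B2"
    using bd[OF test_function_continuous(2)[OF assms]] by blast
  obtain B3 where B3: "\<forall>w\<in>{0..T} \<times> {0..1}. \<bar>\<phi>x (fst w) (snd w)\<bar> \<le> B3"
    using bd[OF test_function_continuous(3)[OF assms]] by blast
  define B where "B = \<bar>B1\<bar> + \<bar>B2\<bar> + \<bar>B3\<bar>"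
  have "\<bar>\<phi> t x\<bar> \<le> B \<and> \<bar>\<phi>t t x\<bar> \<le> B \<and> \<bar>\<phi>x t x\<bar> \<le> B" if "0 \<le> t" "0 < x" "x < 1" for t x
  proof (cases "t \<le> T")
    case True
    then have "(t, x) \<in> {0..T} \<times> {0..1}" using that by auto
    from bspec[OF B1 this] bspec[OF B2 this] bspec[OF B3 this] show ?thesis
      unfolding B_def fst_conv snd_conv by (intro conjI; linarith)
  next
    case False
    then show ?thesis using z[of t x] T(2)[of t x] that by (simp add: B_def)
  qed
  moreover have "0 \<le> B" by (simp add: B_def)
  moreover have "T < t \<Longrightarrow> 0 \<le> x \<Longrightarrow> x \<le> 1 \<Longrightarrow> \<phi> t x = 0" for t x
    using T(2) by simp
  ultimately show ?thesis using that[OF T(1) _ _ z] by blast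
qed

abbreviation strip :: "(real \<times> real) set" where
  "strip \<equiv> {0<..} \<times> {0<..<1}"

lemma strip_measurable [measurable]: "strip \<in> sets borel"
  by (intro borel_open open_Times) auto

lemma integrable_strip:
  fixes f :: "real \<times> real \<Rightarrow> real"
  assumes "f \<in> borel_measurable borel" "\<And>w. w \<in> strip \<Longrightarrow> \<bar>f w\<bar> \<le> B"
    and "\<And>w. w \<in> strip \<Longrightarrow> T < fst w \<Longrightarrow> f w = 0"
  shows "integrable lborel (\<lambda>w. indicator strip w * f w)"
proof (rule integrableI_bounded_set[where A="cbox (0, 0) (T, 1)" and B=B])
  show "emeasure lborel (cbox (0::real, 0::real) (T, 1)) < \<infinity>"
    by (rule emeasure_lborel_cbox_finite)
  have "indicator strip w * f w = 0" if "w \<notin> cbox (0, 0) (T, 1)" for w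
    using that assms(3)[of w] by (cases "w \<in> strip") (auto simp: cbox_Pair_eq cbox_interval not_le)
  then show "AE x in lborel. x \<notin> cbox (0, 0) (T, 1) \<longrightarrow> indicat_real strip x * f x = 0" by auto
  have "0 \<le> B" using assms(2)[of "(1, 1/2)"] by auto
  then show "AE x in lborel. x \<in> cbox (0, 0) (T, 1) \<longrightarrow> norm (indicat_real strip x * f x) \<le> B"
    using assms(2) by (intro AE_I2) (auto simp: indicator_def)
qed (use assms(1) in auto)

text \<open>The substitution \<open>x = y + sqrt (s n) * \<zeta>\<close> freezes the Gaussian, and
  dominated convergence applies. At \<open>y = 0\<close> and \<open>y = 1\<close> only half of the
  mass would remain in the interval, hence their exclusion. The time in \<open>\<phi>\<close> moves
  with \<open>s n\<close> because the integration by parts starts at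
  \<open>\<tau> + s n\<close>.\<close>

lemma heat_kernel_approximate_identity:
  assumes cont: "continuous_on UNIV (\<lambda>w. \<phi> (fst w) (snd w))" and y: "y \<noteq> 0" "y \<noteq> 1"
    and s: "s \<longlonglongrightarrow> 0" "\<And>n. 0 < s n" "\<And>n. s n \<le> 1"
  shows "(\<lambda>n. integral {0..1} (\<lambda>x. heat_kernel \<omega> (s n, x - y) * \<phi> (\<tau> + s n) x))
    \<longlonglongrightarrow> indicator {0<..<1} y * \<phi> \<tau> y"
proof -
  let ?f = "\<lambda>n \<zeta>. indicator {0..1} (y + sqrt (s n) * \<zeta>) * \<phi> (\<tau> + s n) (y + sqrt (s n) * \<zeta>)"
  have sub: "integral {0..1} (\<lambda>x. heat_kernel \<omega> (s n, x - y) * \<phi> (\<tau> + s n) x)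
      = exp (- \<omega>\<^sup>2 * s n) * (LBINT \<zeta>. gauss 1 \<zeta> * ?f n \<zeta>)" for n
  proof -
    have sn: "0 < s n" by (rule s)
    have "continuous_on {0..1} (\<lambda>x. heat_kernel \<omega> (s n, x - y) * \<phi> (\<tau> + s n) x)"
    proof (intro continuous_intros)
      have "continuous_on UNIV (\<lambda>r. heat_kernel \<omega> (s n, r))"
        by (intro continuous_at_imp_continuous_on ballI DERIV_isCont[OF has_real_derivative_heat_kernel_x[OF sn]])
      then show "continuous_on {0..1} (\<lambda>x. heat_kernel \<omega> (s n, x - y))"
        by (rule continuous_on_compose2) (auto intro!: continuous_intros)
      show "continuous_on {0..1} (\<phi> (\<tau> + s n))"
        using continuous_on_real_pair[OF cont continuous_on_const continuous_on_id] by simp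
    qed
    then have "set_integrable lborel {0..1} (\<lambda>x. heat_kernel \<omega> (s n, x - y) * \<phi> (\<tau> + s n) x)"
      by (rule borel_integrable_atLeastAtMost')
    then have "integral {0..1} (\<lambda>x. heat_kernel \<omega> (s n, x - y) * \<phi> (\<tau> + s n) x)
        = (LBINT x. indicator {0..1} x * (heat_kernel \<omega> (s n, x - y) * \<phi> (\<tau> + s n) x))"
      by (simp add: set_borel_integral_eq_integral(2)[symmetric] set_lebesgue_integral_def)
    also have "\<dots> = sqrt (s n) * (LBINT \<zeta>. indicator {0..1} (y + sqrt (s n) * \<zeta>)
        * (heat_kernel \<omega> (s n, sqrt (s n) * \<zeta>) * \<phi> (\<tau> + s n) (y + sqrt (s n) * \<zeta>)))"
      using lborel_integral_real_affine[of "sqrt (s n)"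
          "\<lambda>x. indicator {0..1} x * (heat_kernel \<omega> (s n, x - y) * \<phi> (\<tau> + s n) x)" y] sn by simp
    also have "\<dots> = exp (- \<omega>\<^sup>2 * s n) * (LBINT \<zeta>. gauss 1 \<zeta> * ?f n \<zeta>)"
    proof -
      have g: "sqrt (s n) * gauss (s n) (sqrt (s n) * \<zeta>) = gauss 1 \<zeta>" for \<zeta>
        using sn by (simp add: gauss_eq power_mult_distrib real_sqrt_mult)
      show ?thesis
        unfolding integral_mult_right_zero[symmetric] g[symmetric]
        by (intro Bochner_Integration.integral_cong) (simp_all add: heat_kernel_def)
    qed
    finally show ?thesis .
  qed
  have "(\<lambda>n. LBINT \<zeta>. gauss 1 \<zeta> * ?f n \<zeta>)
      \<longlonglongrightarrow> (LBINT \<zeta>. gauss 1 \<zeta> * (indicator {0<..<1} y * \<phi> \<tau> y))"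
  proof -
    have "compact ({\<tau>..\<tau> + 1} \<times> {0..1::real})" by (intro compact_Times) auto
    then have "compact ((\<lambda>w. \<phi> (fst w) (snd w)) ` ({\<tau>..\<tau> + 1} \<times> {0..1::real}))"
      by (rule compact_continuous_image[OF continuous_on_subset[OF cont subset_UNIV]])
    then obtain C where C: "\<And>w. w \<in> {\<tau>..\<tau> + 1} \<times> {0..1} \<Longrightarrow> \<bar>\<phi> (fst w) (snd w)\<bar> \<le> C"
      using compact_imp_bounded by (fastforce simp: bounded_iff)
    have m: "\<phi> t \<in> borel_measurable borel" for t
      using continuous_on_real_pair[OF cont continuous_on_const continuous_on_id]
      by (intro borel_measurable_continuous_onI) simp
    show ?thesis
    proof (rule integral_dominated_convergence[where w="\<lambda>\<zeta>. gauss 1 \<zeta> * \<bar>C\<bar>"])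
      show "(\<lambda>\<zeta>. gauss 1 \<zeta> * ?f n \<zeta>)
        \<in> borel_measurable lborel" for n
        using m[of "\<tau> + s n"] by measurable
      show "AE \<zeta> in lborel. norm (gauss 1 \<zeta> * ?f n \<zeta>)
          \<le> gauss 1 \<zeta> * \<bar>C\<bar>" for n
      proof (intro AE_I2)
        fix \<zeta>
        have "\<bar>indicator {0..1} (y + sqrt (s n) * \<zeta>) * \<phi> (\<tau> + s n) (y + sqrt (s n) * \<zeta>)\<bar> \<le> \<bar>C\<bar>"
          using C[of "(\<tau> + s n, y + sqrt (s n) * \<zeta>)"] s(2,3)[of n] by (auto simp: indicator_def)
        then show "norm (gauss 1 \<zeta> * ?f n \<zeta>)
          \<le> gauss 1 \<zeta> * \<bar>C\<bar>"
          by (simp add: abs_mult mult_left_mono)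
      qed
      show "AE \<zeta> in lborel. (\<lambda>n. gauss 1 \<zeta> * ?f n \<zeta>)
          \<longlonglongrightarrow> gauss 1 \<zeta> * (indicator {0<..<1} y * \<phi> \<tau> y)"
      proof (intro AE_I2 tendsto_mult tendsto_const)
        fix \<zeta>
        have "(\<lambda>n. y + sqrt (s n) * \<zeta>) \<longlonglongrightarrow> y + sqrt 0 * \<zeta>"
          by (intro tendsto_intros s)
        then have l: "(\<lambda>n. y + sqrt (s n) * \<zeta>) \<longlonglongrightarrow> y" by simp
        have e: "\<forall>\<^sub>F n in sequentially. indicator {0..1} (y + sqrt (s n) * \<zeta>) = (indicator {0<..<1} y :: real)"
        proof (cases "y \<in> {0<..<1}")
          case True
          then have "\<forall>\<^sub>F n in sequentially. 0 < y + sqrt (s n) * \<zeta>" "\<forall>\<^sub>F n in sequentially. y + sqrt (s n) * \<zeta> < 1"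
            using order_tendstoD[OF l] by auto
          then show ?thesis by eventually_elim (use True in auto)
        next
          case False
          then consider "y < 0" | "1 < y" using y by fastforce
          then show ?thesis
          proof cases
            case 1
            from order_tendstoD(2)[OF l 1] show ?thesis by eventually_elim (use False in auto)
          next
            case 2
            from order_tendstoD(1)[OF l 2] show ?thesis by eventually_elim (use False in auto)
          qed
        qed
        show "(\<lambda>n. indicator {0..1} (y + sqrt (s n) * \<zeta>)) \<longlonglongrightarrow> (indicator {0<..<1} y :: real)"
          by (rule tendsto_eventually[OF e])
        have "isCont (\<lambda>w. \<phi> (fst w) (snd w)) (\<tau>, y)"
          using cont by (simp add: continuous_on_eq_continuous_at)
        moreover have "(\<lambda>n. (\<tau> + s n, y + sqrt (s n) * \<zeta>)) \<longlonglongrightarrow> (\<tau> + 0, y)"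
          by (intro tendsto_intros s l)
        ultimately show "(\<lambda>n. \<phi> (\<tau> + s n) (y + sqrt (s n) * \<zeta>)) \<longlonglongrightarrow> \<phi> \<tau> y"
          using isCont_tendsto_compose[of "(\<tau>, y)" "\<lambda>w. \<phi> (fst w) (snd w)"] by fastforce
      qed
    qed simp_all
  qed
  then have "(\<lambda>n. exp (- \<omega>\<^sup>2 * s n) * (LBINT \<zeta>. gauss 1 \<zeta> * ?f n \<zeta>))
      \<longlonglongrightarrow> exp (- \<omega>\<^sup>2 * 0) * (LBINT \<zeta>. gauss 1 \<zeta> * (indicator {0<..<1} y * \<phi> \<tau> y))"
    by (intro tendsto_intros s)
  then show ?thesis by (simp add: sub integral_gauss)
qed

lemma continuous_on_heat_kernels:
  "continuous_on ({0<..} \<times> UNIV) (heat_kernel \<omega>)"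
  "continuous_on ({0<..} \<times> UNIV) (heat_kernel_dx \<omega>)"
  "continuous_on ({0<..} \<times> UNIV) (heat_kernel_dxx \<omega>)"
proof -
  show k: "continuous_on ({0<..} \<times> UNIV) (heat_kernel \<omega>)"
    by (intro continuous_at_imp_continuous_on) (auto intro: isCont_heat_kernel)
  show "continuous_on ({0<..} \<times> UNIV) (heat_kernel_dx \<omega>)"
    unfolding heat_kernel_dx_def split_beta by (intro continuous_intros) (auto simp: k)
  show "continuous_on ({0<..} \<times> UNIV) (heat_kernel_dxx \<omega>)"
    unfolding heat_kernel_dxx_def split_beta by (intro continuous_intros) (auto simp: k)
qed


text \<open>Integration by parts in \<open>x\<close> on \<open>(0, 1)\<close> leaves only the boundary term at \<open>0\<close>, which is odd
  in the position of the source.\<close>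

lemma heat_kernel_by_parts:
  assumes tf: "test_function \<phi> \<phi>t \<phi>x" and a: "\<tau> < a" "a \<le> b" "0 \<le> a" and \<phi>b: "\<And>x. 0 \<le> x \<Longrightarrow> x \<le> 1 \<Longrightarrow> \<phi> b x = 0"
    and F: "\<And>t. F t = integral {0..1} (\<lambda>x. (- \<phi>t t x + \<omega>\<^sup>2 * \<phi> t x) * heat_kernel \<omega> (t - \<tau>, x - y)
        + \<phi>x t x * heat_kernel_dx \<omega> (t - \<tau>, x - y))"
    and Fint: "F integrable_on {a..b}"
  shows "integral {a..b} F = integral {a..b} (\<lambda>t. \<phi> t 0 * heat_kernel_dx \<omega> (t - \<tau>, y))
    + integral {0..1} (\<lambda>x. heat_kernel \<omega> (a - \<tau>, x - y) * \<phi> a x)"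
proof -
  \<comment> \<open>The time derivative of the kernel times \<open>\<phi>\<close>, with the heat
    equation inserted. Added to the integrand of \<open>F\<close>, it cancels the terms with
    \<open>\<phi>t\<close> and \<open>\<omega>\<^sup>2\<close> and leaves the space derivative of
    \<open>\<phi>\<close> times \<open>heat_kernel_dx\<close>.\<close>
  define G where "G = (\<lambda>t x. heat_kernel \<omega> (t - \<tau>, x - y) * \<phi>t t x
    + (heat_kernel_dxx \<omega> (t - \<tau>, x - y) - \<omega>\<^sup>2 * heat_kernel \<omega> (t - \<tau>, x - y)) * \<phi> t x)"
  define J where "J = (\<lambda>t. integral (cbox 0 1) (\<lambda>x. heat_kernel \<omega> (t - \<tau>, x - y) * \<phi> t x))"
  have ck: "continuous_on A (\<lambda>w. k \<omega> (fst w - \<tau>, snd w - y))"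
    if "A \<subseteq> {\<tau><..} \<times> UNIV" "continuous_on ({0<..} \<times> UNIV) (k \<omega>)" for A k
    by (rule continuous_on_compose2[OF that(2)]) (use that(1) in \<open>auto intro!: continuous_intros\<close>)
  note cphi = test_function_continuous[OF tf]
  have slice: "continuous_on {0..1} (\<lambda>x. f (t, x))" if "continuous_on ({\<tau><..} \<times> {0..1}) f" "\<tau> < t"
    for f :: "real \<times> real \<Rightarrow> real" and t
    by (rule continuous_on_compose2[OF that(1)]) (use that(2) in \<open>auto intro!: continuous_intros\<close>)
  note ck' = ck[OF _ continuous_on_heat_kernels(1)] ck[OF _ continuous_on_heat_kernels(2)] ck[OF _ continuous_on_heat_kernels(3)]
  have cG: "continuous_on ({\<tau><..} \<times> {0..1}) (\<lambda>w. G (fst w) (snd w))"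
    unfolding G_def by (intro continuous_intros ck' cphi) auto
  have cJ: "continuous_on ({\<tau><..} \<times> {0..1}) (\<lambda>w. heat_kernel \<omega> (fst w - \<tau>, snd w - y) * \<phi> (fst w) (snd w))"
    by (intro continuous_intros ck' cphi) auto
  have cH: "continuous_on ({\<tau><..} \<times> {0..1}) (\<lambda>w. \<phi>x (fst w) (snd w) * heat_kernel_dx \<omega> (fst w - \<tau>, snd w - y)
      + \<phi> (fst w) (snd w) * heat_kernel_dxx \<omega> (fst w - \<tau>, snd w - y))"
    by (intro continuous_intros ck' cphi) auto
  have Jd: "(J has_real_derivative integral (cbox 0 1) (G t)) (at t within {\<tau><..})" if "\<tau> < t" for t
    unfolding J_def
  proof (rule leibniz_rule_field_derivative)
    show "((\<lambda>t. heat_kernel \<omega> (t - \<tau>, x - y) * \<phi> t x) has_real_derivative G t x) (at t within {\<tau><..})"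
      if "t \<in> {\<tau><..}" for t x
    proof -
      have "0 < t - \<tau>" using that by simp
      then have "((\<lambda>t. heat_kernel \<omega> (t - \<tau>, x - y)) has_real_derivative
          (heat_kernel_dxx \<omega> (t - \<tau>, x - y) - \<omega>\<^sup>2 * heat_kernel \<omega> (t - \<tau>, x - y)) * 1) (at t within {\<tau><..})"
        by (intro DERIV_chain2[where f="\<lambda>s. heat_kernel \<omega> (s, x - y)" and g="\<lambda>t. t - \<tau>"]
            has_real_derivative_heat_kernel_t) (auto intro!: derivative_eq_intros)
      from DERIV_mult'[OF this test_function_derivatives(1)[OF tf, of x t "{\<tau><..}"]]
      show ?thesis by (simp add: G_def)
    qed
    show "(\<lambda>x. heat_kernel \<omega> (t - \<tau>, x - y) * \<phi> t x) integrable_on cbox 0 1" if "t \<in> {\<tau><..}" for t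
      using slice[OF cJ, of t] that by (intro integrable_continuous) (simp add: cbox_interval)
    show "continuous_on ({\<tau><..} \<times> cbox 0 1) (\<lambda>(t, x). G t x)"
      using cG by (simp add: split_beta cbox_interval)
  qed (use that in auto)
  have FG: "F t + integral (cbox 0 1) (G t) = \<phi> t 0 * heat_kernel_dx \<omega> (t - \<tau>, y)" if "\<tau> < t" "0 \<le> t" for t
  proof -
    have pos: "0 < t - \<tau>" using that by simp
    have "F t + integral {0..1} (G t) = integral {0..1} (\<lambda>x. \<phi>x t x * heat_kernel_dx \<omega> (t - \<tau>, x - y)
        + \<phi> t x * heat_kernel_dxx \<omega> (t - \<tau>, x - y))"
    proof -
      have "continuous_on ({\<tau><..} \<times> {0..1}) (\<lambda>w. (- \<phi>t (fst w) (snd w) + \<omega>\<^sup>2 * \<phi> (fst w) (snd w)) * heat_kernel \<omega> (fst w - \<tau>, snd w - y)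
        + \<phi>x (fst w) (snd w) * heat_kernel_dx \<omega> (fst w - \<tau>, snd w - y))"
        by (intro continuous_intros ck' cphi) auto
      from slice[OF this that(1)] slice[OF cG that(1)]
      have "F t + integral {0..1} (G t) = integral {0..1} (\<lambda>x. ((- \<phi>t t x + \<omega>\<^sup>2 * \<phi> t x) * heat_kernel \<omega> (t - \<tau>, x - y)
        + \<phi>x t x * heat_kernel_dx \<omega> (t - \<tau>, x - y)) + G t x)"
        unfolding F by (intro Henstock_Kurzweil_Integration.integral_add[symmetric] integrable_continuous_interval) simp_all
      then show ?thesis by (simp add: G_def algebra_simps)
    qed
    also have "\<dots> = \<phi> t 1 * heat_kernel_dx \<omega> (t - \<tau>, 1 - y) - \<phi> t 0 * heat_kernel_dx \<omega> (t - \<tau>, 0 - y)"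
    proof (rule integral_unique[OF fundamental_theorem_of_calculus])
      show "((\<lambda>x. \<phi> t x * heat_kernel_dx \<omega> (t - \<tau>, x - y)) has_vector_derivative
          \<phi>x t x * heat_kernel_dx \<omega> (t - \<tau>, x - y) + \<phi> t x * heat_kernel_dxx \<omega> (t - \<tau>, x - y)) (at x within {0..1})" for x
      proof -
        have "((\<lambda>x. heat_kernel_dx \<omega> (t - \<tau>, x - y)) has_real_derivative
            heat_kernel_dxx \<omega> (t - \<tau>, x - y) * 1) (at x within {0..1})"
          by (intro DERIV_chain2[where f="\<lambda>r. heat_kernel_dx \<omega> (t - \<tau>, r)" and g="\<lambda>x. x - y"]
              has_real_derivative_heat_kernel_xx pos) (auto intro!: derivative_eq_intros)
        from DERIV_mult'[OF test_function_derivatives(2)[OF tf] this]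
        show ?thesis by (simp add: has_real_derivative_iff_has_vector_derivative[symmetric] add.commute)
      qed
    qed simp
    also have "\<dots> = \<phi> t 0 * heat_kernel_dx \<omega> (t - \<tau>, y)"
      using tf that(2) by (simp add: test_function_def heat_kernel_dx_minus)
    finally show ?thesis by (simp add: cbox_interval)
  qed
  have "((\<lambda>t. integral (cbox 0 1) (G t)) has_integral (J b - J a)) {a..b}"
  proof (rule fundamental_theorem_of_calculus[OF a(2)])
    show "(J has_vector_derivative integral (cbox 0 1) (G t)) (at t within {a..b})" if "t \<in> {a..b}" for t
      using Jd[of t] that a by (auto simp: has_real_derivative_iff_has_vector_derivative
          intro: has_vector_derivative_within_subset)
  qed
  moreover have "J b = 0"
  proof -
    have "J b = integral (cbox 0 1) (\<lambda>x::real. 0)"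
      unfolding J_def
      by (rule Henstock_Kurzweil_Integration.integral_cong) (use \<phi>b in \<open>simp add: cbox_interval\<close>)
    then show ?thesis by simp
  qed
  ultimately have GI: "((\<lambda>t. integral (cbox 0 1) (G t)) has_integral (- J a)) {a..b}" by simp
  from has_integral_add[OF integrable_integral[OF Fint] GI]
  have "((\<lambda>t. F t + integral (cbox 0 1) (G t)) has_integral (integral {a..b} F - J a)) {a..b}" by simp
  then have "((\<lambda>t. \<phi> t 0 * heat_kernel_dx \<omega> (t - \<tau>, y)) has_integral (integral {a..b} F - J a)) {a..b}"
    by (rule has_integral_eq[rotated]) (use FG a in auto)
  then show ?thesis by (simp add: integral_unique J_def cbox_interval)
qed

text \<open>The kernel is singular at its source time, so the integration by parts starts at
  \<open>\<tau> + inverse (Suc n)\<close>. As \<open>n\<close> grows, the term at the starting time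
  tends to \<open>\<phi> \<tau> y\<close> inside the interval and to \<open>0\<close> outside. The
  boundary term at \<open>x = 0\<close> is kept as a limit of integrals, a form in which its oddness
  in \<open>y\<close> is still visible.\<close>

lemma heat_kernel_dual_identity:
  assumes \<omega>: "0 < \<omega>" and tf: "test_function \<phi> \<phi>t \<phi>x" and \<tau>: "0 < \<tau>" and y: "y \<noteq> 0" "y \<noteq> 1"
    and T: "\<And>t x. T < t \<Longrightarrow> 0 \<le> x \<Longrightarrow> x \<le> 1 \<Longrightarrow> \<phi> t x = 0"
    and b: "T < b" "\<tau> + 1 < b"
    and i0: "integrable lborel (\<lambda>u. \<psi>0 u * heat_kernel \<omega> (u - (\<tau>, y)))"
    and i1: "integrable lborel (\<lambda>u. \<psi>1 u * heat_kernel_dx \<omega> (u - (\<tau>, y)))"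
    and \<psi>0: "\<And>u. \<psi>0 u = indicator strip u * (- \<phi>t (fst u) (snd u) + \<omega>\<^sup>2 * \<phi> (fst u) (snd u))"
    and \<psi>1: "\<And>u. \<psi>1 u = indicator strip u * \<phi>x (fst u) (snd u)"
    and supp: "\<And>u. b < fst u \<Longrightarrow> \<psi>0 u = 0 \<and> \<psi>1 u = 0"
  shows "(\<lambda>n. integral {\<tau> + inverse (Suc n)..b} (\<lambda>t. \<phi> t 0 * heat_kernel_dx \<omega> (t - \<tau>, y)))
    \<longlonglongrightarrow> (LBINT u. \<psi>0 u * heat_kernel \<omega> (u - (\<tau>, y)))
      + (LBINT u. \<psi>1 u * heat_kernel_dx \<omega> (u - (\<tau>, y)))
      - indicator {0<..<1} y * \<phi> \<tau> y"
proof -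
  define H where "H = (\<lambda>u. \<psi>0 u * heat_kernel \<omega> (u - (\<tau>, y)) + \<psi>1 u * heat_kernel_dx \<omega> (u - (\<tau>, y)))"
  define f where "f = (\<lambda>t x. (- \<phi>t t x + \<omega>\<^sup>2 * \<phi> t x) * heat_kernel \<omega> (t - \<tau>, x - y)
        + \<phi>x t x * heat_kernel_dx \<omega> (t - \<tau>, x - y))"
  define F where "F = (\<lambda>t. integral {0..1} (f t))"
  define Fh where "Fh = (\<lambda>t. LBINT x. H (t, x))"
  define a where "a = (\<lambda>n. \<tau> + inverse (real (Suc n)))"
  have a: "\<tau> < a n" "a n \<le> b" "a n \<le> \<tau> + 1" for n
  proof -
    have "inverse (real (Suc n)) \<le> 1" "0 < inverse (real (Suc n))"
      by (auto simp: inverse_le_1_iff)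
    then show "\<tau> < a n" "a n \<le> b" "a n \<le> \<tau> + 1" using b by (auto simp: a_def)
  qed
  have iH: "integrable lborel H" unfolding H_def using i0 i1 by (rule Bochner_Integration.integrable_add)
  then have iH': "integrable (lborel \<Otimes>\<^sub>M lborel) H" by (simp add: lborel_prod)
  have iFh: "integrable lborel Fh" unfolding Fh_def by (rule lborel_pair.integrable_fst'[OF iH'])
  have "integral\<^sup>L lborel Fh = integral\<^sup>L lborel H"
    unfolding Fh_def using lborel_pair.integral_fst'[OF iH'] by (simp add: lborel_prod)
  also have "\<dots> = (LBINT u. \<psi>0 u * heat_kernel \<omega> (u - (\<tau>, y))) + (LBINT u. \<psi>1 u * heat_kernel_dx \<omega> (u - (\<tau>, y)))"
    unfolding H_def using i0 i1 by (rule Bochner_Integration.integral_add)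
  finally have intFh: "integral\<^sup>L lborel Fh = \<dots>" .
  have Fh0: "Fh t = 0" if "t \<le> \<tau> \<or> b < t" for t
  proof -
    have "H (t, x) = 0" for x
      using that supp[of "(t, x)"] by (auto simp: H_def minus_prod_def heat_kernel_nonpos heat_kernel_dx_nonpos)
    then show ?thesis unfolding Fh_def by (simp only: integral_zero)
  qed
  have FhF: "Fh t = F t" if "\<tau> < t" for t
  proof -
    have "continuous_on {0..1} (f t)"
    proof -
      have k: "continuous_on {0..1} (\<lambda>x. k \<omega> (t - \<tau>, x - y))" if "continuous_on ({0<..} \<times> UNIV) (k \<omega>)" for k
        by (rule continuous_on_compose2[OF that]) (use \<open>\<tau> < t\<close> in \<open>auto intro!: continuous_intros\<close>)
      have "continuous_on {0..1} (\<lambda>x. (- \<phi>t t x + \<omega>\<^sup>2 * \<phi> t x) * heat_kernel \<omega> (t - \<tau>, x - y)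
        + \<phi>x t x * heat_kernel_dx \<omega> (t - \<tau>, x - y))"
        by (intro continuous_intros k continuous_on_heat_kernels
            continuous_on_real_pair[OF test_function_continuous(1)[OF tf] continuous_on_const continuous_on_id]
            continuous_on_real_pair[OF test_function_continuous(2)[OF tf] continuous_on_const continuous_on_id]
            continuous_on_real_pair[OF test_function_continuous(3)[OF tf] continuous_on_const continuous_on_id])
      then show ?thesis by (simp add: f_def)
    qed
    then have si: "set_integrable lborel {0..1} (f t)"
      by (rule borel_integrable_atLeastAtMost')
    have "F t = (LBINT x. indicator {0..1} x * f t x)"
      unfolding F_def using set_borel_integral_eq_integral(2)[OF si] by (simp add: set_lebesgue_integral_def)
    also have "\<dots> = (LBINT x. H (t, x))"
    proof (rule integral_cong_AE)
      show "(\<lambda>x. indicator {0..1} x * f t x) \<in> borel_measurable lborel"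
        using si by (simp add: set_integrable_def borel_measurable_integrable)
      have "H \<in> borel_measurable (lborel \<Otimes>\<^sub>M lborel)" using iH' by (rule borel_measurable_integrable)
      then show "(\<lambda>x. H (t, x)) \<in> borel_measurable lborel" by measurable
      have "AE x in lborel. x \<noteq> (0::real) \<and> x \<noteq> 1"
        using AE_lborel_singleton[of "0::real"] AE_lborel_singleton[of "1::real"] by eventually_elim simp
      then show "AE x in lborel. indicator {0..1} x * f t x = H (t, x)"
        by eventually_elim (use that \<tau> in \<open>auto simp: H_def \<psi>0 \<psi>1 f_def indicator_def minus_prod_def\<close>)
    qed
    finally show ?thesis by (simp add: Fh_def)
  qed
  have si: "set_integrable lborel {a n..b} Fh" for n
    unfolding set_integrable_def using iFh by (intro integrable_mult_indicator) auto
  have eqF: "integral {a n..b} F = (LBINT t. indicator {a n..b} t * Fh t)" "F integrable_on {a n..b}" for n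
  proof -
    have "integral {a n..b} F = integral {a n..b} Fh"
      by (rule Henstock_Kurzweil_Integration.integral_cong) (use a(1)[of n] FhF in auto)
    also have "\<dots> = (LBINT t. indicator {a n..b} t * Fh t)"
      using set_borel_integral_eq_integral(2)[OF si[of n]] by (simp add: set_lebesgue_integral_def)
    finally show "integral {a n..b} F = (LBINT t. indicator {a n..b} t * Fh t)" .
    show "F integrable_on {a n..b}"
      using set_borel_integral_eq_integral(1)[OF si[of n]]
      by (rule integrable_eq) (use a(1)[of n] FhF in auto)
  qed
  have an: "a \<longlonglongrightarrow> \<tau>"
    unfolding a_def using tendsto_add[OF tendsto_const[of \<tau>] LIMSEQ_inverse_real_of_nat] by simp
  have limF: "(\<lambda>n. integral {a n..b} F) \<longlonglongrightarrow> integral\<^sup>L lborel Fh"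
    unfolding eqF
  proof (rule integral_dominated_convergence[where w="\<lambda>t. norm (Fh t)"])
    show "AE t in lborel. (\<lambda>n. indicator {a n..b} t * Fh t) \<longlonglongrightarrow> Fh t"
    proof (intro AE_I2)
      fix t
      show "(\<lambda>n. indicator {a n..b} t * Fh t) \<longlonglongrightarrow> Fh t"
      proof (cases "\<tau> < t \<and> t \<le> b")
        case True
        from order_tendstoD(2)[OF an conjunct1[OF True]]
        have "\<forall>\<^sub>F n in sequentially. indicator {a n..b} t * Fh t = Fh t"
          by eventually_elim (use True in auto)
        then show ?thesis by (rule tendsto_eventually)
      qed (use Fh0 in auto)
    qed
  qed (use iFh in \<open>auto simp: indicator_def\<close>)
  have parts: "integral {a n..b} F = integral {a n..b} (\<lambda>t. \<phi> t 0 * heat_kernel_dx \<omega> (t - \<tau>, y))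
      + integral {0..1} (\<lambda>x. heat_kernel \<omega> (a n - \<tau>, x - y) * \<phi> (a n) x)" for n
    by (rule heat_kernel_by_parts[OF tf])
      (use a[of n] \<tau> b T eqF(2) in \<open>auto simp: F_def f_def[abs_def]\<close>)
  have "(\<lambda>n. integral {0..1} (\<lambda>x. heat_kernel \<omega> (inverse (Suc n), x - y) * \<phi> (\<tau> + inverse (Suc n)) x))
    \<longlonglongrightarrow> indicator {0<..<1} y * \<phi> \<tau> y"
    by (rule heat_kernel_approximate_identity[OF test_function_continuous(1)[OF tf] y LIMSEQ_inverse_real_of_nat])
      (auto simp: inverse_le_1_iff)
  then have "(\<lambda>n. integral {0..1} (\<lambda>x. heat_kernel \<omega> (a n - \<tau>, x - y) * \<phi> (a n) x))
    \<longlonglongrightarrow> indicator {0<..<1} y * \<phi> \<tau> y" by (simp add: a_def)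
  from tendsto_diff[OF limF this]
  have "(\<lambda>n. integral {a n..b} (\<lambda>t. \<phi> t 0 * heat_kernel_dx \<omega> (t - \<tau>, y)))
      \<longlonglongrightarrow> integral\<^sup>L lborel Fh - indicator {0<..<1} y * \<phi> \<tau> y"
    by (simp add: parts)
  then show ?thesis unfolding intFh by (simp add: a_def)
qed

text \<open>After Fubini the defect of the identity is the integral of \<open>R\<close>. By the dual
  identity the second factor of \<open>R\<close> is a limit of boundary integrals at
  \<open>x = 0\<close>, odd in the source position since \<open>heat_kernel_dx\<close> is odd. As
  \<open>K\<close> is even, \<open>R\<close> is odd in space and integrates to zero: this
  cancellation is the Neumann condition.\<close>

lemma heat_potential_weak_identity:
  assumes \<omega>: "0 < \<omega>" and tf: "test_function \<phi> \<phi>t \<phi>x"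
    and K[measurable]: "K \<in> borel_measurable borel" and B: "\<And>z. \<bar>K z\<bar> \<le> B"
    and ev: "\<And>t x. K (t, - x) = K (t, x)" and start: "\<And>t x. t \<le> 0 \<Longrightarrow> K (t, x) = 0"
  defines "f \<equiv> \<lambda>u. indicator strip u * (- convol (heat_kernel \<omega>) K u * \<phi>t (fst u) (snd u)
      + convol (heat_kernel_dx \<omega>) K u * \<phi>x (fst u) (snd u)
      + \<omega>\<^sup>2 * convol (heat_kernel \<omega>) K u * \<phi> (fst u) (snd u))"
  shows "integrable lborel f"
    and "(LBINT u. f u) = (LBINT u. indicator strip u * (K u * \<phi> (fst u) (snd u)))"
proof -
  obtain T C where T: "0 < T" "0 \<le> C"
    "\<And>t x. T < t \<Longrightarrow> 0 \<le> x \<Longrightarrow> x \<le> 1 \<Longrightarrow> \<phi> t x = 0"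
    "\<And>t x. T < t \<Longrightarrow> 0 < x \<Longrightarrow> x < 1 \<Longrightarrow> \<phi>t t x = 0 \<and> \<phi>x t x = 0"
    "\<And>t x. 0 \<le> t \<Longrightarrow> 0 < x \<Longrightarrow> x < 1 \<Longrightarrow> \<bar>\<phi> t x\<bar> \<le> C \<and> \<bar>\<phi>t t x\<bar> \<le> C \<and> \<bar>\<phi>x t x\<bar> \<le> C"
    by (rule test_function_support[OF tf]) (rule that)
  note [measurable] = borel_measurable_continuous_onI[OF test_function_continuous(1)[OF tf]]
    borel_measurable_continuous_onI[OF test_function_continuous(2)[OF tf]]
    borel_measurable_continuous_onI[OF test_function_continuous(3)[OF tf]]
  define \<psi>0 where "\<psi>0 = (\<lambda>u. indicator strip u * (- \<phi>t (fst u) (snd u) + \<omega>\<^sup>2 * \<phi> (fst u) (snd u)))"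
  define \<psi>1 where "\<psi>1 = (\<lambda>u. indicator strip u * \<phi>x (fst u) (snd u))"
  define D where "D = C + \<omega>\<^sup>2 * C"
  have bd0: "\<bar>- \<phi>t (fst u) (snd u) + \<omega>\<^sup>2 * \<phi> (fst u) (snd u)\<bar> \<le> D" if "u \<in> strip" for u
  proof -
    have *: "\<bar>\<phi> (fst u) (snd u)\<bar> \<le> C" "\<bar>\<phi>t (fst u) (snd u)\<bar> \<le> C" using T(5)[of "fst u" "snd u"] that by auto
    have "\<bar>\<omega>\<^sup>2 * \<phi> (fst u) (snd u)\<bar> \<le> \<omega>\<^sup>2 * C" using *(1) by (simp add: abs_mult mult_left_mono)
    then show ?thesis using *(2) unfolding D_def by linarith
  qed
  have bd1: "\<bar>\<phi>x (fst u) (snd u)\<bar> \<le> C" if "u \<in> strip" for u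
    using T(5)[of "fst u" "snd u"] that by auto
  have i0: "integrable lborel \<psi>0"
    unfolding \<psi>0_def by (rule integrable_strip[of _ D T]) (use bd0 T in auto)
  have i1: "integrable lborel \<psi>1"
    unfolding \<psi>1_def by (rule integrable_strip[of _ C T]) (use bd1 T in auto)
  have D0: "0 \<le> D" using T(2) by (simp add: D_def)
  have b0: "\<bar>\<psi>0 u\<bar> \<le> D" and b1: "\<bar>\<psi>1 u\<bar> \<le> C" for u
    using bd0[of u] bd1[of u] D0 T(2) by (auto simp: \<psi>0_def \<psi>1_def indicator_def)
  note ip = integrable_heat_kernel[OF \<omega>] and iq = integrable_heat_kernel_dx[OF \<omega>]
  have shift: "integrable lborel (\<lambda>u. q (u - c))" if "integrable lborel q" for q :: "real \<times> real \<Rightarrow> real" and c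
    using lborel_integral_shift(2)[of q "- c"] that by simp
  note pair0 = integral_mult_convol[OF i0 ip K B] and pair1 = integral_mult_convol[OF i1 iq K B]
  define G where "G = (\<lambda>v. (LBINT u. \<psi>0 u * heat_kernel \<omega> (u - v)) + (LBINT u. \<psi>1 u * heat_kernel_dx \<omega> (u - v)))"
  have f_eq: "f u = \<psi>0 u * convol (heat_kernel \<omega>) K u + \<psi>1 u * convol (heat_kernel_dx \<omega>) K u" for u
    by (simp add: f_def \<psi>0_def \<psi>1_def algebra_simps)
  show "integrable lborel f"
    unfolding f_eq[abs_def] using pair0(3) pair1(3) by (rule Bochner_Integration.integrable_add)
  have iKG: "integrable lborel (\<lambda>v. K v * G v)"
    unfolding G_def distrib_left using pair0(2) pair1(2) by (rule Bochner_Integration.integrable_add)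
  have intf: "(LBINT u. f u) = (LBINT v. K v * G v)"
    unfolding f_eq[abs_def] G_def distrib_left
    using pair0 pair1 by (simp only: Bochner_Integration.integral_add)
  define R where "R = (\<lambda>v. K v * (G v - indicator strip v * \<phi> (fst v) (snd v)))"
  have i\<phi>: "integrable lborel (\<lambda>v. indicator strip v * (K v * \<phi> (fst v) (snd v)))"
  proof (rule integrable_strip[of _ "B * C" T])
    show "\<bar>K w * \<phi> (fst w) (snd w)\<bar> \<le> B * C" if "w \<in> strip" for w
      unfolding abs_mult using B[of w] T(5)[of "fst w" "snd w"] that
      by (intro mult_mono) (auto intro: order.trans[OF abs_ge_zero])
  qed (use T in auto)
  have R_eq: "R v = K v * G v - indicator strip v * (K v * \<phi> (fst v) (snd v))" for v
    by (simp add: R_def algebra_simps)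
  have iR: "integrable lborel R"
    unfolding R_eq[abs_def] using iKG i\<phi> by (rule Bochner_Integration.integrable_diff)
  have odd: "R (\<tau>, - y) = - R (\<tau>, y)" if y: "y \<noteq> 0" "y \<noteq> 1" "y \<noteq> -1" for \<tau> y
  proof (cases "0 < \<tau>")
    case True
    define b where "b = max T (\<tau> + 1) + 1"
    have lim: "(\<lambda>n. integral {\<tau> + inverse (Suc n)..b} (\<lambda>t. \<phi> t 0 * heat_kernel_dx \<omega> (t - \<tau>, y)))
      \<longlonglongrightarrow> G (\<tau>, y) - indicator {0<..<1} y * \<phi> \<tau> y" if y: "y \<noteq> 0" "y \<noteq> 1" for y
      unfolding G_def
    proof (rule heat_kernel_dual_identity[OF \<omega> tf True y T(3)])
      show "integrable lborel (\<lambda>u. \<psi>0 u * heat_kernel \<omega> (u - (\<tau>, y)))"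
        using integrable_mult_bounded[OF shift[OF ip] borel_measurable_integrable[OF i0] b0]
        by (simp add: mult.commute)
      show "integrable lborel (\<lambda>u. \<psi>1 u * heat_kernel_dx \<omega> (u - (\<tau>, y)))"
        using integrable_mult_bounded[OF shift[OF iq] borel_measurable_integrable[OF i1] b1]
        by (simp add: mult.commute)
      show "\<psi>0 u = 0 \<and> \<psi>1 u = 0" if "b < fst u" for u
        using that T(3)[of "fst u" "snd u"] T(4)[of "fst u" "snd u"]
        by (auto simp: \<psi>0_def \<psi>1_def b_def indicator_def)
    qed (auto simp: \<psi>0_def \<psi>1_def b_def)
    have y': "- y \<noteq> 0" "- y \<noteq> 1" using y by auto
    have "(\<lambda>n. - integral {\<tau> + inverse (Suc n)..b} (\<lambda>t. \<phi> t 0 * heat_kernel_dx \<omega> (t - \<tau>, - y)))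
      \<longlonglongrightarrow> - (G (\<tau>, - y) - indicator {0<..<1} (- y) * \<phi> \<tau> (- y))"
      by (intro tendsto_minus lim[OF y'])
    moreover have "- integral {\<tau> + inverse (Suc n)..b} (\<lambda>t. \<phi> t 0 * heat_kernel_dx \<omega> (t - \<tau>, - y))
        = integral {\<tau> + inverse (Suc n)..b} (\<lambda>t. \<phi> t 0 * heat_kernel_dx \<omega> (t - \<tau>, y))" for n
      by (simp add: heat_kernel_dx_minus)
    ultimately have "- (G (\<tau>, - y) - indicator {0<..<1} (- y) * \<phi> \<tau> (- y)) = G (\<tau>, y) - indicator {0<..<1} y * \<phi> \<tau> y"
      using LIMSEQ_unique[OF _ lim[OF y(1,2)]] by simp
    then have "G (\<tau>, - y) - indicator {0<..<1} (- y) * \<phi> \<tau> (- y) = - (G (\<tau>, y) - indicator {0<..<1} y * \<phi> \<tau> y)"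
      by simp
    moreover have "indicator strip (\<tau>, y) = (indicator {0<..<1} y :: real)" for y
      using True by (auto simp: indicator_def)
    ultimately show ?thesis
      unfolding R_def fst_conv snd_conv ev by (simp only: mult_minus_right)
  next
    case False
    then show ?thesis by (simp add: R_def start)
  qed
  have "(LBINT v. R v) = (LBINT v. R (fst v, - snd v))"
    by (rule lborel_integral_reflect_snd[OF iR, symmetric])
  also have "\<dots> = (LBINT v. - R v)"
  proof (rule integral_cong_AE)
    have R[measurable]: "R \<in> borel_measurable borel" using iR by simp
    show "(\<lambda>v. R (fst v, - snd v)) \<in> borel_measurable lborel"
      by (rule measurable_compose[OF _ R]) (auto intro!: borel_measurable_continuous_onI continuous_intros)
    have "AE v::real \<times> real in lborel \<Otimes>\<^sub>M lborel. snd v \<noteq> 0 \<and> snd v \<noteq> 1 \<and> snd v \<noteq> -1"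
    proof (rule lborel_pair.AE_pair_measure)
      have "AE y::real in lborel. y \<noteq> 0 \<and> y \<noteq> 1 \<and> y \<noteq> -1"
        using AE_lborel_singleton[of "0::real"] AE_lborel_singleton[of "1::real"] AE_lborel_singleton[of "-1::real"]
        by eventually_elim simp
      then show "AE t in lborel. AE y in lborel. snd (t::real, y::real) \<noteq> 0 \<and> snd (t, y) \<noteq> 1 \<and> snd (t, y) \<noteq> -1"
        by simp
    qed measurable
    then have "AE v::real \<times> real in lborel. snd v \<noteq> 0 \<and> snd v \<noteq> 1 \<and> snd v \<noteq> -1"
      unfolding lborel_prod .
    then show "AE v in lborel. R (fst v, - snd v) = - R v"
      by eventually_elim (use odd in auto)
  qed (use borel_measurable_integrable[OF iR] in simp)
  finally have "(LBINT v. R v) = 0" by simp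
  then have "(LBINT v. K v * G v) = (LBINT v. indicator strip v * (K v * \<phi> (fst v) (snd v)))"
    unfolding R_eq[abs_def] using iKG i\<phi> by simp
  then show "(LBINT u. f u) = (LBINT u. indicator strip u * (K u * \<phi> (fst u) (snd u)))"
    using intf by simp
qed

section \<open>Stationary profiles\<close>

lemma zero_derivative_constant_on:
  fixes f :: "real \<Rightarrow> real"
  assumes "finite S" "continuous_on {0..b} f"
    and "\<And>x. 0 < x \<Longrightarrow> x < b \<Longrightarrow> x \<notin> S \<Longrightarrow> (f has_real_derivative 0) (at x)"
    and "x \<in> {0..b}"
  shows "f x = f 0"
proof (rule has_derivative_zero_unique_strong_interval[of "insert 0 (insert b S)" 0 b f "f 0" x])
  show "(f has_derivative (\<lambda>h. 0)) (at y within {0..b})" if "y \<in> {0..b} - insert 0 (insert b S)" for y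
  proof -
    have "(f has_real_derivative 0) (at y)" using that assms(3)[of y] by auto
    then show ?thesis
      by (auto simp: has_field_derivative_def lambda_zero intro: has_derivative_at_withinI)
  qed
qed (use assms in auto)

text \<open>The Wronskian of \<open>d\<close> with \<open>cosh (\<omega> x)\<close> vanishes, so \<open>d\<close> is a multiple of \<open>cosh (\<omega> x)\<close>.\<close>

lemma mixed_bvp_unique:
  fixes d e :: "real \<Rightarrow> real"
  assumes S: "finite S" and cd: "continuous_on {0..1} d" and ce: "continuous_on {0..<1} e"
    and d: "\<And>x. 0 < x \<Longrightarrow> x < 1 \<Longrightarrow> x \<notin> S \<Longrightarrow> (d has_real_derivative e x) (at x)"
    and e: "\<And>x. 0 < x \<Longrightarrow> x < 1 \<Longrightarrow> x \<notin> S \<Longrightarrow> (e has_real_derivative \<omega>\<^sup>2 * d x) (at x)"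
    and bc: "e 0 = 0" "d 1 = 0" and x: "x \<in> {0..1}"
  shows "d x = 0"
proof -
  define W where "W = (\<lambda>x. e x * cosh (\<omega> * x) - \<omega> * d x * sinh (\<omega> * x))"
  have W0: "W x = 0" if "0 \<le> x" "x < 1" for x
  proof -
    have "W x = W 0"
    proof (rule zero_derivative_constant_on[OF S, where b=x])
      show "continuous_on {0..x} W"
        unfolding W_def using that
        by (intro continuous_intros continuous_on_subset[OF cd] continuous_on_subset[OF ce]) auto
      show "(W has_real_derivative 0) (at y)" if "0 < y" "y < x" "y \<notin> S" for y
        unfolding W_def using that \<open>x < 1\<close>
        by (auto intro!: derivative_eq_intros d e simp: power2_eq_square algebra_simps)
    qed (use that in auto)
    then show ?thesis using bc by (simp add: W_def)
  qed
  define q where "q = (\<lambda>x. d x / cosh (\<omega> * x))"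
  have q: "q x = q 0" if "x \<in> {0..1}" for x
  proof (rule zero_derivative_constant_on[OF S, where b=1])
    show "continuous_on {0..1} q"
      unfolding q_def by (intro continuous_intros cd) (metis cosh_real_pos less_irrefl)
    show "(q has_real_derivative 0) (at y)" if "0 < y" "y < 1" "y \<notin> S" for y
    proof -
      have "(q has_real_derivative (e y * cosh (\<omega> * y) - d y * (sinh (\<omega> * y) * \<omega>)) / (cosh (\<omega> * y) * cosh (\<omega> * y))) (at y)"
        unfolding q_def
        by (intro DERIV_divide d that) (auto intro!: derivative_eq_intros simp: cosh_real_nonzero)
      moreover have "e y * cosh (\<omega> * y) - d y * (sinh (\<omega> * y) * \<omega>) = W y"
        by (simp add: W_def)
      ultimately show ?thesis using W0[of y] that by simp
    qed
  qed (use that in auto)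
  have "q 1 = 0" using bc by (simp add: q_def)
  then have "q x = 0" using q[of 1] q[OF x] by simp
  then show ?thesis by (simp add: q_def cosh_real_nonzero)
qed

text \<open>Divided by \<open>\<omega>\<^sup>2 * cosh \<omega>\<close>, this is the response of the
  mixed boundary value problem to the indicator of \<open>[0, s)\<close>. The branches
  \<open>bump_left\<close> and \<open>bump_right\<close> are merged by \<open>max\<close> and
  \<open>min\<close>, so that joint continuity in \<open>s\<close> and \<open>x\<close> is evident
  from the formula.\<close>

definition bump :: "real \<Rightarrow> real \<Rightarrow> real \<Rightarrow> real" where
  "bump \<omega> s x = cosh \<omega> - cosh (\<omega> * x) * cosh (\<omega> * (1 - max x s))
     - (sinh (\<omega> * x) - sinh (\<omega> * min x s)) * sinh (\<omega> * (1 - x))"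

text \<open>Superposition of the responses to the uniform source \<open>lam * f0\<close> and to the
  extra source \<open>lam * (1 - f0)\<close> on \<open>[0, s)\<close>.\<close>

definition profile :: "real \<Rightarrow> real \<Rightarrow> real \<Rightarrow> real \<Rightarrow> real \<Rightarrow> real" where
  "profile \<omega> lam f0 s x = lam / (\<omega>\<^sup>2 * cosh \<omega>) * (f0 * (cosh \<omega> - cosh (\<omega> * x)) + (1 - f0) * bump \<omega> s x)"

definition profile_dx :: "real \<Rightarrow> real \<Rightarrow> real \<Rightarrow> real \<Rightarrow> real \<Rightarrow> real" where
  "profile_dx \<omega> lam f0 s x = - lam / (\<omega> * cosh \<omega>)
     * (f0 * sinh (\<omega> * x) + (1 - f0) * (sinh (\<omega> * min x s) * cosh (\<omega> * (1 - max x s))))"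

definition step :: "real \<Rightarrow> real \<Rightarrow> real \<Rightarrow> real" where
  "step f0 s x = (if x < s then 1 else f0)"

lemma bump_left: "x \<le> s \<Longrightarrow> bump \<omega> s x = cosh \<omega> - cosh (\<omega> * x) * cosh (\<omega> * (1 - s))"
  by (simp add: bump_def max_def min_def)

lemma bump_right:
  assumes "s \<le> x"
  shows "bump \<omega> s x = sinh (\<omega> * s) * sinh (\<omega> * (1 - x))"
proof -
  have "cosh \<omega> = cosh (\<omega> * x + \<omega> * (1 - x))" by (simp add: algebra_simps)
  also have "\<dots> = cosh (\<omega> * x) * cosh (\<omega> * (1 - x)) + sinh (\<omega> * x) * sinh (\<omega> * (1 - x))"
    by (rule cosh_add)
  finally show ?thesis using assms by (simp add: bump_def max_def min_def algebra_simps)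
qed

lemma continuous_on_profile: "continuous_on A (\<lambda>w. profile \<omega> lam f0 (fst w) (snd w))"
  unfolding profile_def bump_def
  by (intro continuous_intros)

lemma continuous_on_profile_snd: "continuous_on A (profile \<omega> lam f0 s)"
  unfolding profile_def[abs_def] bump_def by (intro continuous_intros)

lemma continuous_on_profile_dx: "continuous_on A (profile_dx \<omega> lam f0 s)"
  unfolding profile_dx_def[abs_def] by (intro continuous_intros)

lemma profile_derivs:
  assumes \<omega>: "0 < \<omega>" and "x \<noteq> s"
  shows "(profile \<omega> lam f0 s has_real_derivative profile_dx \<omega> lam f0 s x) (at x)"
    and "(profile_dx \<omega> lam f0 s has_real_derivative
      \<omega>\<^sup>2 * profile \<omega> lam f0 s x - lam * step f0 s x) (at x)"
proof -
  have c: "cosh \<omega> \<noteq> 0" by (simp add: cosh_real_nonzero)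
  have "(profile \<omega> lam f0 s has_real_derivative profile_dx \<omega> lam f0 s x) (at x)
    \<and> (profile_dx \<omega> lam f0 s has_real_derivative
      \<omega>\<^sup>2 * profile \<omega> lam f0 s x - lam * step f0 s x) (at x)"
  proof (cases "x < s")
    case True
    have ev: "\<forall>\<^sub>F y in nhds x. y < s" using True eventually_nhds_in_open[of "{..<s}" x] by auto
    have 1: "((\<lambda>x. lam / (\<omega>\<^sup>2 * cosh \<omega>) * (f0 * (cosh \<omega> - cosh (\<omega> * x))
        + (1 - f0) * (cosh \<omega> - cosh (\<omega> * x) * cosh (\<omega> * (1 - s))))) has_real_derivative profile_dx \<omega> lam f0 s x) (at x)"
      using \<omega> c True by (auto intro!: derivative_eq_intros simp: profile_dx_def power2_eq_square field_simps)
    have 2: "((\<lambda>x. - lam / (\<omega> * cosh \<omega>) * (f0 * sinh (\<omega> * x) + (1 - f0) * (sinh (\<omega> * x) * cosh (\<omega> * (1 - s)))))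
        has_real_derivative \<omega>\<^sup>2 * profile \<omega> lam f0 s x - lam * step f0 s x) (at x)"
      using \<omega> c True
      by (auto intro!: derivative_eq_intros simp: profile_def bump_left step_def power2_eq_square field_simps)
    show ?thesis
      by (intro conjI; subst DERIV_cong_ev[OF refl _ refl], rule eventually_mono[OF ev])
        (use 1 2 in \<open>auto simp: profile_def bump_left profile_dx_def min_def max_def\<close>)
  next
    case False
    then have sx: "s < x" using assms by simp
    have ev: "\<forall>\<^sub>F y in nhds x. s < y" using sx eventually_nhds_in_open[of "{s<..}" x] by auto
    have 1: "((\<lambda>x. lam / (\<omega>\<^sup>2 * cosh \<omega>) * (f0 * (cosh \<omega> - cosh (\<omega> * x))
        + (1 - f0) * (sinh (\<omega> * s) * sinh (\<omega> * (1 - x))))) has_real_derivative profile_dx \<omega> lam f0 s x) (at x)"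
      using \<omega> c sx by (auto intro!: derivative_eq_intros simp: profile_dx_def power2_eq_square field_simps)
    have 2: "((\<lambda>x. - lam / (\<omega> * cosh \<omega>) * (f0 * sinh (\<omega> * x) + (1 - f0) * (sinh (\<omega> * s) * cosh (\<omega> * (1 - x)))))
        has_real_derivative \<omega>\<^sup>2 * profile \<omega> lam f0 s x - lam * step f0 s x) (at x)"
      using \<omega> c sx
      by (auto intro!: derivative_eq_intros simp: profile_def bump_right step_def power2_eq_square field_simps)
    show ?thesis
      by (intro conjI; subst DERIV_cong_ev[OF refl _ refl], rule eventually_mono[OF ev])
        (use 1 2 in \<open>auto simp: profile_def bump_right profile_dx_def min_def max_def\<close>)
  qed
  then show "(profile \<omega> lam f0 s has_real_derivative profile_dx \<omega> lam f0 s x) (at x)"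
    "(profile_dx \<omega> lam f0 s has_real_derivative
      \<omega>\<^sup>2 * profile \<omega> lam f0 s x - lam * step f0 s x) (at x)" by auto
qed

lemma profile_boundary:
  assumes "0 \<le> s" "s \<le> 1"
  shows "profile \<omega> lam f0 s 1 = 0" "profile_dx \<omega> lam f0 s 0 = 0"
  using assms by (auto simp: profile_def profile_dx_def bump_right min_def)

text \<open>The difference from the profile solves the homogeneous problem, whose only solution is
  zero. Two objects are identified in this way: the given solution \<open>u_low\<close> and the
  stationary potential of a frozen reaction.\<close>

lemma profile_unique:
  assumes \<omega>: "0 < \<omega>" and s: "0 \<le> s" "s \<le> 1" and S: "finite S"
    and cv: "continuous_on {0..1} v" and ce: "continuous_on {0..<1} e"
    and v: "\<And>x. 0 < x \<Longrightarrow> x < 1 \<Longrightarrow> x \<notin> S \<Longrightarrow> (v has_real_derivative e x) (at x)"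
    and e: "\<And>x. 0 < x \<Longrightarrow> x < 1 \<Longrightarrow> x \<notin> S \<Longrightarrow> (e has_real_derivative \<omega>\<^sup>2 * v x - lam * step f0 s x) (at x)"
    and bc: "e 0 = 0" "v 1 = 0" and x: "x \<in> {0..1}"
  shows "v x = profile \<omega> lam f0 s x"
proof -
  have "v x - profile \<omega> lam f0 s x = 0"
  proof (rule mixed_bvp_unique[where S="insert s S" and d="\<lambda>x. v x - profile \<omega> lam f0 s x"
        and e="\<lambda>x. e x - profile_dx \<omega> lam f0 s x" and \<omega>=\<omega>])
    show "((\<lambda>x. v x - profile \<omega> lam f0 s x) has_real_derivative e x - profile_dx \<omega> lam f0 s x) (at x)"
      if "0 < x" "x < 1" "x \<notin> insert s S" for x
      using that by (intro DERIV_diff v profile_derivs(1) \<omega>) auto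
    show "((\<lambda>x. e x - profile_dx \<omega> lam f0 s x) has_real_derivative \<omega>\<^sup>2 * (v x - profile \<omega> lam f0 s x)) (at x)"
      if "0 < x" "x < 1" "x \<notin> insert s S" for x
      using DERIV_diff[OF e profile_derivs(2)[OF \<omega>], of x s lam f0] that by (simp add: algebra_simps)
  qed (use S bc x profile_boundary[OF s] in \<open>auto intro!: continuous_intros cv ce continuous_on_profile_snd continuous_on_profile_dx\<close>)
  then show ?thesis by simp
qed

text \<open>Monotonicity of \<open>cosh\<close> on the positive axis. A profile that reaches
  \<open>\<mu>\<close> at its interface \<open>s\<close> is therefore at least \<open>\<mu>\<close>
  on all of \<open>[0, s]\<close>, and its own reaction is \<open>1\<close> there.\<close>

lemma profile_decreasing_left:
  assumes "0 < \<omega>" "0 \<le> lam" "0 \<le> f0" "f0 \<le> 1" "0 \<le> x" "x \<le> s"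
  shows "profile \<omega> lam f0 s s \<le> profile \<omega> lam f0 s x"
proof -
  have "cosh (\<omega> * x) \<le> cosh (\<omega> * s)"
    using assms by (subst cosh_real_nonneg_le_iff) (auto intro: mult_left_mono)
  then have "cosh (\<omega> * x) * cosh (\<omega> * (1 - s)) \<le> cosh (\<omega> * s) * cosh (\<omega> * (1 - s))"
    "f0 * (cosh \<omega> - cosh (\<omega> * s)) \<le> f0 * (cosh \<omega> - cosh (\<omega> * x))"
    using assms by (auto intro!: mult_right_mono mult_left_mono)
  moreover from this(1) have "(1 - f0) * (cosh \<omega> - cosh (\<omega> * s) * cosh (\<omega> * (1 - s)))
      \<le> (1 - f0) * (cosh \<omega> - cosh (\<omega> * x) * cosh (\<omega> * (1 - s)))"
    using assms by (intro mult_left_mono) auto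
  ultimately show ?thesis
    unfolding profile_def using assms by (intro mult_left_mono) (auto simp: bump_left)
qed

text \<open>Uniform continuity on the unit square, jointly in interface and position. It provides
  initial data near \<open>u_low\<close> in the uniform norm whose interface lies strictly beyond
  \<open>\<xi>\<close>.\<close>

lemma profile_uniformly_close:
  assumes "0 \<le> \<xi>" "\<xi> < r" "r \<le> 1" "0 < \<delta>"
  obtains s where "\<xi> < s" "s < r" "\<And>x. x \<in> {0..1} \<Longrightarrow> \<bar>profile \<omega> lam f0 s x - profile \<omega> lam f0 \<xi> x\<bar> < \<delta>"
proof -
  have "compact ({0..1::real} \<times> {0..1::real})" by (intro compact_Times) auto
  from compact_uniformly_continuous[OF continuous_on_profile this]
  obtain e where e: "0 < e" "\<And>w w'. w \<in> {0..1} \<times> {0..1} \<Longrightarrow> w' \<in> {0..1} \<times> {0..1} \<Longrightarrow> dist w' w < e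
      \<Longrightarrow> dist (profile \<omega> lam f0 (fst w') (snd w')) (profile \<omega> lam f0 (fst w) (snd w)) < \<delta>"
    unfolding uniformly_continuous_on_def using assms(4) by metis
  define s where "s = min ((\<xi> + r) / 2) (\<xi> + e / 2)"
  have s: "\<xi> < s" "s < r" "dist s \<xi> < e" using assms e(1) by (auto simp: s_def dist_real_def min_def)
  have "\<bar>profile \<omega> lam f0 s x - profile \<omega> lam f0 \<xi> x\<bar> < \<delta>" if "x \<in> {0..1}" for x
  proof -
    have "dist (s, x) (\<xi>, x) < e" using s by (simp add: dist_prod_def)
    then have "dist (profile \<omega> lam f0 (fst (s, x)) (snd (s, x))) (profile \<omega> lam f0 (fst (\<xi>, x)) (snd (\<xi>, x))) < \<delta>"
      using assms s that by (intro e(2)) auto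
    then show ?thesis by (simp add: dist_real_def)
  qed
  with s show ?thesis using that by blast
qed

section \<open>The denominator of \<open>g\<close> and its growth up to
  \<open>r_star\<close>\<close>

definition denom :: "real \<Rightarrow> real \<Rightarrow> real \<Rightarrow> real" where
  "denom f0 \<omega> r = sinh (\<omega> * r) * sinh (\<omega> - \<omega> * r) - f0 * cosh (\<omega> * r) + f0 * cosh (\<omega> * r) * cosh (\<omega> - \<omega> * r)"

lemma g_eq_denom: "g f0 \<omega> r = \<omega>\<^sup>2 * cosh \<omega> / denom f0 \<omega> r"
  by (simp add: g_def denom_def)

lemma cosh_split: "cosh \<omega> = cosh (\<omega> * r) * cosh (\<omega> - \<omega> * r) + sinh (\<omega> * r) * sinh (\<omega> - \<omega> * r)" for \<omega> r :: real
  using cosh_add[of "\<omega> * r" "\<omega> - \<omega> * r"] by simp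

lemma profile_at_interface: "profile \<omega> lam f0 s s = lam * denom f0 \<omega> s / (\<omega>\<^sup>2 * cosh \<omega>)"
proof -
  have "f0 * (cosh \<omega> - cosh (\<omega> * s)) + (1 - f0) * bump \<omega> s s = denom f0 \<omega> s"
    using cosh_split[of \<omega> s] by (simp add: bump_right denom_def algebra_simps)
  then show ?thesis by (simp add: profile_def)
qed

text \<open>The addition formula for \<open>cosh\<close> together with \<open>f0 < 1\<close> bounds
  the denominator by \<open>cosh \<omega> - cosh (\<omega> * r)\<close>.\<close>

lemma denom_less:
  assumes "0 < \<omega>" "0 < f0" "f0 < 1" "0 \<le> r" "r < 1"
  shows "denom f0 \<omega> r < cosh \<omega>"
proof -
  have "1 < cosh (\<omega> - \<omega> * r)"
    using assms cosh_real_strict_mono[of 0 "\<omega> - \<omega> * r"] by simp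
  then have "f0 * (cosh (\<omega> * r) * (cosh (\<omega> - \<omega> * r) - 1)) \<le> cosh (\<omega> * r) * (cosh (\<omega> - \<omega> * r) - 1)"
    using assms by (intro mult_left_le_one_le) auto
  then have "denom f0 \<omega> r \<le> cosh \<omega> - cosh (\<omega> * r)"
    using cosh_split[of \<omega> r] by (simp add: denom_def algebra_simps)
  then show ?thesis using cosh_real_pos[of "\<omega> * r"] by linarith
qed

lemma denom_0_pos: "0 < \<omega> \<Longrightarrow> 0 < f0 \<Longrightarrow> 0 < denom f0 \<omega> 0"
  using cosh_real_strict_mono[of 0 \<omega>] by (simp add: denom_def)

text \<open>The equation for \<open>r_star\<close> says that the derivative of \<open>denom\<close> vanishes there.\<close>

lemma denom_strict_mono:
  assumes \<omega>: "0 < \<omega>" and f0: "0 < f0" "f0 < 1"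
    and r: "r_star = 1 / 2 * (1 + 1 / \<omega> * arsinh (f0 / (f0 - 1) * sinh (\<omega> * r_star)))"
    and st: "0 \<le> s" "s < t" "t \<le> r_star"
  shows "denom f0 \<omega> s < denom f0 \<omega> t"
proof -
  \<comment> \<open>The derivative of \<open>denom\<close> divided by \<open>\<omega>\<close>. Its
    first term decreases and the subtracted one increases, so the zero at \<open>r_star\<close>
    makes it positive at every earlier point.\<close>
  define q where "q = (\<lambda>s. (1 - f0) * sinh (\<omega> - 2 * \<omega> * s) - f0 * sinh (\<omega> * s))"
  have "\<omega> * (2 * r_star - 1) = arsinh (f0 / (f0 - 1) * sinh (\<omega> * r_star))"
    using r \<omega> by (simp add: field_simps)
  then have "sinh (\<omega> * (2 * r_star - 1)) = f0 / (f0 - 1) * sinh (\<omega> * r_star)" by simp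
  moreover have "sinh (\<omega> - 2 * \<omega> * r_star) = - sinh (\<omega> * (2 * r_star - 1))"
    by (simp add: sinh_minus[symmetric] algebra_simps del: sinh_minus)
  ultimately have q0: "q r_star = 0" using f0 by (simp add: q_def field_simps)
  have qpos: "0 < q x" if "x < r_star" for x
  proof -
    have "sinh (\<omega> - 2 * \<omega> * r_star) < sinh (\<omega> - 2 * \<omega> * x)" "sinh (\<omega> * x) < sinh (\<omega> * r_star)"
      using that \<omega> by auto
    then have "(1 - f0) * sinh (\<omega> - 2 * \<omega> * r_star) < (1 - f0) * sinh (\<omega> - 2 * \<omega> * x)"
      "f0 * sinh (\<omega> * x) < f0 * sinh (\<omega> * r_star)" using f0 by auto
    then show ?thesis using q0 unfolding q_def by linarith
  qed
  have d: "(denom f0 \<omega> has_real_derivative \<omega> * q x) (at x)" for x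
  proof -
    have den: "denom f0 \<omega> = (\<lambda>r. (1 - f0) * (sinh (\<omega> * r) * sinh (\<omega> - \<omega> * r)) - f0 * cosh (\<omega> * r) + f0 * cosh \<omega>)"
    proof
      fix r
      show "denom f0 \<omega> r = (1 - f0) * (sinh (\<omega> * r) * sinh (\<omega> - \<omega> * r)) - f0 * cosh (\<omega> * r) + f0 * cosh \<omega>"
        using cosh_split[of \<omega> r] by (simp add: denom_def algebra_simps)
    qed
    have "\<omega> - 2 * \<omega> * x = (\<omega> - \<omega> * x) - \<omega> * x" by simp
    then have "sinh (\<omega> - 2 * \<omega> * x) = sinh (\<omega> - \<omega> * x) * cosh (\<omega> * x) - cosh (\<omega> - \<omega> * x) * sinh (\<omega> * x)"
      by (simp only: sinh_diff[of "\<omega> - \<omega> * x"])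
    then have qx: "q x = (1 - f0) * (sinh (\<omega> - \<omega> * x) * cosh (\<omega> * x) - cosh (\<omega> - \<omega> * x) * sinh (\<omega> * x)) - f0 * sinh (\<omega> * x)"
      by (simp add: q_def)
    show ?thesis
      unfolding den qx by (auto intro!: derivative_eq_intros simp: algebra_simps)
  qed
  show ?thesis
  proof (rule DERIV_pos_imp_increasing_open[OF st(2)])
    show "\<exists>y. (denom f0 \<omega> has_real_derivative y) (at x) \<and> 0 < y" if "s < x" "x < t" for x
      using d[of x] qpos[of x] \<omega> that st by auto
    show "continuous_on {s..t} (denom f0 \<omega>)"
      using d by (intro continuous_at_imp_continuous_on ballI DERIV_isCont)
  qed
qed


section \<open>Stationary heat potentials\<close>

text \<open>Up to a factor and a null set this is the time integral of the heat kernel, and a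
  marginal of an integrable function is integrable.\<close>

lemma integrable_exp_abs:
  assumes "0 < \<omega>"
  shows "integrable lborel (\<lambda>r::real. exp (- \<omega> * \<bar>r\<bar>))"
proof -
  have "integrable (lborel \<Otimes>\<^sub>M lborel) (\<lambda>(s, r). heat_kernel \<omega> (s, r))"
    using integrable_heat_kernel[OF assms] by (simp add: lborel_prod)
  from integrable_mult_right[OF lborel_pair.integrable_snd[OF this], of "2 * \<omega>"]
  have "integrable lborel (\<lambda>r. 2 * \<omega> * (LBINT s. heat_kernel \<omega> (s, r)))" by simp
  moreover have "AE r in lborel. 2 * \<omega> * (LBINT s. heat_kernel \<omega> (s, r)) = exp (- \<omega> * \<bar>r\<bar>)"
    using AE_lborel_singleton[of "0::real"]
    by eventually_elim (use assms in \<open>simp add: laplace_transform_heat_kernel(2)\<close>)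
  ultimately show ?thesis
    using integrable_cong_AE[of "\<lambda>r. 2 * \<omega> * (LBINT s. heat_kernel \<omega> (s, r))" lborel "\<lambda>r. exp (- \<omega> * \<bar>r\<bar>)"]
    by (auto dest: borel_measurable_integrable)
qed

text \<open>Integration over time first leaves
  \<open>exp (- \<omega> * \<bar>r\<bar>) / (2 * \<omega>)\<close>, the resolvent kernel of
  \<open>- u'' + \<omega>\<^sup>2 u\<close> on the line.\<close>

lemma stationary_convol:
  assumes \<omega>: "0 < \<omega>" and k[measurable]: "k \<in> borel_measurable borel" and B: "\<And>x. \<bar>k x\<bar> \<le> B"
  shows "convol (heat_kernel \<omega>) (\<lambda>w. k (snd w)) (t, x) = (LBINT y. exp (- \<omega> * \<bar>x - y\<bar>) * k y) / (2 * \<omega>)"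
proof -
  have m: "(\<lambda>w::real \<times> real. k (snd w)) \<in> borel_measurable borel"
    by (rule measurable_compose[OF _ k]) (auto intro!: borel_measurable_continuous_onI continuous_intros)
  have "integrable lborel (\<lambda>w. heat_kernel \<omega> w * k (snd ((t, x) - w)))"
    by (rule integrable_convol[OF integrable_heat_kernel[OF \<omega>] m B])
  then have i: "integrable (lborel \<Otimes>\<^sub>M lborel) (\<lambda>(s, r). heat_kernel \<omega> (s, r) * k (x - r))"
    by (simp add: lborel_prod case_prod_beta')
  have "convol (heat_kernel \<omega>) (\<lambda>w. k (snd w)) (t, x)
      = (LBINT r. LBINT s. heat_kernel \<omega> (s, r) * k (x - r))"
    using lborel_pair.integral_snd[OF i] by (simp add: convol_def lborel_prod case_prod_beta')
  also have "\<dots> = (LBINT r. exp (- \<omega> * \<bar>r\<bar>) / (2 * \<omega>) * k (x - r))"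
  proof (rule integral_cong_AE)
    show "AE r in lborel. (LBINT s. heat_kernel \<omega> (s, r) * k (x - r)) = exp (- \<omega> * \<bar>r\<bar>) / (2 * \<omega>) * k (x - r)"
      using AE_lborel_singleton[of "0::real"]
      by eventually_elim (use \<omega> in \<open>simp add: laplace_transform_heat_kernel(2)\<close>)
    show "(\<lambda>r. LBINT s. heat_kernel \<omega> (s, r) * k (x - r)) \<in> borel_measurable lborel"
      using lborel_pair.integrable_snd[OF i] by (rule borel_measurable_integrable)
  qed measurable
  also have "\<dots> = (LBINT r. exp (- \<omega> * \<bar>r\<bar>) * k (x - r)) / (2 * \<omega>)" by simp
  also have "(LBINT r. exp (- \<omega> * \<bar>r\<bar>) * k (x - r)) = (LBINT y. exp (- \<omega> * \<bar>x - y\<bar>) * k y)"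
    using lborel_integral_reflect(1)[of "\<lambda>r. exp (- \<omega> * \<bar>x - r\<bar>) * k r" x] by simp
  finally show ?thesis .
qed

lemma borel_measurable_step [measurable]: "step f0 s \<in> borel_measurable borel"
  unfolding step_def[abs_def] by measurable

lemma borel_measurable_reflect1:
  assumes "k \<in> borel_measurable borel"
  shows "reflect k \<in> borel_measurable borel"
proof -
  note [measurable] = assms
  show ?thesis unfolding reflect_def[abs_def] by measurable
qed

text \<open>The left side is shown to solve the boundary value problem of the profile. For
  \<open>x \<ge> 0\<close> the convolution splits into a constant \<open>C\<close> from the half
  lines and into integrals over \<open>[0, x]\<close>, which can be differentiated; outside
  \<open>[0, 1)\<close> the reflected source is felt only through \<open>C\<close>, whose value is
  never computed. The condition at \<open>1\<close> comes from oddness.\<close>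

lemma profile_eq_convol:
  assumes \<omega>: "0 < \<omega>" and s: "0 \<le> s" "s \<le> 1" and x: "x \<in> {0..1}"
  shows "convol (heat_kernel \<omega>) (\<lambda>w. reflect (\<lambda>x. lam * step f0 s x) (snd w)) (t, x) = profile \<omega> lam f0 s x"
proof -
  define k where "k = reflect (\<lambda>x. lam * step f0 s x)"
  define B where "B = \<bar>lam\<bar> * (1 + \<bar>f0\<bar>)"
  have k[measurable]: "k \<in> borel_measurable borel"
    unfolding k_def by (intro borel_measurable_reflect1) measurable
  have B: "\<bar>k x\<bar> \<le> B" for x
    unfolding k_def by (rule reflect_bounded) (auto simp: B_def step_def abs_mult algebra_simps)
  have kmin: "k (- y) = k y" for y by (simp add: k_def reflect_minus)
  have kstep: "k y = lam * step f0 s y" if "0 \<le> y" "y < 1" for y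
    using that by (simp add: k_def reflect_eq)
  define v where "v = (\<lambda>x. convol (heat_kernel \<omega>) (\<lambda>w. k (snd w)) (t, x))"
  define L where "L = (\<lambda>y. indicator {..<0} y * (exp (\<omega> * y) * k y))"
  define R where "R = (\<lambda>y. indicator {0..} y * (exp (- \<omega> * y) * k y))"
  define C where "C = (LBINT y. L y)"
  have iE: "integrable lborel (\<lambda>y. exp (- \<omega> * \<bar>y\<bar>) * k y)"
    by (rule integrable_mult_bounded[OF integrable_exp_abs[OF \<omega>] _ B]) simp
  have iL: "integrable lborel L" and iR: "integrable lborel R"
  proof -
    have "L = (\<lambda>y. (exp (- \<omega> * \<bar>y\<bar>) * k y) * indicator {..<0} y)" "R = (\<lambda>y. (exp (- \<omega> * \<bar>y\<bar>) * k y) * indicator {0..} y)"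
      by (auto simp: L_def R_def indicator_def)
    then show "integrable lborel L" "integrable lborel R"
      using integrable_real_mult_indicator[OF _ iE, of "{..<0}"] integrable_real_mult_indicator[OF _ iE, of "{0..}"]
      by simp_all
  qed
  \<comment> \<open>Evenness of the source makes the two half-line integrals equal; this gives
    \<open>v1 0 = 0\<close>, the Neumann condition.\<close>
  have CR: "(LBINT y. R y) = C"
  proof -
    have "C = (LBINT y. L (0 - y))"
      unfolding C_def by (rule lborel_integral_reflect(1)[symmetric]) (use borel_measurable_integrable[OF iL] in simp)
    also have "\<dots> = (LBINT y. R y)"
    proof (rule integral_cong_AE)
      show "AE y in lborel. L (0 - y) = R y"
        using AE_lborel_singleton[of "0::real"]
        by eventually_elim (auto simp: L_def R_def kmin indicator_def)
      show "(\<lambda>y. L (0 - y)) \<in> borel_measurable lborel" unfolding L_def by measurable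
      show "R \<in> borel_measurable lborel" using iR by (rule borel_measurable_integrable)
    qed
    finally show ?thesis ..
  qed
  define m where "m = (\<lambda>c x. integral {0..x} (\<lambda>y. exp (c * y) * k y))"
  have si: "set_integrable lborel {0..x} (\<lambda>y. exp (c * y) * k y)" for c x :: real
  proof -
    have "set_integrable lborel {0..x} (\<lambda>y. exp (c * y))"
      by (intro borel_integrable_atLeastAtMost' continuous_intros)
    then have "integrable lborel (\<lambda>y. (indicator {0..x} y * exp (c * y)) * k y)"
      by (intro integrable_mult_bounded[OF _ _ B]) (auto simp: set_integrable_def)
    then show ?thesis by (simp add: set_integrable_def mult.assoc)
  qed
  have ik: "(\<lambda>y. exp (c * y) * k y) integrable_on {0..x}" for c x :: real
    by (rule set_borel_integral_eq_integral(1)[OF si])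
  have m_eq: "m c x = (LBINT y. indicator {0..x} y * (exp (c * y) * k y))" for c x
    using set_borel_integral_eq_integral(2)[OF si[of x c]] by (simp add: m_def set_lebesgue_integral_def)
  have v_eq: "v x = (exp (\<omega> * x) * (C - m (- \<omega>) x) + exp (- \<omega> * x) * (C + m \<omega> x)) / (2 * \<omega>)" if "0 \<le> x" for x
  proof -
    have split: "exp (- \<omega> * \<bar>x - y\<bar>) * k y = exp (- \<omega> * x) * L y + exp (\<omega> * x) * R y
        + exp (- \<omega> * x) * (indicator {0..x} y * (exp (\<omega> * y) * k y))
        - exp (\<omega> * x) * (indicator {0..x} y * (exp (- \<omega> * y) * k y))" for y
    proof -
      consider "y < 0" | "0 \<le> y" "y \<le> x" | "x < y" by linarith
      then show ?thesis
      proof cases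
        case 1
        then have "\<bar>x - y\<bar> = x - y" using that by simp
        then have "exp (- \<omega> * \<bar>x - y\<bar>) = exp (- \<omega> * x) * exp (\<omega> * y)" by (simp add: exp_add[symmetric] algebra_simps)
        then show ?thesis using 1 by (simp add: L_def R_def)
      next
        case 2
        then have "\<bar>x - y\<bar> = x - y" by simp
        then have "exp (- \<omega> * \<bar>x - y\<bar>) = exp (- \<omega> * x) * exp (\<omega> * y)" by (simp add: exp_add[symmetric] algebra_simps)
        then show ?thesis using 2 by (simp add: L_def R_def)
      next
        case 3
        then have "\<bar>x - y\<bar> = y - x" by simp
        then have "exp (- \<omega> * \<bar>x - y\<bar>) = exp (\<omega> * x) * exp (- \<omega> * y)" by (simp add: exp_add[symmetric] algebra_simps)
        then show ?thesis using 3 that by (simp add: L_def R_def)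
      qed
    qed
    have i: "integrable lborel (\<lambda>y. indicator {0..x} y * (exp (c * y) * k y))" for c
      using si[of x c] by (simp add: set_integrable_def)
    have "v x = (LBINT y. exp (- \<omega> * \<bar>x - y\<bar>) * k y) / (2 * \<omega>)"
      unfolding v_def by (rule stationary_convol[OF \<omega> k B])
    also have "(LBINT y. exp (- \<omega> * \<bar>x - y\<bar>) * k y)
        = exp (- \<omega> * x) * C + exp (\<omega> * x) * C + exp (- \<omega> * x) * m \<omega> x - exp (\<omega> * x) * m (- \<omega>) x"
    proof -
      have lin: "(LBINT y. a * p y + b * q y + a * p' y - b * q' y)
          = a * integral\<^sup>L lborel p + b * integral\<^sup>L lborel q + a * integral\<^sup>L lborel p' - b * integral\<^sup>L lborel q'"
        if "integrable lborel p" "integrable lborel q" "integrable lborel p'" "integrable lborel q'"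
        for a b and p q p' q' :: "real \<Rightarrow> real"
        using that by simp
      show ?thesis unfolding split lin[OF iL iR i i] by (simp only: CR C_def[symmetric] m_eq)
    qed
    finally show ?thesis by (simp add: algebra_simps)
  qed
  let ?P = "\<lambda>x. exp (\<omega> * x) * (C - m (- \<omega>) x)" and ?Q = "\<lambda>x. exp (- \<omega> * x) * (C + m \<omega> x)"
  \<comment> \<open>The derivatives of \<open>?P\<close> and \<open>?Q\<close> in the raw shape of
    the product rule. The source terms cancel in the sum, which gives \<open>v1\<close>, and
    reinforce each other in the difference, which gives the equation.\<close>
  let ?P1 = "\<lambda>x. ((exp (\<omega> * x) * \<omega>) * (C - m (- \<omega>) x) + (0 - exp (- \<omega> * x) * (lam * step f0 s x)) * exp (\<omega> * x))"
    and ?Q1 = "\<lambda>x. ((exp (- \<omega> * x) * - \<omega>) * (C + m \<omega> x) + (0 + exp (\<omega> * x) * (lam * step f0 s x)) * exp (- \<omega> * x))"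
  define v1 where "v1 = (\<lambda>x. (?P x - ?Q x) / 2)"
  have cm: "continuous_on {0..1} (m c)" for c
    unfolding m_def by (rule indefinite_integral_continuous_1[OF ik])
  have dm: "(m c has_real_derivative exp (c * x) * (lam * step f0 s x)) (at x)" if "0 < x" "x < 1" "x \<noteq> s" for c x
  proof -
    have "isCont (\<lambda>y. exp (c * y) * k y) x"
    proof -
      have "\<forall>\<^sub>F y in nhds x. k y = lam * step f0 s x"
      proof -
        have "open ({0<..<1} \<inter> (if x < s then {..<s} else {s<..}))" by auto
        then have "\<forall>\<^sub>F y in nhds x. y \<in> {0<..<1} \<inter> (if x < s then {..<s} else {s<..})"
          using that by (intro eventually_nhds_in_open) auto
        then show ?thesis
          by eventually_elim (auto simp: kstep step_def split: if_splits)
      qed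
      then have "isCont k x" by (subst isCont_cong) auto
      then show ?thesis by (intro continuous_intros)
    qed
    then have "((\<lambda>u. integral {0..u} (\<lambda>y. exp (c * y) * k y)) has_vector_derivative exp (c * x) * k x) (at x within {0..1} - {})"
      using that by (intro integral_has_vector_derivative_continuous_at[OF ik]) (auto intro: continuous_at_imp_continuous_at_within)
    then have "(m c has_real_derivative exp (c * x) * k x) (at x within {0..1})"
      by (simp add: m_def[abs_def] has_real_derivative_iff_has_vector_derivative)
    moreover have "at x within {0..1} = at x" using that by (intro at_within_interior) auto
    ultimately show ?thesis using that by (simp add: kstep)
  qed
  have ee: "exp (\<omega> * x) * exp (- \<omega> * x) = 1" for x by (simp add: exp_add[symmetric])
  have "v x = profile \<omega> lam f0 s x"
  proof (rule profile_unique[OF \<omega> s, where S="{s}" and e=v1])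
    have "continuous_on {0..1} (\<lambda>x. (?P x + ?Q x) / (2 * \<omega>))"
      using \<omega> by (intro continuous_intros cm) auto
    then show "continuous_on {0..1} v"
      by (rule continuous_on_eq) (use v_eq in auto)
    show "continuous_on {0..<1} v1"
      unfolding v1_def by (intro continuous_intros continuous_on_subset[OF cm]) auto
    show "(v has_real_derivative v1 x) (at x)" if "0 < x" "x < 1" "x \<notin> {s}" for x
    proof -
      have "((\<lambda>x. (?P x + ?Q x) / (2 * \<omega>)) has_real_derivative
        (?P1 x
         + ?Q1 x) / (2 * \<omega>)) (at x)"
        using that by (intro DERIV_cdivide DERIV_add DERIV_mult DERIV_diff dm DERIV_const)
          (auto intro!: derivative_eq_intros)
      also have "(?P1 x
         + ?Q1 x) / (2 * \<omega>) = v1 x"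
        using \<omega> by (simp add: v1_def field_simps)
      finally show ?thesis
        by (rule has_field_derivative_transform_within_open[of _ _ _ "{0<..}"]) (use that v_eq in auto)
    qed
    show "(v1 has_real_derivative \<omega>\<^sup>2 * v x - lam * step f0 s x) (at x)" if "0 < x" "x < 1" "x \<notin> {s}" for x
    proof -
      have "(v1 has_real_derivative
        (?P1 x
         - ?Q1 x) / 2) (at x)"
        unfolding v1_def using that by (intro DERIV_cdivide DERIV_add DERIV_mult DERIV_diff dm DERIV_const)
          (auto intro!: derivative_eq_intros)
      also have "(?P1 x
         - ?Q1 x) / 2
         = \<omega>\<^sup>2 * v x - (exp (\<omega> * x) * exp (- \<omega> * x)) * (lam * step f0 s x)"
      proof -
        have vx: "\<omega>\<^sup>2 * v x = \<omega> * (?P x + ?Q x) / 2"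
          using \<omega> that by (subst v_eq) (auto simp: power2_eq_square)
        show ?thesis unfolding vx by (simp add: field_simps)
      qed
      finally show ?thesis unfolding ee by simp
    qed
    show "v1 0 = 0" by (simp add: v1_def m_def)
    have "even_odd (convol (heat_kernel \<omega>) (\<lambda>w. k (snd w)))"
    proof (rule even_odd_convol[OF \<omega> _ B])
      show "(\<lambda>w::real \<times> real. k (snd w)) \<in> borel_measurable borel"
        by (rule measurable_compose[OF _ k]) (auto intro!: borel_measurable_continuous_onI continuous_intros)
      show "even_odd (\<lambda>w. k (snd w))" by (simp add: even_odd_def k_def reflect_minus reflect_diff)
    qed
    then have "v (2 - 1) = - v 1" unfolding even_odd_def v_def by blast
    then show "v 1 = 0" by simp
  qed (use x in auto)
  then show ?thesis by (simp add: v_def k_def)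
qed

section \<open>From heat potentials to weak solutions\<close>

text \<open>The bridge between two measures: solutions are defined with
  \<open>lebesgue_on S\<close>, whereas the calculus is done with \<open>lborel\<close> and Borel
  functions.\<close>

lemma lebesgue_on_borel:
  fixes f :: "'a::euclidean_space \<Rightarrow> real"
  assumes S: "S \<in> sets borel" and f: "f \<in> borel_measurable borel"
  shows "f \<in> borel_measurable (lebesgue_on S)"
    and "integrable (lebesgue_on S) f \<longleftrightarrow> integrable lborel (\<lambda>x. indicator S x * f x)"
    and "(\<integral>x. f x \<partial>lebesgue_on S) = (LBINT x. indicator S x * f x)"
proof -
  have m: "(\<lambda>x. indicator S x * f x) \<in> borel_measurable lborel" using S f by measurable
  have S': "S \<inter> space lebesgue \<in> sets lebesgue" using S by simp
  show "f \<in> borel_measurable (lebesgue_on S)"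
    using f by (intro measurable_restrict_space1 measurable_completion) simp
  show "integrable (lebesgue_on S) f \<longleftrightarrow> integrable lborel (\<lambda>x. indicator S x * f x)"
    using integrable_restrict_space[OF S', of f] integrable_completion[OF m] by simp
  show "(\<integral>x. f x \<partial>lebesgue_on S) = (LBINT x. indicator S x * f x)"
    using integral_restrict_space[OF S', of f] integral_completion[OF m] by simp
qed

lemma in_L2_bounded:
  fixes f :: "'a::euclidean_space \<Rightarrow> real"
  assumes S: "S \<in> sets borel" "emeasure lborel S < \<infinity>" and f: "f \<in> borel_measurable borel"
    and B: "\<And>x. x \<in> S \<Longrightarrow> \<bar>f x\<bar> \<le> B"
  shows "in_L2 S f"
proof -
  have "integrable lborel (\<lambda>x. indicator S x * (f x)\<^sup>2)"
  proof (rule integrableI_bounded_set[where A=S and B="B\<^sup>2"])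
    show "AE x in lborel. x \<in> S \<longrightarrow> norm (indicator S x * (f x)\<^sup>2) \<le> B\<^sup>2"
    proof (intro AE_I2 impI)
      fix x assume "x \<in> S"
      then have "\<bar>f x\<bar>\<^sup>2 \<le> B\<^sup>2" using B by (intro power_mono) auto
      then show "norm (indicator S x * (f x)\<^sup>2) \<le> B\<^sup>2" using \<open>x \<in> S\<close> by simp
    qed
  qed (use S f in auto)
  then show ?thesis
    using lebesgue_on_borel(1,2)[OF S(1), of f] lebesgue_on_borel(2)[OF S(1), of "\<lambda>x. (f x)\<^sup>2"] f
    by (simp add: in_L2_def)
qed

lemma profile_bounded:
  obtains B where "\<And>x. x \<in> {0..1} \<Longrightarrow> \<bar>profile \<omega> lam f0 s x\<bar> \<le> B"
    "\<And>x. x \<in> {0..1} \<Longrightarrow> \<bar>profile_dx \<omega> lam f0 s x\<bar> \<le> B"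
proof -
  have "bounded (profile \<omega> lam f0 s ` {0..1})" "bounded (profile_dx \<omega> lam f0 s ` {0..1})"
    by (auto intro!: compact_imp_bounded compact_continuous_image continuous_on_profile_snd continuous_on_profile_dx)
  then obtain B1 B2 where "\<forall>x\<in>{0..1}. \<bar>profile \<omega> lam f0 s x\<bar> \<le> B1" "\<forall>x\<in>{0..1}. \<bar>profile_dx \<omega> lam f0 s x\<bar> \<le> B2"
    by (auto simp: bounded_iff)
  then show ?thesis using that[of "max B1 B2"] by fastforce
qed

lemma profile_measurable [measurable]:
  "profile \<omega> lam f0 s \<in> borel_measurable borel" "profile_dx \<omega> lam f0 s \<in> borel_measurable borel"
  by (intro borel_measurable_continuous_onI continuous_on_profile_snd continuous_on_profile_dx)+

lemma borel_measurable_snd: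
  fixes k :: "real \<Rightarrow> real"
  assumes "k \<in> borel_measurable borel"
  shows "(\<lambda>w::real \<times> real. k (snd w)) \<in> borel_measurable borel"
  by (rule measurable_compose[OF _ assms]) (auto intro!: borel_measurable_continuous_onI continuous_intros)

text \<open>The integrand is split. \<open>F1\<close>, integrated in time for fixed
  \<open>x\<close>, yields the initial value. \<open>F2\<close> is, for fixed \<open>t > 0\<close>,
  the space derivative of \<open>profile_dx\<close> times \<open>\<phi>\<close> and integrates to
  zero, since \<open>profile_dx\<close> vanishes at \<open>0\<close> and \<open>\<phi>\<close> at
  \<open>1\<close>.\<close>

lemma profile_weak_identity:
  fixes \<omega> lam f0 s :: real
  assumes \<omega>: "0 < \<omega>" and s: "0 \<le> s" "s \<le> 1" and tf: "test_function \<phi> \<phi>t \<phi>x"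
  defines "F \<equiv> \<lambda>w. indicator strip w * (- profile \<omega> lam f0 s (snd w) * \<phi>t (fst w) (snd w)
      + (profile_dx \<omega> lam f0 s (snd w) * \<phi>x (fst w) (snd w)
        + (\<omega>\<^sup>2 * profile \<omega> lam f0 s (snd w) - lam * step f0 s (snd w)) * \<phi> (fst w) (snd w)))"
  shows "integrable lborel F"
    and "(LBINT w. F w) = (LBINT x. indicator {0<..<1} x * (profile \<omega> lam f0 s x * \<phi> 0 x))"
proof -
  let ?U = "profile \<omega> lam f0 s" and ?U' = "profile_dx \<omega> lam f0 s"
  obtain T C where T: "0 < T" "0 \<le> C"
    "\<And>t x. T < t \<Longrightarrow> 0 \<le> x \<Longrightarrow> x \<le> 1 \<Longrightarrow> \<phi> t x = 0"
    "\<And>t x. T < t \<Longrightarrow> 0 < x \<Longrightarrow> x < 1 \<Longrightarrow> \<phi>t t x = 0 \<and> \<phi>x t x = 0"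
    "\<And>t x. 0 \<le> t \<Longrightarrow> 0 < x \<Longrightarrow> x < 1 \<Longrightarrow> \<bar>\<phi> t x\<bar> \<le> C \<and> \<bar>\<phi>t t x\<bar> \<le> C \<and> \<bar>\<phi>x t x\<bar> \<le> C"
    by (rule test_function_support[OF tf]) (rule that)
  obtain B where B: "\<And>x. x \<in> {0..1} \<Longrightarrow> \<bar>?U x\<bar> \<le> B" "\<And>x. x \<in> {0..1} \<Longrightarrow> \<bar>?U' x\<bar> \<le> B"
    using profile_bounded by blast
  note [measurable] = borel_measurable_continuous_onI[OF test_function_continuous(1)[OF tf]]
    borel_measurable_continuous_onI[OF test_function_continuous(2)[OF tf]]
    borel_measurable_continuous_onI[OF test_function_continuous(3)[OF tf]]
  note snd_m[measurable] = borel_measurable_snd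
  define G where "G = (\<lambda>w::real \<times> real. \<omega>\<^sup>2 * ?U (snd w) - lam * step f0 s (snd w))"
  define D where "D = \<omega>\<^sup>2 * B + \<bar>lam\<bar> * (1 + \<bar>f0\<bar>)"
  have [measurable]: "G \<in> borel_measurable borel"
    unfolding G_def by (intro snd_m) measurable
  have G: "\<bar>G w\<bar> \<le> D" if "snd w \<in> {0..1}" for w
  proof -
    have "\<bar>\<omega>\<^sup>2 * ?U (snd w)\<bar> \<le> \<omega>\<^sup>2 * B" using B(1)[OF that] by (simp add: abs_mult mult_left_mono)
    moreover have "\<bar>lam * step f0 s (snd w)\<bar> \<le> \<bar>lam\<bar> * (1 + \<bar>f0\<bar>)"
      unfolding abs_mult by (intro mult_left_mono) (auto simp: step_def)
    ultimately show ?thesis unfolding G_def D_def by linarith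
  qed
  define F1 where "F1 = (\<lambda>w. indicator strip w * (- ?U (snd w) * \<phi>t (fst w) (snd w)))"
  define F2 where "F2 = (\<lambda>w. indicator strip w * (?U' (snd w) * \<phi>x (fst w) (snd w) + G w * \<phi> (fst w) (snd w)))"
  have F: "F w = F1 w + F2 w" for w
    unfolding F_def F1_def F2_def G_def by (simp only: distrib_left)
  have i1: "integrable lborel F1"
    unfolding F1_def
  proof (rule integrable_strip[of _ "B * C" T])
    show "(\<lambda>w. - ?U (snd w) * \<phi>t (fst w) (snd w)) \<in> borel_measurable borel"
      by (intro borel_measurable_times borel_measurable_uminus snd_m) measurable
    show "\<bar>- ?U (snd w) * \<phi>t (fst w) (snd w)\<bar> \<le> B * C" if "w \<in> strip" for w
      using B(1)[of "snd w"] T(5)[of "fst w" "snd w"] that unfolding abs_mult abs_minus_cancel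
      by (intro mult_mono) (auto intro: order.trans[OF abs_ge_zero])
  qed (use T in auto)
  have i2: "integrable lborel F2"
    unfolding F2_def
  proof (rule integrable_strip[of _ "B * C + D * C" T])
    show "(\<lambda>w. ?U' (snd w) * \<phi>x (fst w) (snd w) + G w * \<phi> (fst w) (snd w)) \<in> borel_measurable borel"
      by (intro borel_measurable_add borel_measurable_times snd_m) measurable
    show "\<bar>?U' (snd w) * \<phi>x (fst w) (snd w) + G w * \<phi> (fst w) (snd w)\<bar> \<le> B * C + D * C" if w: "w \<in> strip" for w
    proof -
      have "\<bar>?U' (snd w) * \<phi>x (fst w) (snd w)\<bar> \<le> B * C" "\<bar>G w * \<phi> (fst w) (snd w)\<bar> \<le> D * C"
        using B(2)[of "snd w"] G[of w] T(5)[of "fst w" "snd w"] w unfolding abs_mult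
        by (auto intro!: mult_mono intro: order.trans[OF abs_ge_zero])
      then show ?thesis by linarith
    qed
  qed (use T in auto)
  show "integrable lborel F"
    unfolding F[abs_def] using i1 i2 by (rule Bochner_Integration.integrable_add)
  have p1: "integrable (lborel \<Otimes>\<^sub>M lborel) (\<lambda>(t, x). F1 (t, x))"
    and p2: "integrable (lborel \<Otimes>\<^sub>M lborel) (\<lambda>(t, x). F2 (t, x))"
    using i1 i2 by (simp_all add: lborel_prod)
  have "(LBINT w. F2 w) = (LBINT t. LBINT x. F2 (t, x))"
    using lborel_pair.integral_fst[OF p2] by (simp add: lborel_prod)
  also have "(LBINT t. LBINT x. F2 (t, x)) = (\<integral>t. 0 \<partial>(lborel::real measure))"
  proof (rule integral_cong_AE)
    show "AE t in lborel. (LBINT x. F2 (t, x)) = 0"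
      using lborel_pair.AE_integrable_fst[OF p2]
    proof eventually_elim
      case (elim t)
      show ?case
      proof (cases "0 < t")
        case True
        define q where "q = (\<lambda>x. ?U' x * \<phi>x t x + G (t, x) * \<phi> t x)"
        have F2q: "F2 (t, x) = indicator {0<..<1} x *\<^sub>R q x" for x
          using True by (auto simp: F2_def q_def indicator_def)
        then have si: "set_integrable lborel {0<..<1} q" using elim by (simp add: set_integrable_def)
        have "(q has_integral (?U' 1 * \<phi> t 1 - ?U' 0 * \<phi> t 0)) {0..1}"
        proof (rule fundamental_theorem_of_calculus_interior_strong[of "{s}" 0 1 "\<lambda>x. ?U' x * \<phi> t x"])
          show "((\<lambda>x. ?U' x * \<phi> t x) has_vector_derivative q x) (at x)" if "x \<in> {0<..<1} - {s}" for x
            using DERIV_mult'[OF profile_derivs(2)[OF \<omega>, of x s lam f0] test_function_derivatives(2)[OF tf, of t x UNIV]] that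
            by (simp add: q_def G_def has_real_derivative_iff_has_vector_derivative[symmetric])
          show "continuous_on {0..1} (\<lambda>x. ?U' x * \<phi> t x)"
            by (intro continuous_intros continuous_on_profile_dx
                continuous_on_real_pair[OF test_function_continuous(1)[OF tf] continuous_on_const continuous_on_id])
        qed auto
        moreover have "?U' 1 * \<phi> t 1 - ?U' 0 * \<phi> t 0 = 0"
          using tf True profile_boundary(2)[OF s] by (simp add: test_function_def)
        ultimately have "integral {0<..<1} q = 0"
          by (simp add: integral_unique integral_open_interval_real[symmetric])
        then show ?thesis
          using set_borel_integral_eq_integral(2)[OF si] by (simp add: F2q set_lebesgue_integral_def)
      next
        case False
        then have "F2 (t, x) = 0" for x by (simp add: F2_def)
        then show ?thesis by (simp only: integral_zero)
      qed
    qed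
    show "(\<lambda>t. LBINT x. F2 (t, x)) \<in> borel_measurable lborel"
      using lborel_pair.integrable_fst[OF p2] by (rule borel_measurable_integrable)
  qed simp
  finally have 2: "(LBINT w. F2 w) = 0" by simp
  have "(LBINT w. F1 w) = (LBINT x. LBINT t. F1 (t, x))"
    using lborel_pair.integral_snd[OF p1] by (simp add: lborel_prod)
  also have "\<dots> = (LBINT x. indicator {0<..<1} x * (?U x * \<phi> 0 x))"
  proof (rule Bochner_Integration.integral_cong[OF refl])
    fix x :: real
    show "(LBINT t. F1 (t, x)) = indicator {0<..<1} x * (?U x * \<phi> 0 x)"
    proof (cases "x \<in> {0<..<1}")
      case True
      have "(LBINT t. F1 (t, x)) = (LBINT t. - ?U x * (indicator {0..T + 1} t *\<^sub>R \<phi>t t x))"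
      proof (rule integral_cong_AE)
        show "AE t in lborel. F1 (t, x) = - ?U x * (indicator {0..T + 1} t *\<^sub>R \<phi>t t x)"
          using AE_lborel_singleton[of "0::real"]
        proof eventually_elim
          case (elim t)
          then show ?case using True T(4)[of t x] by (auto simp: F1_def indicator_def)
        qed
        have "F1 \<in> borel_measurable (lborel \<Otimes>\<^sub>M lborel)"
          using i1 by (simp add: lborel_prod borel_measurable_integrable)
        then show "(\<lambda>t. F1 (t, x)) \<in> borel_measurable lborel" by measurable
        have "(\<lambda>t. \<phi>t t x) \<in> borel_measurable borel"
          by (intro borel_measurable_continuous_onI continuous_on_real_pair[OF test_function_continuous(2)[OF tf]]
              continuous_on_const continuous_on_id)
        then show "(\<lambda>t. - ?U x * (indicator {0..T + 1} t *\<^sub>R \<phi>t t x)) \<in> borel_measurable lborel" by measurable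
      qed
      also have "\<dots> = - ?U x * (LBINT t. indicator {0..T + 1} t *\<^sub>R \<phi>t t x)" by simp
      also have "(LBINT t. indicator {0..T + 1} t *\<^sub>R \<phi>t t x) = \<phi> (T + 1) x - \<phi> 0 x"
      proof (rule integral_FTC_atLeastAtMost)
        show "continuous_on {0..T + 1} (\<lambda>t. \<phi>t t x)"
          by (intro continuous_on_real_pair[OF test_function_continuous(2)[OF tf]] continuous_on_const continuous_on_id)
        show "((\<lambda>t. \<phi> t x) has_vector_derivative \<phi>t t x) (at t within {0..T + 1})" for t
          using test_function_derivatives(1)[OF tf] by (simp add: has_real_derivative_iff_has_vector_derivative)
      qed (use T in auto)
      also have "\<phi> (T + 1) x = 0" using T(3)[of "T + 1" x] True by auto
      finally show ?thesis using True by simp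
    next
      case False
      then have "F1 (t, x) = 0" for t by (auto simp: F1_def)
      then have "(LBINT t. F1 (t, x)) = 0" by (simp only: integral_zero)
      then show ?thesis using False by simp
    qed
  qed
  finally have 1: "(LBINT w. F1 w) = (LBINT x. indicator {0<..<1} x * (?U x * \<phi> 0 x))" .
  show "(LBINT w. F w) = (LBINT x. indicator {0<..<1} x * (?U x * \<phi> 0 x))"
    unfolding F[abs_def] using i1 i2 1 2 by simp
qed


text \<open>Both summands vanish at \<open>1\<close>, the profile by its boundary value and the
  potential by oddness, so each is minus the integral of its derivative from \<open>x\<close> to
  \<open>1\<close>.\<close>

lemma heat_potential_weak_deriv:
  assumes \<omega>: "0 < \<omega>" and s: "0 \<le> s" "s \<le> 1" and K[measurable]: "K \<in> borel_measurable borel"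
    and B: "\<And>z. \<bar>K z\<bar> \<le> B" and eo: "even_odd K"
  shows "weak_deriv_V (\<lambda>x. profile \<omega> lam f0 s x + convol (heat_kernel \<omega>) K (t, x))
    (\<lambda>x. profile_dx \<omega> lam f0 s x + convol (heat_kernel_dx \<omega>) K (t, x))"
proof -
  let ?z = "\<lambda>x. convol (heat_kernel \<omega>) K (t, x)" and ?w = "\<lambda>x. convol (heat_kernel_dx \<omega>) K (t, x)"
  note iq = integrable_heat_kernel_dx[OF \<omega>]
  define M where "M = B * (LBINT w. \<bar>heat_kernel_dx \<omega> w\<bar>)"
  have M: "\<bar>?w x\<bar> \<le> M" for x unfolding M_def by (rule convol_bound[OF iq K B])
  have "convol (heat_kernel_dx \<omega>) K \<in> borel_measurable (borel \<Otimes>\<^sub>M borel)"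
    by (simp add: borel_prod borel_measurable_convol)
  then have wm[measurable]: "?w \<in> borel_measurable borel" by measurable
  obtain C where C: "\<And>x. x \<in> {0..1} \<Longrightarrow> \<bar>profile_dx \<omega> lam f0 s x\<bar> \<le> C"
    using profile_bounded by metis
  have z1: "?z 1 = 0"
  proof -
    have "convol (heat_kernel \<omega>) K (t, 2 - 1) = - convol (heat_kernel \<omega>) K (t, 1)"
      using even_odd_convol[OF \<omega> K B eo] unfolding even_odd_def by blast
    then show ?thesis by simp
  qed
  have eq: "profile \<omega> lam f0 s x + ?z x = - (\<integral>y. profile_dx \<omega> lam f0 s y + ?w y \<partial>lebesgue_on {x<..<1})"
    if x: "0 < x" "x < 1" for x
  proof -
    have si: "set_integrable lborel {x..1} (profile_dx \<omega> lam f0 s)"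
      by (intro borel_integrable_atLeastAtMost' continuous_on_profile_dx)
    have "(LBINT y. indicator {x..1} y * profile_dx \<omega> lam f0 s y) = integral {x..1} (profile_dx \<omega> lam f0 s)"
      using set_borel_integral_eq_integral(2)[OF si] by (simp add: set_lebesgue_integral_def)
    also have "\<dots> = profile \<omega> lam f0 s 1 - profile \<omega> lam f0 s x"
    proof (rule integral_unique[OF fundamental_theorem_of_calculus_interior_strong[of "{s}"]])
      show "(profile \<omega> lam f0 s has_vector_derivative profile_dx \<omega> lam f0 s y) (at y)" if "y \<in> {x<..<1} - {s}" for y
        using profile_derivs(1)[OF \<omega>, of y s] that by (simp add: has_real_derivative_iff_has_vector_derivative[symmetric])
    qed (use x in \<open>auto intro: continuous_on_profile_snd\<close>)
    finally have 1: "(LBINT y. indicator {x..1} y * profile_dx \<omega> lam f0 s y) = - profile \<omega> lam f0 s x"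
      using profile_boundary(1)[OF s] by simp
    have 2: "(LBINT y. indicator {x..1} y * ?w y) = - ?z x"
      using heat_potential_diff_eq_integral[OF \<omega> K B, of x 1 t] x z1 by simp
    have i1: "integrable lborel (\<lambda>y. indicator {x..1} y * profile_dx \<omega> lam f0 s y)"
      using si by (simp add: set_integrable_def)
    have i2: "integrable lborel (\<lambda>y. indicator {x..1} y * ?w y)"
      by (rule integrable_mult_bounded[OF _ _ M]) (auto intro!: integrable_real_indicator simp: emeasure_lborel_Icc_eq)
    have "(\<integral>y. profile_dx \<omega> lam f0 s y + ?w y \<partial>lebesgue_on {x<..<1})
        = (LBINT y. indicator {x<..<1} y * (profile_dx \<omega> lam f0 s y + ?w y))"
      by (rule lebesgue_on_borel(3)) auto
    also have "\<dots> = (LBINT y. indicator {x..1} y * profile_dx \<omega> lam f0 s y + indicator {x..1} y * ?w y)"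
    proof (rule integral_cong_AE)
      show "AE y in lborel. indicator {x<..<1} y * (profile_dx \<omega> lam f0 s y + ?w y)
          = indicator {x..1} y * profile_dx \<omega> lam f0 s y + indicator {x..1} y * ?w y"
        using AE_lborel_singleton[of x] AE_lborel_singleton[of "1::real"]
        by eventually_elim (auto simp: indicator_def)
    qed auto
    also have "\<dots> = - profile \<omega> lam f0 s x - ?z x" using i1 i2 1 2 by simp
    finally show ?thesis by simp
  qed
  have "in_L2 {0<..<1} (\<lambda>x. profile_dx \<omega> lam f0 s x + ?w x)"
  proof (rule in_L2_bounded[where B="C + M"])
    show "\<bar>profile_dx \<omega> lam f0 s x + ?w x\<bar> \<le> C + M" if "x \<in> {0<..<1}" for x
      using C[of x] M[of x] that by (auto intro: order.trans[OF abs_triangle_ineq])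
  qed auto
  moreover have "AE x in lebesgue_on {0<..<1}. profile \<omega> lam f0 s x + ?z x
      = - (\<integral>y. profile_dx \<omega> lam f0 s y + ?w y \<partial>lebesgue_on {x<..<1})"
    using eq by (intro AE_I2) (simp add: space_restrict_space)
  ultimately show ?thesis by (simp add: weak_deriv_V_def)
qed

lemma heat_potential_L2_continuous:
  assumes \<omega>: "0 < \<omega>" and K[measurable]: "K \<in> borel_measurable borel" and B: "\<And>z. \<bar>K z\<bar> \<le> B"
  shows "((\<lambda>t. \<integral>x. (convol (heat_kernel \<omega>) K (t, x) - convol (heat_kernel \<omega>) K (s, x))\<^sup>2 \<partial>lebesgue_on {0<..<1})
    \<longlongrightarrow> 0) (at s within A)"
  unfolding tendsto_at_iff_sequentially
proof (intro allI impI)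
  fix X :: "nat \<Rightarrow> real" assume X: "X \<longlonglongrightarrow> s"
  let ?z = "convol (heat_kernel \<omega>) K"
  define M where "M = B * (LBINT w. \<bar>heat_kernel \<omega> w\<bar>)"
  have M: "\<bar>?z w\<bar> \<le> M" for w unfolding M_def by (rule convol_bound[OF integrable_heat_kernel[OF \<omega>] K B])
  have "?z \<in> borel_measurable (borel \<Otimes>\<^sub>M borel)"
    by (simp add: borel_prod borel_measurable_convol)
  then have zm[measurable]: "(\<lambda>x. ?z (t, x)) \<in> borel_measurable borel" for t by measurable
  have "(\<lambda>n. LBINT x. indicator {0<..<1} x * (?z (X n, x) - ?z (s, x))\<^sup>2) \<longlonglongrightarrow> (\<integral>x. 0 \<partial>(lborel::real measure))"
  proof (rule integral_dominated_convergence[where w="\<lambda>x::real. indicator {0<..<1} x * (2 * M)\<^sup>2"])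
    show "integrable lborel (\<lambda>x::real. indicator {0<..<1} x * (2 * M)\<^sup>2)"
      by (intro integrable_mult_left integrable_real_indicator) auto
    show "AE x in lborel. (\<lambda>n. indicator {0<..<1} x * (?z (X n, x) - ?z (s, x))\<^sup>2) \<longlonglongrightarrow> 0"
    proof (intro AE_I2)
      fix x :: real
      have "(\<lambda>n. ?z (X n, x)) \<longlonglongrightarrow> ?z (s, x)"
        by (intro isCont_tendsto_compose[OF isCont_heat_potential[OF \<omega> K B]] tendsto_Pair X tendsto_const)
      then have "(\<lambda>n. indicator {0<..<1} x * (?z (X n, x) - ?z (s, x))\<^sup>2)
          \<longlonglongrightarrow> indicator {0<..<1} x * (?z (s, x) - ?z (s, x))\<^sup>2"
        by (intro tendsto_intros)
      then show "(\<lambda>n. indicator {0<..<1} x * (?z (X n, x) - ?z (s, x))\<^sup>2) \<longlonglongrightarrow> 0" by simp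
    qed
    show "AE x in lborel. norm (indicator {0<..<1} x * (?z (X n, x) - ?z (s, x))\<^sup>2) \<le> indicator {0<..<1} x * (2 * M)\<^sup>2" for n
    proof (intro AE_I2)
      fix x :: real
      have "\<bar>?z (X n, x) - ?z (s, x)\<bar> \<le> 2 * M" using M[of "(X n, x)"] M[of "(s, x)"] by linarith
      then have "\<bar>?z (X n, x) - ?z (s, x)\<bar>\<^sup>2 \<le> (2 * M)\<^sup>2" by (intro power_mono) auto
      then show "norm (indicator {0<..<1} x * (?z (X n, x) - ?z (s, x))\<^sup>2) \<le> indicator {0<..<1} x * (2 * M)\<^sup>2"
        by (simp add: indicator_def)
    qed
  qed auto
  moreover have "(\<integral>x. (?z (t, x) - ?z (s, x))\<^sup>2 \<partial>lebesgue_on {0<..<1})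
      = (LBINT x. indicator {0<..<1} x * (?z (t, x) - ?z (s, x))\<^sup>2)" for t
    by (rule lebesgue_on_borel(3)) auto
  ultimately show "((\<lambda>t. \<integral>x. (?z (t, x) - ?z (s, x))\<^sup>2 \<partial>lebesgue_on {0<..<1}) \<circ> X) \<longlonglongrightarrow> 0"
    by (simp add: o_def)
qed

definition source :: "real \<Rightarrow> real \<Rightarrow> real \<Rightarrow> (real \<Rightarrow> real \<Rightarrow> real) \<Rightarrow> real \<times> real \<Rightarrow> real" where
  "source lam f0 s h =
     (\<lambda>w. reflect (\<lambda>x. if 0 < fst w then lam * (h (fst w) x - step f0 s x) else 0) (snd w))"

lemma source_measurable:
  assumes h: "(\<lambda>w. h (fst w) (snd w)) \<in> borel_measurable borel"
  shows "source lam f0 s h \<in> borel_measurable borel"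
proof -
  have [measurable]: "{w::real \<times> real. 0 < fst w} \<in> sets borel"
    by (intro borel_open open_Collect_less continuous_intros)
  note [measurable] = h borel_measurable_snd[OF borel_measurable_step[of f0 s]]
  have "(\<lambda>w. indicator {w. 0 < fst w} w * (lam * (h (fst w) (snd w) - step f0 s (snd w)))) \<in> borel_measurable borel"
    by measurable
  moreover have "(\<lambda>w. indicator {w. 0 < fst w} w * (lam * (h (fst w) (snd w) - step f0 s (snd w))))
      = (\<lambda>w. if 0 < fst w then lam * (h (fst w) (snd w) - step f0 s (snd w)) else 0)"
    by (auto simp: indicator_def)
  ultimately show ?thesis
    unfolding source_def
    by (intro borel_measurable_reflect[where k="\<lambda>t x. if 0 < t then lam * (h t x - step f0 s x) else 0"]) simp
qed

lemma source_bounded: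
  assumes "\<And>t x. \<bar>h t x\<bar> \<le> 1" "\<bar>f0\<bar> \<le> 1"
  shows "\<bar>source lam f0 s h w\<bar> \<le> \<bar>lam\<bar> * 2"
  unfolding source_def
proof (rule reflect_bounded)
  fix x
  have "\<bar>step f0 s x\<bar> \<le> 1" using assms(2) by (auto simp: step_def)
  then show "\<bar>if 0 < fst w then lam * (h (fst w) x - step f0 s x) else 0\<bar> \<le> \<bar>lam\<bar> * 2"
    using assms(1)[of "fst w" x] by (auto simp: abs_mult intro!: mult_left_mono)
qed simp

lemma even_odd_source: "even_odd (source lam f0 s h)"
  unfolding even_odd_def source_def fst_conv snd_conv reflect_minus reflect_diff by simp

lemma source_start: "t \<le> 0 \<Longrightarrow> source lam f0 s h (t, x) = 0"
  by (simp add: source_def reflect_def)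

lemma source_eq: "0 < t \<Longrightarrow> \<bar>x\<bar> < 1 \<Longrightarrow> source lam f0 s h (t, x) = lam * (h t \<bar>x\<bar> - step f0 s \<bar>x\<bar>)"
  by (simp add: source_def reflect_eq_abs)

lemma parabolic_solution_heat_potential:
  fixes \<omega> lam f0 s :: real
  assumes \<omega>: "0 < \<omega>" and s: "0 \<le> s" "s \<le> 1"
    and h: "(\<lambda>w. h (fst w) (snd w)) \<in> borel_measurable borel" and hb: "\<And>t x. \<bar>h t x\<bar> \<le> 1" and f0: "\<bar>f0\<bar> \<le> 1"
  defines "K \<equiv> source lam f0 s h"
  defines "u \<equiv> \<lambda>t x. profile \<omega> lam f0 s x + convol (heat_kernel \<omega>) K (t, x)"
  assumes \<beta>: "\<And>t x. 0 < t \<Longrightarrow> 0 < x \<Longrightarrow> x < 1 \<Longrightarrow> h t x \<in> \<beta> (u t x)"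
  shows "parabolic_solution \<omega> lam \<beta> (profile \<omega> lam f0 s) u"
proof -
  note snd_m = borel_measurable_snd
  have K[measurable]: "K \<in> borel_measurable borel"
    unfolding K_def by (rule source_measurable[OF h])
  define B where "B = \<bar>lam\<bar> * 2"
  have stepb: "\<bar>step f0 s x\<bar> \<le> 1" for x using f0 by (auto simp: step_def)
  have B: "\<bar>K z\<bar> \<le> B" for z
    unfolding K_def B_def by (rule source_bounded[OF hb f0])
  have eo: "even_odd K" unfolding K_def by (rule even_odd_source)
  then have ev: "K (t, - x) = K (t, x)" for t x by (simp add: even_odd_def)
  have start: "K (t, x) = 0" if "t \<le> 0" for t x
    unfolding K_def using that by (rule source_start)
  have K_in: "K (t, x) = lam * (h t x - step f0 s x)" if "0 < t" "0 < x" "x < 1" for t x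
    using that source_eq[of t x lam f0 s h] by (simp add: K_def)
  let ?z = "convol (heat_kernel \<omega>) K" and ?zx = "convol (heat_kernel_dx \<omega>) K"
  note ip = integrable_heat_kernel[OF \<omega>] and iq = integrable_heat_kernel_dx[OF \<omega>]
  define M where "M = B * (LBINT w. \<bar>heat_kernel \<omega> w\<bar>)"
  define M' where "M' = B * (LBINT w. \<bar>heat_kernel_dx \<omega> w\<bar>)"
  have M: "\<bar>?z w\<bar> \<le> M" for w unfolding M_def by (rule convol_bound[OF ip K B])
  have M': "\<bar>?zx w\<bar> \<le> M'" for w unfolding M'_def by (rule convol_bound[OF iq K B])
  have zm[measurable]: "?z \<in> borel_measurable borel" and zxm[measurable]: "?zx \<in> borel_measurable borel"
    by (simp_all add: borel_measurable_convol)
  have "?z \<in> borel_measurable (borel \<Otimes>\<^sub>M borel)" by (simp add: borel_prod zm)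
  then have zt[measurable]: "(\<lambda>x. ?z (t, x)) \<in> borel_measurable borel" for t by measurable
  obtain C where C: "\<And>x. x \<in> {0..1} \<Longrightarrow> \<bar>profile \<omega> lam f0 s x\<bar> \<le> C"
    "\<And>x. x \<in> {0..1} \<Longrightarrow> \<bar>profile_dx \<omega> lam f0 s x\<bar> \<le> C"
    using profile_bounded by blast
  have um: "(\<lambda>(t, x). u t x) \<in> borel_measurable borel"
    using snd_m[OF profile_measurable(1)] by (simp add: u_def case_prod_beta')
  define w where "w = (\<lambda>t x. profile_dx \<omega> lam f0 s x + ?zx (t, x))"
  have wm: "(\<lambda>(t, x). w t x) \<in> borel_measurable borel"
    using snd_m[OF profile_measurable(2)] by (simp add: w_def case_prod_beta')
  have u_L2: "in_L2 {0<..<1} (u t)" for t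
  proof (rule in_L2_bounded[where B="C + M"])
    show "\<bar>u t x\<bar> \<le> C + M" if "x \<in> {0<..<1}" for x
      using C(1)[of x] M[of "(t, x)"] that unfolding u_def by (auto intro: order.trans[OF abs_triangle_ineq])
    show "u t \<in> borel_measurable borel" unfolding u_def[abs_def] by measurable
  qed auto
  have u_cont: "((\<lambda>t. \<integral>x. (u t x - u r x)\<^sup>2 \<partial>lebesgue_on {0<..<1}) \<longlongrightarrow> 0) (at r within {0..})" for r
    using heat_potential_L2_continuous[OF \<omega> K B, of r "{0..}"] by (simp add: u_def)
  have u_start: "u 0 x = profile \<omega> lam f0 s x" for x
    using heat_potential_start[of 0 K 0 \<omega> x] start by (simp add: u_def)
  have w_L2: "in_L2 ({0<..<T} \<times> {0<..<1}) (\<lambda>(t, x). w t x)" for T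
  proof (rule in_L2_bounded[where B="C + M'"])
    have "{0<..<T} \<times> {0<..<1::real} = box (0, 0) (T, 1)" by (auto simp: box_def Basis_prod_def)
    then show "emeasure lborel ({0<..<T} \<times> {0<..<1::real}) < \<infinity>"
      using emeasure_lborel_box_finite[of "(0, 0)" "(T, 1)"] by (simp only:)
    show "{0<..<T} \<times> {0<..<1::real} \<in> sets borel" by (intro borel_open open_Times) auto
    show "\<bar>case v of (t, x) \<Rightarrow> w t x\<bar> \<le> C + M'" if "v \<in> {0<..<T} \<times> {0<..<1}" for v
      using C(2)[of "snd v"] M'[of v] that unfolding w_def by (auto intro: order.trans[OF abs_triangle_ineq])
  qed (rule wm)
  have weak_d: "weak_deriv_V (u t) (w t)" for t
    unfolding u_def[abs_def] w_def[abs_def] by (rule heat_potential_weak_deriv[OF \<omega> s K B eo])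
  have hm: "(\<lambda>(t, x). h t x) \<in> borel_measurable borel" using h by (simp add: case_prod_beta')
  have weak: "(\<integral>(t, x). - u t x * \<phi>t t x + w t x * \<phi>x t x + \<omega>\<^sup>2 * u t x * \<phi> t x \<partial>lebesgue_on strip)
      = (\<integral>(t, x). lam * h t x * \<phi> t x \<partial>lebesgue_on strip)
        + (\<integral>x. profile \<omega> lam f0 s x * \<phi> 0 x \<partial>lebesgue_on {0<..<1})"
    if tf: "test_function \<phi> \<phi>t \<phi>x" for \<phi> \<phi>t \<phi>x
  proof -
    let ?U = "profile \<omega> lam f0 s" and ?U' = "profile_dx \<omega> lam f0 s"
    note [measurable] = borel_measurable_continuous_onI[OF test_function_continuous(1)[OF tf]]
      borel_measurable_continuous_onI[OF test_function_continuous(2)[OF tf]]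
      borel_measurable_continuous_onI[OF test_function_continuous(3)[OF tf]]
    note [measurable] = h um wm
    obtain T D where T: "0 < T" "0 \<le> D"
      "\<And>t x. T < t \<Longrightarrow> 0 \<le> x \<Longrightarrow> x \<le> 1 \<Longrightarrow> \<phi> t x = 0"
      "\<And>t x. T < t \<Longrightarrow> 0 < x \<Longrightarrow> x < 1 \<Longrightarrow> \<phi>t t x = 0 \<and> \<phi>x t x = 0"
      "\<And>t x. 0 \<le> t \<Longrightarrow> 0 < x \<Longrightarrow> x < 1 \<Longrightarrow> \<bar>\<phi> t x\<bar> \<le> D \<and> \<bar>\<phi>t t x\<bar> \<le> D \<and> \<bar>\<phi>x t x\<bar> \<le> D"
      by (rule test_function_support[OF tf]) (rule that)
    define F where "F = (\<lambda>v. indicator strip v * (- ?U (snd v) * \<phi>t (fst v) (snd v)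
      + (?U' (snd v) * \<phi>x (fst v) (snd v)
        + (\<omega>\<^sup>2 * ?U (snd v) - lam * step f0 s (snd v)) * \<phi> (fst v) (snd v))))"
    define G where "G = (\<lambda>v. indicator strip v * (- ?z v * \<phi>t (fst v) (snd v)
      + ?zx v * \<phi>x (fst v) (snd v) + \<omega>\<^sup>2 * ?z v * \<phi> (fst v) (snd v)))"
    define S where "S = (\<lambda>v. indicator strip v * (lam * step f0 s (snd v) * \<phi> (fst v) (snd v)))"
    define H where "H = (\<lambda>v. indicator strip v * (K v * \<phi> (fst v) (snd v)))"
    have iF: "integrable lborel F" and iG: "integrable lborel G"
      unfolding F_def G_def by (rule profile_weak_identity(1)[OF \<omega> s tf])
        (rule heat_potential_weak_identity(1)[OF \<omega> tf K B ev start])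
    have intF: "integral\<^sup>L lborel F = (LBINT x. indicator {0<..<1} x * (?U x * \<phi> 0 x))"
      unfolding F_def by (rule profile_weak_identity(2)[OF \<omega> s tf])
    have intG: "integral\<^sup>L lborel G = integral\<^sup>L lborel H"
      unfolding G_def H_def
      by (rule heat_potential_weak_identity(2)[OF \<omega> tf K B ev start])
    have iS: "integrable lborel S"
      unfolding S_def
    proof (rule integrable_strip[of _ "\<bar>lam\<bar> * D" T])
      show "(\<lambda>v. lam * step f0 s (snd v) * \<phi> (fst v) (snd v)) \<in> borel_measurable borel"
        using snd_m[OF borel_measurable_step[of f0 s]] by measurable
      show "\<bar>lam * step f0 s (snd v) * \<phi> (fst v) (snd v)\<bar> \<le> \<bar>lam\<bar> * D" if "v \<in> strip" for v
      proof -
        have "\<bar>step f0 s (snd v)\<bar> * \<bar>\<phi> (fst v) (snd v)\<bar> \<le> 1 * D"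
          using stepb T(5)[of "fst v" "snd v"] that by (intro mult_mono) auto
        then show ?thesis by (simp add: abs_mult mult.assoc mult_left_mono)
      qed
    qed (use T in auto)
    have iH: "integrable lborel H"
      unfolding H_def
    proof (rule integrable_strip[of _ "B * D" T])
      show "\<bar>K v * \<phi> (fst v) (snd v)\<bar> \<le> B * D" if "v \<in> strip" for v
        unfolding abs_mult using B[of v] T(5)[of "fst v" "snd v"] that
        by (intro mult_mono) (auto intro: order.trans[OF abs_ge_zero])
    qed (use T in auto)
    have "(\<integral>(t, x). - u t x * \<phi>t t x + w t x * \<phi>x t x + \<omega>\<^sup>2 * u t x * \<phi> t x \<partial>lebesgue_on strip)
        = (LBINT v. indicator strip v * (case v of (t, x) \<Rightarrow> - u t x * \<phi>t t x + w t x * \<phi>x t x + \<omega>\<^sup>2 * u t x * \<phi> t x))"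
      using um wm by (intro lebesgue_on_borel(3) strip_measurable) (simp add: case_prod_beta')
    also have "\<dots> = (LBINT v. F v + G v + S v)"
    proof (rule Bochner_Integration.integral_cong[OF refl])
      fix v :: "real \<times> real"
      show "indicator strip v * (case v of (t, x) \<Rightarrow> - u t x * \<phi>t t x + w t x * \<phi>x t x + \<omega>\<^sup>2 * u t x * \<phi> t x) = F v + G v + S v"
        by (cases v) (simp add: F_def G_def S_def u_def w_def algebra_simps)
    qed
    also have "\<dots> = integral\<^sup>L lborel F + integral\<^sup>L lborel G + integral\<^sup>L lborel S"
      using iF iG iS by simp
    also have "\<dots> = (LBINT v. H v + S v) + (LBINT x. indicator {0<..<1} x * (?U x * \<phi> 0 x))"
      using iH iS intF intG by simp
    also have "(LBINT v. H v + S v) = (LBINT v. indicator strip v * (case v of (t, x) \<Rightarrow> lam * h t x * \<phi> t x))"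
    proof (rule Bochner_Integration.integral_cong[OF refl])
      fix v :: "real \<times> real"
      show "H v + S v = indicator strip v * (case v of (t, x) \<Rightarrow> lam * h t x * \<phi> t x)"
        by (cases v) (auto simp: H_def S_def K_in indicator_def algebra_simps)
    qed
    also have "\<dots> = (\<integral>(t, x). lam * h t x * \<phi> t x \<partial>lebesgue_on strip)"
      using h by (intro lebesgue_on_borel(3)[symmetric] strip_measurable) (simp add: case_prod_beta')
    also have "(LBINT x. indicator {0<..<1} x * (?U x * \<phi> 0 x)) = (\<integral>x. ?U x * \<phi> 0 x \<partial>lebesgue_on {0<..<1})"
    proof (rule lebesgue_on_borel(3)[symmetric])
      have "\<phi> 0 \<in> borel_measurable borel"
        using continuous_on_real_pair[OF test_function_continuous(1)[OF tf] continuous_on_const continuous_on_id]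
        by (intro borel_measurable_continuous_onI) simp
      then show "(\<lambda>x. ?U x * \<phi> 0 x) \<in> borel_measurable borel" by measurable
    qed simp
    finally show ?thesis .
  qed
  show ?thesis
    unfolding parabolic_solution_def Let_def
  proof (intro conjI allI impI; (rule exI[of _ w], rule exI[of _ h], intro conjI allI impI)?)
    show "(\<lambda>(t, x). u t x) \<in> borel_measurable (lebesgue_on strip)"
      by (rule lebesgue_on_borel(1)[OF strip_measurable um])
    show "(\<lambda>(t, x). h t x) \<in> borel_measurable (lebesgue_on strip)"
      by (rule lebesgue_on_borel(1)[OF strip_measurable hm])
    show "AE x in lebesgue_on {0<..<1}. u 0 x = profile \<omega> lam f0 s x" by (simp add: u_start)
    show "AE t in lebesgue_on {0<..}. weak_deriv_V (u t) (w t)" by (simp add: weak_d)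
    show "bounded ((\<lambda>(t, x). h t x) ` strip)" using hb by (auto simp: bounded_iff intro!: exI[of _ 1])
    show "AE (t, x) in lebesgue_on strip. h t x \<in> \<beta> (u t x)"
      using \<beta> by (intro AE_I2) (auto simp: space_restrict_space)
  qed (use u_L2 u_cont w_L2 weak in auto)
qed

section \<open>The increasing solution above a subsolution\<close>

lemma reaction_eq: "reaction f0 \<mu> v = (if v < \<mu> then f0 else 1)"
  by (simp add: reaction_def heaviside_def)

lemma convol_time_shift:
  "convol q K (t + a, x) = convol q (\<lambda>w. K (fst w + a, snd w)) (t, x)"
  by (simp add: convol_def minus_prod_def algebra_simps)

lemma heat_potential_mono:
  assumes "0 < \<omega>" and K: "K \<in> borel_measurable borel" "\<And>z. \<bar>K z\<bar> \<le> B" "even_odd K"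
    and L: "L \<in> borel_measurable borel" "\<And>z. \<bar>L z\<bar> \<le> B" "even_odd L"
    and le: "\<And>t x. \<bar>x\<bar> < 1 \<Longrightarrow> K (t, x) \<le> L (t, x)" and x: "\<bar>x\<bar> \<le> 1"
  shows "convol (heat_kernel \<omega>) K (t, x) \<le> convol (heat_kernel \<omega>) L (t, x)"
proof -
  have "0 \<le> convol (heat_kernel \<omega>) (\<lambda>w. L w - K w) (t, x)"
  proof (rule heat_potential_nonneg[OF assms(1), where B="2 * B"])
    show "\<bar>L z - K z\<bar> \<le> 2 * B" for z using K(2)[of z] L(2)[of z] by linarith
    show "even_odd (\<lambda>w. L w - K w)" using K(3) L(3) by (simp add: even_odd_def)
  qed (use K L le x in auto)
  then show ?thesis
    using convol_diff[OF integrable_heat_kernel[OF assms(1)] L(1,2) K(1,2)] by simp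
qed

locale subsolution =
  fixes \<omega> lam f0 \<mu> s :: real
  assumes \<omega>: "0 < \<omega>" and lam: "0 < lam" and f0: "0 < f0" "f0 < 1" and s: "0 \<le> s" "s < 1"
    and above: "\<mu> \<le> profile \<omega> lam f0 s s"
begin

text \<open>For \<open>t \<le> 0\<close> the source vanishes and every iterate equals the profile,
  so comparison with time shifts makes sense for all real \<open>t\<close>.\<close>

primrec approx :: "nat \<Rightarrow> real \<Rightarrow> real \<Rightarrow> real" where
  "approx 0 = (\<lambda>t x. profile \<omega> lam f0 s x)"
| "approx (Suc n) = (\<lambda>t x. profile \<omega> lam f0 s x
     + convol (heat_kernel \<omega>) (source lam f0 s (\<lambda>t x. reaction f0 \<mu> (approx n t x))) (t, x))"

declare approx.simps(2) [simp del]

definition react :: "nat \<Rightarrow> real \<Rightarrow> real \<Rightarrow> real" where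
  "react n t x = reaction f0 \<mu> (approx n t x)"

lemma approx_Suc: "approx (Suc n) t x = profile \<omega> lam f0 s x + convol (heat_kernel \<omega>) (source lam f0 s (react n)) (t, x)"
  by (simp add: react_def[abs_def] approx.simps(2))

lemma react_bounds: "f0 \<le> react n t x" "react n t x \<le> 1" "\<bar>react n t x\<bar> \<le> 1"
  using f0 by (auto simp: react_def reaction_eq)

lemma f0_abs: "\<bar>f0\<bar> \<le> 1"
  using f0 by simp

lemma approx_measurable: "(\<lambda>w. approx n (fst w) (snd w)) \<in> borel_measurable borel"
  and react_measurable: "(\<lambda>w. react n (fst w) (snd w)) \<in> borel_measurable borel"
proof (induction n)
  case 0
  show a: "(\<lambda>w. approx 0 (fst w) (snd w)) \<in> borel_measurable borel"
    using borel_measurable_snd[OF profile_measurable(1)] by simp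
  { case 2 show ?case unfolding react_def reaction_eq using a by measurable }
next
  case (Suc n)
  note [measurable] = borel_measurable_snd[OF profile_measurable(1)[of \<omega> lam f0 s]]
    borel_measurable_convol[OF borel_measurable_heat_kernel source_measurable[OF Suc(2)], of \<omega> lam f0 s]
  show a: "(\<lambda>w. approx (Suc n) (fst w) (snd w)) \<in> borel_measurable borel"
    unfolding approx_Suc prod.collapse by measurable
  { case 2 show ?case unfolding react_def reaction_eq using a by measurable }
qed

lemma source_mono:
  assumes h: "(\<lambda>w. h (fst w) (snd w)) \<in> borel_measurable borel" "\<And>t x. \<bar>h t x\<bar> \<le> 1"
    and k: "(\<lambda>w. k (fst w) (snd w)) \<in> borel_measurable borel" "\<And>t x. \<bar>k t x\<bar> \<le> 1"
    and le: "\<And>t x. 0 < t \<Longrightarrow> 0 \<le> x \<Longrightarrow> x < 1 \<Longrightarrow> h t x \<le> k t x" and x: "\<bar>x\<bar> \<le> 1"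
  shows "convol (heat_kernel \<omega>) (source lam f0 s h) (t, x) \<le> convol (heat_kernel \<omega>) (source lam f0 s k) (t, x)"
proof (rule heat_potential_mono[OF \<omega> source_measurable[OF h(1)] source_bounded[OF h(2) f0_abs] even_odd_source
      source_measurable[OF k(1)] source_bounded[OF k(2) f0_abs] even_odd_source _ x])
  show "source lam f0 s h (t, x) \<le> source lam f0 s k (t, x)" if "\<bar>x\<bar> < 1" for t x
  proof (cases "0 < t")
    case True
    then show ?thesis using that lam le[of t "\<bar>x\<bar>"] by (simp add: source_eq)
  qed (simp add: source_start)
qed

lemma step_measurable2: "(\<lambda>w::real \<times> real. step f0 s (snd w)) \<in> borel_measurable borel"
  by (rule borel_measurable_snd) simp

lemma step_le_react_0: "0 \<le> x \<Longrightarrow> step f0 s x \<le> react 0 t x"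
  using profile_decreasing_left[of \<omega> lam f0 x s] \<omega> lam f0 above
  by (auto simp: step_def react_def reaction_eq)

lemma source_step: "source lam f0 s (\<lambda>t. step f0 s) = (\<lambda>w. 0)"
  by (auto simp: source_def reflect_def)

lemma approx_mono: "\<bar>x\<bar> \<le> 1 \<Longrightarrow> approx n t x \<le> approx (Suc n) t x"
proof (induction n arbitrary: t x)
  case 0
  have "convol (heat_kernel \<omega>) (source lam f0 s (\<lambda>t. step f0 s)) (t, x)
      \<le> convol (heat_kernel \<omega>) (source lam f0 s (react 0)) (t, x)"
    by (rule source_mono) (use 0 f0 step_le_react_0 react_bounds react_measurable step_measurable2 in \<open>auto simp: step_def\<close>)
  then show ?case unfolding approx_Suc by (simp add: source_step convol_def)
next
  case (Suc n)
  have "react n t x \<le> react (Suc n) t x" if "\<bar>x\<bar> \<le> 1" for t x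
    using Suc.IH[OF that, of t] f0 by (auto simp: react_def reaction_eq)
  then show ?case
    unfolding approx_Suc using Suc.prems react_bounds react_measurable
    by (intro add_left_mono source_mono) auto
qed

lemma approx_mono': "\<bar>x\<bar> \<le> 1 \<Longrightarrow> m \<le> n \<Longrightarrow> approx m t x \<le> approx n t x"
  using lift_Suc_mono_le[of "\<lambda>n. approx n t x" m n] approx_mono[of x _ t] by blast

lemma react_mono: "\<bar>x\<bar> \<le> 1 \<Longrightarrow> m \<le> n \<Longrightarrow> react m t x \<le> react n t x"
  using approx_mono'[of x m n t] f0 by (auto simp: react_def reaction_eq)

lemma step_le_react: "0 \<le> x \<Longrightarrow> x < 1 \<Longrightarrow> step f0 s x \<le> react n t x"
  using step_le_react_0[of x t] react_mono[of x 0 n t] by simp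

text \<open>A shift of the source in time shifts the potential. The shifted source dominates the
  original one: at positive times by induction, at nonpositive times because the original is
  \<open>0\<close> there and the shifted one is nonnegative.\<close>

lemma approx_mono_time: "\<bar>x\<bar> \<le> 1 \<Longrightarrow> 0 \<le> a \<Longrightarrow> approx n t x \<le> approx n (t + a) x"
proof (induction n arbitrary: t x)
  case (Suc n)
  have IH: "react n t x \<le> react n (t + a) x" if "\<bar>x\<bar> \<le> 1" for t x
    using Suc.IH[OF that Suc.prems(2), of t] f0 by (auto simp: react_def reaction_eq)
  let ?K = "source lam f0 s (react n)"
  note K = source_measurable[OF react_measurable[of n], of lam f0 s] source_bounded[of "react n" f0 lam s, OF react_bounds(3) f0_abs]
  have "convol (heat_kernel \<omega>) ?K (t, x) \<le> convol (heat_kernel \<omega>) (\<lambda>w. ?K (fst w + a, snd w)) (t, x)"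
  proof (rule heat_potential_mono[OF \<omega> K even_odd_source _ K(2) _ _ Suc.prems(1)])
    show "(\<lambda>w. ?K (fst w + a, snd w)) \<in> borel_measurable borel"
      by (rule measurable_compose[OF _ K(1)]) (auto intro!: borel_measurable_continuous_onI continuous_intros)
    show "even_odd (\<lambda>w. ?K (fst w + a, snd w))"
      using even_odd_source[of lam f0 s "react n"] by (simp add: even_odd_def)
    show "?K (t, x) \<le> ?K (fst (t, x) + a, snd (t, x))" if x: "\<bar>x\<bar> < 1" for t x
    proof (cases "0 < t")
      case True
      then show ?thesis using x Suc.prems(2) lam IH[of "\<bar>x\<bar>" t] by (simp add: source_eq)
    next
      case False
      have "0 \<le> ?K (t + a, x)"
      proof (cases "0 < t + a")
        case True
        then show ?thesis using x lam step_le_react[of "\<bar>x\<bar>" n "t + a"] by (simp add: source_eq)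
      qed (simp add: source_start)
      then show ?thesis using False by (simp add: source_start)
    qed
  qed
  then show ?case unfolding approx_Suc convol_time_shift[of _ _ t a] by simp
qed simp

lemma react_mono_time: "\<bar>x\<bar> \<le> 1 \<Longrightarrow> t \<le> t' \<Longrightarrow> react n t x \<le> react n t' x"
  using approx_mono_time[of x "t' - t" n t] f0 by (auto simp: react_def reaction_eq)

text \<open>A supremum of reactions, not the reaction of the limit: where the iterates stay strictly
  below \<open>\<mu>\<close> and only tend to it, this is \<open>f0\<close>, whereas
  \<open>reaction\<close> is \<open>1\<close> at \<open>\<mu>\<close>. The limit fits the
  graph.\<close>

definition react_lim :: "real \<Rightarrow> real \<Rightarrow> real" where
  "react_lim t x = (SUP n. react n t x)"

lemma react_bdd_above: "bdd_above (range (\<lambda>n. react n t x))"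
  using react_bounds by (intro bdd_aboveI2[where M=1]) auto

lemma react_le_lim: "react n t x \<le> react_lim t x"
  unfolding react_lim_def by (rule cSUP_upper[OF _ react_bdd_above]) simp

lemma react_lim_le: "react_lim t x \<le> 1"
  unfolding react_lim_def by (rule cSUP_least) (auto simp: react_bounds)

lemma react_lim_ge: "f0 \<le> react_lim t x"
  using react_bounds(1)[of 0 t x] react_le_lim[of 0 t x] by linarith

lemma react_lim_abs: "\<bar>react_lim t x\<bar> \<le> 1"
  using react_lim_le[of t x] react_lim_ge[of t x] f0 by linarith

lemma react_LIMSEQ: "\<bar>x\<bar> \<le> 1 \<Longrightarrow> (\<lambda>n. react n t x) \<longlonglongrightarrow> react_lim t x"
  unfolding react_lim_def
  by (intro LIMSEQ_incseq_SUP react_bdd_above) (auto simp: incseq_def intro: react_mono)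

lemma react_lim_measurable: "(\<lambda>w. react_lim (fst w) (snd w)) \<in> borel_measurable borel"
  unfolding react_lim_def using react_measurable react_bdd_above by (intro borel_measurable_cSUP) auto

lemma react_lim_mono_time:
  assumes "\<bar>x\<bar> \<le> 1" "t \<le> t'"
  shows "react_lim t x \<le> react_lim t' x"
  unfolding react_lim_def[of t]
  by (rule cSUP_least) (auto intro: order.trans[OF react_mono_time[OF assms] react_le_lim])

definition sol :: "real \<Rightarrow> real \<Rightarrow> real" where
  "sol t x = profile \<omega> lam f0 s x + convol (heat_kernel \<omega>) (source lam f0 s react_lim) (t, x)"

lemma approx_LIMSEQ: "(\<lambda>n. approx n t x) \<longlonglongrightarrow> sol t x"
proof (rule LIMSEQ_imp_Suc)
  have "(\<lambda>n. convol (heat_kernel \<omega>) (source lam f0 s (react n)) (t, x))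
      \<longlonglongrightarrow> convol (heat_kernel \<omega>) (source lam f0 s react_lim) (t, x)"
  proof (rule convol_LIMSEQ[OF integrable_heat_kernel[OF \<omega>]])
    show "(\<lambda>n. source lam f0 s (react n) w) \<longlonglongrightarrow> source lam f0 s react_lim w" for w
      unfolding source_def
      by (rule reflect_LIMSEQ) (auto intro!: tendsto_intros react_LIMSEQ)
    show "\<bar>source lam f0 s (react n) w\<bar> \<le> \<bar>lam\<bar> * 2" for n w
      by (rule source_bounded[OF react_bounds(3) f0_abs])
  qed (intro source_measurable react_measurable react_lim_measurable)+
  then show "(\<lambda>n. approx (Suc n) t x) \<longlonglongrightarrow> sol t x"
    unfolding approx_Suc sol_def by (intro tendsto_intros)
qed

lemma approx_le_sol: "\<bar>x\<bar> \<le> 1 \<Longrightarrow> approx n t x \<le> sol t x"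
  by (rule LIMSEQ_le_const[OF approx_LIMSEQ]) (auto intro: approx_mono')

lemma react_lim_in_graph:
  assumes "\<bar>x\<bar> \<le> 1"
  shows "react_lim t x \<in> reaction_graph f0 \<mu> (sol t x)"
proof -
  consider "sol t x < \<mu>" | "sol t x = \<mu>" | "\<mu> < sol t x" by linarith
  then show ?thesis
  proof cases
    case 1
    then have "react n t x = f0" for n
      using approx_le_sol[OF assms, of n t] by (simp add: react_def reaction_eq)
    then show ?thesis using 1 by (simp add: react_lim_def reaction_graph_def reaction_eq)
  next
    case 2
    then show ?thesis using react_lim_ge react_lim_le by (simp add: reaction_graph_def)
  next
    case 3
    obtain n where "\<mu> < approx n t x"
      using order_tendstoD(1)[OF approx_LIMSEQ 3] by (auto simp: eventually_sequentially)
    then have "react n t x = 1" by (simp add: react_def reaction_eq)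
    then have "react_lim t x = 1" using react_le_lim[of n t x] react_lim_le[of t x] by simp
    then show ?thesis using 3 by (simp add: reaction_graph_def reaction_eq)
  qed
qed

lemma parabolic_solution_sol:
  "parabolic_solution \<omega> lam (reaction_graph f0 \<mu>) (profile \<omega> lam f0 s) sol"
  unfolding sol_def[abs_def]
  by (rule parabolic_solution_heat_potential[OF \<omega> s(1) less_imp_le[OF s(2)] react_lim_measurable react_lim_abs f0_abs])
    (use react_lim_in_graph in \<open>auto simp: sol_def\<close>)

lemma isCont_sol: "isCont (sol t) x"
proof -
  have "isCont (convol (heat_kernel \<omega>) (source lam f0 s react_lim)) (t, x)"
    by (rule isCont_heat_potential[OF \<omega> source_measurable[OF react_lim_measurable] source_bounded[OF react_lim_abs f0_abs]])
  then have "isCont (\<lambda>x. convol (heat_kernel \<omega>) (source lam f0 s react_lim) (t, x)) x"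
    by (rule isCont_o2[rotated]) (intro continuous_intros)
  moreover have "isCont (profile \<omega> lam f0 s) x"
    using continuous_on_profile_snd[of UNIV] by (simp add: continuous_on_eq_continuous_at)
  ultimately show ?thesis unfolding sol_def[abs_def] by (intro continuous_intros)
qed

section \<open>The limit for large times\<close>

definition react_inf :: "real \<Rightarrow> real" where
  "react_inf x = (SUP N::nat. react_lim (real N) x)"

text \<open>The source is constant in time, so evaluation at time \<open>0\<close> is a mere choice.
  Defined as a potential, the limit can be compared with profiles by
  \<open>heat_potential_mono\<close>.\<close>

definition sol_inf :: "real \<Rightarrow> real" where
  "sol_inf x = convol (heat_kernel \<omega>) (\<lambda>w. reflect (\<lambda>x. lam * react_inf x) (snd w)) (0, x)"

lemma react_lim_bdd_above: "bdd_above (range (\<lambda>N::nat. react_lim (real N) x))"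
  using react_lim_le by (intro bdd_aboveI2[where M=1]) auto

lemma react_lim_le_inf: "react_lim (real N) x \<le> react_inf x"
  unfolding react_inf_def by (rule cSUP_upper[OF _ react_lim_bdd_above]) simp

lemma react_inf_le: "react_inf x \<le> 1"
  unfolding react_inf_def by (rule cSUP_least) (auto simp: react_lim_le)

lemma react_inf_ge: "f0 \<le> react_inf x"
  using react_lim_ge[of "real 0" x] react_lim_le_inf[of 0 x] by linarith

lemma react_inf_measurable: "react_inf \<in> borel_measurable borel"
proof -
  have [measurable]: "(\<lambda>w. react_lim (fst w) (snd w)) \<in> borel_measurable (borel \<Otimes>\<^sub>M borel)"
    using react_lim_measurable by (simp add: borel_prod)
  have "react_lim t \<in> borel_measurable borel" for t
    using measurable_compose[of "\<lambda>x. (t, x)" borel "borel \<Otimes>\<^sub>M borel" "\<lambda>w. react_lim (fst w) (snd w)" borel] by simp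
  then show ?thesis
    unfolding react_inf_def[abs_def] using react_lim_bdd_above by (intro borel_measurable_cSUP) auto
qed

lemma react_lim_LIMSEQ_time:
  assumes "\<bar>x\<bar> \<le> 1"
  shows "(\<lambda>N. react_lim (t + real N) x) \<longlonglongrightarrow> react_inf x"
proof (rule order_tendstoI)
  fix a assume "a < react_inf x"
  then obtain N0 :: nat where N0: "a < react_lim (real N0) x"
    unfolding react_inf_def using less_cSUP_iff[OF _ react_lim_bdd_above] by auto
  obtain N1 :: nat where "real N0 - t < real N1" using reals_Archimedean2 by blast
  then have "a < react_lim (t + real N) x" if "N1 \<le> N" for N
    using that N0 by (intro less_le_trans[OF N0 react_lim_mono_time[OF assms]]) auto
  then show "\<forall>\<^sub>F N in sequentially. a < react_lim (t + real N) x"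
    by (auto simp: eventually_sequentially)
next
  fix a assume a: "react_inf x < a"
  have "react_lim (t + real N) x < a" for N
  proof -
    obtain m :: nat where "t + real N < real m" using reals_Archimedean2 by blast
    then have "react_lim (t + real N) x \<le> react_lim (real m) x"
      by (intro react_lim_mono_time[OF assms]) simp
    then show ?thesis using react_lim_le_inf[of m x] a by linarith
  qed
  then show "\<forall>\<^sub>F N in sequentially. react_lim (t + real N) x < a" by simp
qed

lemma reflect_bound_lam:
  assumes "\<And>x. \<bar>k x\<bar> \<le> 1"
  shows "\<bar>reflect (\<lambda>x. lam * k x) y\<bar> \<le> lam * 2"
proof (rule reflect_bounded)
  show "\<bar>lam * k x\<bar> \<le> lam * 2" for x
    using assms[of x] lam by (simp add: abs_mult)
qed (use lam in simp)

lemma step_abs: "\<bar>step f0 r x\<bar> \<le> 1"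
  using f0 by (auto simp: step_def)

lemma react_inf_abs: "\<bar>react_inf x\<bar> \<le> 1"
  using react_inf_le[of x] react_inf_ge[of x] f0 by linarith

lemma reflect_lam_measurable:
  assumes "k \<in> borel_measurable borel"
  shows "(\<lambda>w::real \<times> real. reflect (\<lambda>x. lam * k x) (snd w)) \<in> borel_measurable borel"
  using assms by (intro borel_measurable_snd borel_measurable_reflect1) measurable

lemma even_odd_snd: "even_odd (\<lambda>w. reflect k (snd w))"
  by (simp add: even_odd_def reflect_minus reflect_diff)

text \<open>The value at time \<open>N\<close> is the value at time \<open>0\<close> for the source
  shifted by \<open>N\<close>. The moment of switching on recedes to minus infinity, and the shifted
  sources converge pointwise to a stationary one. Its frozen part has the profile as potential, by
  \<open>profile_eq_convol\<close>, which cancels the profile that \<open>sol\<close> started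
  from.\<close>

lemma sol_LIMSEQ_time:
  assumes "x \<in> {0..1}"
  shows "(\<lambda>N. sol (real N) x) \<longlonglongrightarrow> sol_inf x"
proof -
  let ?K = "\<lambda>N w. source lam f0 s react_lim (fst w + real N, snd w)"
  let ?R = "\<lambda>w::real \<times> real. reflect (\<lambda>x. lam * react_inf x) (snd w)"
  let ?S = "\<lambda>w::real \<times> real. reflect (\<lambda>x. lam * step f0 s x) (snd w)"
  have lim: "(\<lambda>N. convol (heat_kernel \<omega>) (?K N) (0, x)) \<longlonglongrightarrow> convol (heat_kernel \<omega>) (\<lambda>w. ?R w - ?S w) (0, x)"
  proof (rule convol_LIMSEQ[OF integrable_heat_kernel[OF \<omega>]])
    show "?K N \<in> borel_measurable borel" for N
      by (rule measurable_compose[OF _ source_measurable[OF react_lim_measurable]])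
        (auto intro!: borel_measurable_continuous_onI continuous_intros)
    show "(\<lambda>w. ?R w - ?S w) \<in> borel_measurable borel"
      by (intro borel_measurable_diff reflect_lam_measurable react_inf_measurable borel_measurable_step)
    show "\<bar>?K N w\<bar> \<le> \<bar>lam\<bar> * 2" for N w
      by (rule source_bounded[OF react_lim_abs f0_abs])
    show "(\<lambda>N. ?K N w) \<longlonglongrightarrow> ?R w - ?S w" for w
    proof -
      obtain N0 :: nat where N0: "- fst w < real N0" using reals_Archimedean2 by blast
      have "(\<lambda>N. reflect (\<lambda>x. if 0 < fst w + real N then lam * (react_lim (fst w + real N) x - step f0 s x) else 0) (snd w))
          \<longlonglongrightarrow> reflect (\<lambda>x. lam * (react_inf x - step f0 s x)) (snd w)"
      proof (rule reflect_LIMSEQ)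
        fix x :: real assume "0 \<le> x" "x < 1"
        then have "(\<lambda>N. lam * (react_lim (fst w + real N) x - step f0 s x)) \<longlonglongrightarrow> lam * (react_inf x - step f0 s x)"
          by (intro tendsto_intros react_lim_LIMSEQ_time) auto
        moreover have "\<forall>\<^sub>F N in sequentially. lam * (react_lim (fst w + real N) x - step f0 s x)
            = (if 0 < fst w + real N then lam * (react_lim (fst w + real N) x - step f0 s x) else 0)"
          using N0 by (intro eventually_sequentiallyI[of N0]) auto
        ultimately show "(\<lambda>N. if 0 < fst w + real N then lam * (react_lim (fst w + real N) x - step f0 s x) else 0)
            \<longlonglongrightarrow> lam * (react_inf x - step f0 s x)"
          by (rule Lim_transform_eventually)
      qed
      then show ?thesis
        unfolding source_def fst_conv snd_conv reflect_diff_fun right_diff_distrib .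
    qed
  qed
  have "convol (heat_kernel \<omega>) (\<lambda>w. ?R w - ?S w) (0, x)
      = convol (heat_kernel \<omega>) ?R (0, x) - convol (heat_kernel \<omega>) ?S (0, x)"
    by (rule convol_diff[OF integrable_heat_kernel[OF \<omega>] reflect_lam_measurable[OF react_inf_measurable]
          reflect_bound_lam[OF react_inf_abs] reflect_lam_measurable[OF borel_measurable_step] reflect_bound_lam[OF step_abs]])
  moreover have "convol (heat_kernel \<omega>) ?S (0, x) = profile \<omega> lam f0 s x"
    using profile_eq_convol[OF \<omega> s(1) less_imp_le[OF s(2)] assms] by simp
  ultimately have "profile \<omega> lam f0 s x + convol (heat_kernel \<omega>) (\<lambda>w. ?R w - ?S w) (0, x) = sol_inf x"
    by (simp add: sol_inf_def)
  moreover have "sol (real N) x = profile \<omega> lam f0 s x + convol (heat_kernel \<omega>) (?K N) (0, x)" for N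
    using convol_time_shift[of "heat_kernel \<omega>" "source lam f0 s react_lim" 0 "real N" x] by (simp add: sol_def)
  ultimately show ?thesis
    using tendsto_add[OF tendsto_const[of "profile \<omega> lam f0 s x"] lim] by simp
qed

text \<open>Both sides are stationary potentials, and on \<open>[0, 1)\<close> the reaction
  \<open>react_inf\<close> dominates the one frozen at \<open>r\<close>: it is \<open>1\<close> up
  to \<open>r\<close> and never below \<open>f0\<close>.\<close>

lemma sol_inf_ge_profile:
  assumes r: "0 \<le> r" "r \<le> 1" and one: "\<And>x. 0 \<le> x \<Longrightarrow> x < r \<Longrightarrow> react_inf x = 1" and x: "x \<in> {0..1}"
  shows "profile \<omega> lam f0 r x \<le> sol_inf x"
proof -
  have "convol (heat_kernel \<omega>) (\<lambda>w. reflect (\<lambda>x. lam * step f0 r x) (snd w)) (0, x) \<le> sol_inf x"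
    unfolding sol_inf_def
  proof (rule heat_potential_mono[OF \<omega> reflect_lam_measurable[OF borel_measurable_step] reflect_bound_lam[OF step_abs] even_odd_snd
        reflect_lam_measurable[OF react_inf_measurable] reflect_bound_lam[OF react_inf_abs] even_odd_snd])
    show "reflect (\<lambda>x. lam * step f0 r x) (snd (t, y)) \<le> reflect (\<lambda>x. lam * react_inf x) (snd (t, y))" if "\<bar>y\<bar> < 1" for t y :: real
      using that lam react_inf_ge[of "\<bar>y\<bar>"] one[of "\<bar>y\<bar>"] by (auto simp: reflect_eq_abs step_def)
  qed (use x in auto)
  then show ?thesis using profile_eq_convol[OF \<omega> r x] by simp
qed

text \<open>The strict inequality already holds at some finite time, where the graph above
  \<open>\<mu>\<close> consists of \<open>1\<close> alone; \<open>react_inf\<close> lies between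
  this reaction and \<open>1\<close>.\<close>

lemma react_inf_eq_1:
  assumes "x \<in> {0..1}" "\<mu> < sol_inf x"
  shows "react_inf x = 1"
proof -
  obtain N where "\<mu> < sol (real N) x"
    using order_tendstoD(1)[OF sol_LIMSEQ_time[OF assms(1)] assms(2)] by (auto simp: eventually_sequentially)
  then have "react_lim (real N) x = 1"
    using react_lim_in_graph[of x "real N"] assms(1) by (auto simp: reaction_graph_def reaction_eq split: if_splits)
  then show ?thesis using react_lim_le_inf[of N x] react_inf_le[of x] by simp
qed

lemma react_inf_ge_step: "0 \<le> x \<Longrightarrow> x < s \<Longrightarrow> react_inf x = 1"
  using step_le_react[of x 0 "real 0"] react_le_lim[of 0 "real 0" x] react_lim_le_inf[of 0 x] react_inf_le[of x] s
  by (simp add: step_def)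

text \<open>The limiting interface cannot stop at any \<open>R < r\<close>: the solution dominates \<open>profile \<omega> lam f0 R\<close>,
  whose value at \<open>R\<close> exceeds \<open>\<mu>\<close>.\<close>

lemma sol_inf_passes:
  assumes r: "s \<le> r" "r < 1" and gt: "\<And>q. s \<le> q \<Longrightarrow> q \<le> r \<Longrightarrow> \<mu> < profile \<omega> lam f0 q q" and x: "x \<in> {0..1}"
  shows "profile \<omega> lam f0 r x \<le> sol_inf x"
proof -
  define A where "A = {q \<in> {s..r}. \<forall>x. 0 \<le> x \<longrightarrow> x < q \<longrightarrow> react_inf x = 1}"
  have sA: "s \<in> A" using r react_inf_ge_step by (auto simp: A_def)
  have bdd: "bdd_above A" by (intro bdd_aboveI[of _ r]) (auto simp: A_def)
  define R where "R = Sup A"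
  have R: "s \<le> R" "R \<le> r"
    unfolding R_def using sA bdd by (auto intro: cSup_upper cSup_least simp: A_def)
  have RA: "react_inf x = 1" if "0 \<le> x" "x < R" for x
  proof -
    have "A \<noteq> {}" using sA by auto
    moreover have "x < Sup A" using that(2) by (simp add: R_def)
    ultimately obtain q where "q \<in> A" "x < q" using less_cSup_iff[of A x] bdd by auto
    then show ?thesis using that by (auto simp: A_def)
  qed
  have "R = r"
  proof (rule ccontr)
    assume "R \<noteq> r"
    then have Rr: "R < r" using R by simp
    have "open {x. \<mu> < profile \<omega> lam f0 R x}"
      by (intro open_Collect_less continuous_on_const continuous_on_profile_snd)
    moreover have "R \<in> {x. \<mu> < profile \<omega> lam f0 R x}" using gt[OF R] by simp
    ultimately obtain e where e: "0 < e" "\<And>x. dist x R < e \<Longrightarrow> \<mu> < profile \<omega> lam f0 R x"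
      unfolding open_dist by blast
    \<comment> \<open>The half of \<open>e\<close> keeps \<open>[R, R')\<close> inside the
      neighbourhood where the profile frozen at \<open>R\<close> exceeds \<open>\<mu>\<close>; the
      minimum keeps the new point in the range of \<open>A\<close>.\<close>
    define R' where "R' = min r (R + e / 2)"
    have R': "R < R'" "R' \<le> r" using Rr e(1) by (auto simp: R'_def)
    have "react_inf x = 1" if "0 \<le> x" "x < R'" for x
    proof (cases "x < R")
      case False
      have x01: "x \<in> {0..1}" using that R' r by auto
      have "dist x R < e" using that False e(1) by (auto simp: R'_def dist_real_def)
      then have "\<mu> < profile \<omega> lam f0 R x" by (rule e(2))
      also have "\<dots> \<le> sol_inf x" using R r s by (intro sol_inf_ge_profile RA x01) auto
      finally show ?thesis by (rule react_inf_eq_1[OF x01])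
    qed (use RA that in auto)
    then have "R' \<in> A" using R R' by (auto simp: A_def)
    then have "R' \<le> R" unfolding R_def by (rule cSup_upper[OF _ bdd])
    then show False using R'(1) by simp
  qed
  then show ?thesis using R r s by (intro sol_inf_ge_profile RA x) auto
qed

end

section \<open>Instability\<close>

text \<open>A plateau \<open>u = \<mu>\<close> to the right of \<open>\<xi>\<close> would force \<open>lam = \<omega>\<^sup>2 \<mu>\<close>, i.e. \<open>denom f0 \<omega> \<xi> = cosh \<omega>\<close>.\<close>

lemma monotone_solution_eq_profile:
  assumes \<mu>: "0 < \<mu>" and f0: "0 < f0" "f0 < 1" and \<omega>: "0 < \<omega>" and \<xi>: "0 \<le> \<xi>" "\<xi> < 1"
    and lam: "lam = \<mu> * g f0 \<omega> \<xi>" and den: "0 < denom f0 \<omega> \<xi>"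
    and sol: "monotone_solution \<omega> lam (reaction f0 \<mu>) \<mu> \<xi> u" and x: "x \<in> {0..1}"
  shows "u x = profile \<omega> lam f0 \<xi> x"
proof -
  have fb: "free_boundary_solution \<omega> lam (reaction f0 \<mu>) \<mu> \<xi> u" and dec: "\<forall>x\<in>{0<..<1}. deriv u x \<le> 0"
    using sol by (auto simp: monotone_solution_def)
  from fb obtain u' u'' where cont: "continuous_on {0..1} u" and at_\<xi>: "u \<xi> = \<mu>" and u1: "u 1 = 0"
    and du: "\<forall>x\<in>{0..<1}. (u has_real_derivative u' x) (at x within {0..<1})"
    and cont': "continuous_on {0..<1} u'"
    and du': "\<forall>x\<in>{0<..<1} - {\<xi>}. (u' has_real_derivative u'' x) (at x)"
    and ode: "\<forall>x\<in>{0<..<1} - {\<xi>}. - u'' x + \<omega>\<^sup>2 * u x = lam * reaction f0 \<mu> (u x)"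
    and u'0: "u' 0 = 0"
    unfolding free_boundary_solution_def by blast
  have d: "(u has_real_derivative u' x) (at x)" if "0 < x" "x < 1" for x
  proof -
    have "at x within {0..<1} = at x" using that by (intro at_within_interior) auto
    then show ?thesis using du that by (metis atLeastLessThan_iff less_imp_le)
  qed
  have nonpos: "u' x \<le> 0" if "0 < x" "x < 1" for x
  proof -
    have "deriv u x \<le> 0" using dec that by simp
    then show ?thesis using DERIV_imp_deriv[OF d[OF that]] by simp
  qed
  have anti: "u b \<le> u a" if "0 \<le> a" "a \<le> b" "b \<le> 1" for a b
  proof (rule DERIV_nonpos_imp_decreasing_open[OF that(2)])
    show "\<exists>y. (u has_real_derivative y) (at x) \<and> y \<le> 0" if "a < x" "x < b" for x
      using d[of x] nonpos[of x] that \<open>0 \<le> a\<close> \<open>b \<le> 1\<close> by auto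
    show "continuous_on {a..b} u" using that by (intro continuous_on_subset[OF cont]) auto
  qed
  have below: "u x < \<mu>" if x: "\<xi> < x" "x < 1" for x
  proof (rule ccontr)
    assume "\<not> u x < \<mu>"
    then have plateau: "u y = \<mu>" if "\<xi> \<le> y" "y \<le> x" for y
      using anti[of \<xi> y] anti[of y x] at_\<xi> that x \<xi> by auto
    have u'_0: "u' y = 0" if "\<xi> < y" "y < x" for y
    proof -
      have "(u has_real_derivative 0) (at y)"
        by (rule has_field_derivative_transform_within_open[of "\<lambda>_. \<mu>" 0 y "{\<xi><..<x}"])
          (use that plateau in auto)
      then show ?thesis using d[of y] DERIV_unique that x \<xi> by force
    qed
    define y where "y = (\<xi> + x) / 2"
    have y: "\<xi> < y" "y < x" using x by (auto simp: y_def)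
    have "(u' has_real_derivative 0) (at y)"
      by (rule has_field_derivative_transform_within_open[of "\<lambda>_. 0" 0 y "{\<xi><..<x}"])
        (use y u'_0 in auto)
    moreover have yI: "y \<in> {0<..<1} - {\<xi>}" using y x \<xi> by auto
    then have "(u' has_real_derivative u'' y) (at y)" using du' by blast
    ultimately have "u'' y = 0" using DERIV_unique by blast
    moreover have "- u'' y + \<omega>\<^sup>2 * u y = lam * reaction f0 \<mu> (u y)" using ode yI by blast
    ultimately have "\<omega>\<^sup>2 * \<mu> = lam" using plateau[of y] y by (simp add: reaction_eq)
    then have "denom f0 \<omega> \<xi> = cosh \<omega>" using lam \<mu> \<omega> den by (simp add: g_eq_denom field_simps)
    then show False using denom_less[OF \<omega> f0 \<xi>] by simp
  qed
  show ?thesis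
  proof (rule profile_unique[OF \<omega> \<xi>(1) less_imp_le[OF \<xi>(2)], where S="{\<xi>}" and e=u'])
    show "(u' has_real_derivative \<omega>\<^sup>2 * u x - lam * step f0 \<xi> x) (at x)" if x: "0 < x" "x < 1" "x \<notin> {\<xi>}" for x
    proof -
      have xI: "x \<in> {0<..<1} - {\<xi>}" using x by auto
      have "reaction f0 \<mu> (u x) = step f0 \<xi> x"
      proof (cases "x < \<xi>")
        case True
        then show ?thesis using anti[of x \<xi>] x \<xi> at_\<xi> by (simp add: reaction_eq step_def)
      next
        case False
        then show ?thesis using below[of x] x by (simp add: reaction_eq step_def)
      qed
      moreover have "- u'' x + \<omega>\<^sup>2 * u x = lam * reaction f0 \<mu> (u x)" using ode xI by blast
      ultimately have "u'' x = \<omega>\<^sup>2 * u x - lam * step f0 \<xi> x" by simp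
      moreover have "(u' has_real_derivative u'' x) (at x)" using du' xI by blast
      ultimately show ?thesis by simp
    qed
  qed (use cont cont' d u'0 u1 x in auto)
qed

text \<open>At \<open>x = 0\<close> a profile depends on its interface \<open>s\<close> only through
  \<open>cosh (\<omega> * (1 - s))\<close>. The escape of the solution is measured at this
  point.\<close>

lemma profile_0_less:
  assumes "0 < \<omega>" "0 < lam" "f0 < 1" "0 \<le> \<xi>" "\<xi> < r" "r \<le> 1"
  shows "profile \<omega> lam f0 \<xi> 0 < profile \<omega> lam f0 r 0"
proof -
  have "cosh (\<omega> * (1 - r)) < cosh (\<omega> * (1 - \<xi>))"
    using assms by (intro cosh_real_strict_mono) auto
  then have "bump \<omega> \<xi> 0 < bump \<omega> r 0" using assms by (simp add: bump_left)
  then show ?thesis unfolding profile_def using assms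
    by (intro mult_strict_left_mono) (auto simp: cosh_real_pos)
qed

text \<open>The essential supremum ignores single points, and \<open>0\<close> is not even in the
  open interval; continuity of \<open>d\<close> spreads the strict bound at \<open>0\<close> to an
  interval \<open>(0, \<eta>)\<close> of positive measure.\<close>

lemma Linf_norm_ge_of_isCont:
  assumes cont: "\<And>x. isCont d x" and eq: "\<And>x. 0 < x \<Longrightarrow> x < 1 \<Longrightarrow> v x = d x" and gt: "\<epsilon> < d 0"
  shows "ereal \<epsilon> \<le> Linf_norm v"
proof (rule ccontr)
  assume "\<not> ereal \<epsilon> \<le> Linf_norm v"
  then have less: "Linf_norm v < ereal \<epsilon>" by simp
  have "AE x in lebesgue_on {0<..<1}. ereal \<bar>v x\<bar> \<le> Linf_norm v"
    unfolding Linf_norm_def by (rule esssup_AE)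
  then have "AE x in lebesgue_on {0<..<1}. \<bar>v x\<bar> < \<epsilon>"
    by eventually_elim (use less in \<open>metis ereal_less_eq(3) not_le order.strict_trans1\<close>)
  then have small: "AE x in lebesgue. x \<in> {0<..<1} \<longrightarrow> \<bar>v x\<bar> < \<epsilon>"
    by (subst (asm) AE_restrict_space_iff) auto
  have "open {x. \<epsilon> < d x}"
    using cont by (intro open_Collect_less continuous_on_const continuous_at_imp_continuous_on) auto
  then obtain e where e: "0 < e" "\<And>x. dist x 0 < e \<Longrightarrow> \<epsilon> < d x"
    using gt unfolding open_dist by blast
  define \<eta> where "\<eta> = min e 1"
  have \<eta>: "0 < \<eta>" "\<eta> \<le> 1" "\<eta> \<le> e" using e(1) by (auto simp: \<eta>_def)
  from small have "AE x in lebesgue. x \<notin> {0<..<\<eta>}"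
  proof eventually_elim
    case (elim x)
    show ?case
    proof
      assume x: "x \<in> {0<..<\<eta>}"
      then have "\<epsilon> < d x" using \<eta> by (intro e(2)) (auto simp: dist_real_def)
      moreover have "v x = d x" using x \<eta> by (intro eq) auto
      moreover have "\<bar>v x\<bar> < \<epsilon>" using elim x \<eta> by auto
      ultimately show False by linarith
    qed
  qed
  moreover have eq: "{x \<in> space lebesgue. \<not> x \<notin> {0<..<\<eta>}} = {0<..<\<eta>}" by auto
  ultimately have "emeasure lebesgue {0<..<\<eta>} = 0"
    using AE_iff_measurable[OF _ eq] by simp
  then show False using \<eta> by simp
qed

theorem theorem1p3:
  fixes \<mu> f0 \<omega> lam r_star \<xi> :: real and u_low :: "real \<Rightarrow> real"
  assumes "0 < \<mu>" and "f0 \<in> {0<..<1}" and "0 < \<omega>" and "\<omega> < 1"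
    and r_star: "r_star \<in> {0<..<1}"
      "r_star = 1 / 2 * (1 + 1 / \<omega> * arsinh (f0 / (f0 - 1) * sinh (\<omega> * r_star)))"
    and lambda: "lam \<in> {\<mu> * g f0 \<omega> r_star <.. \<mu> * g f0 \<omega> 0}"
    and xi: "\<xi> \<in> {0..<r_star}" "g f0 \<omega> \<xi> = lam / \<mu>"
    and u_low: "monotone_solution \<omega> lam (reaction f0 \<mu>) \<mu> \<xi> u_low"
  shows "unstable_Linf \<omega> lam (reaction_graph f0 \<mu>) u_low"
proof -
  have f0: "0 < f0" "f0 < 1" and \<xi>: "0 \<le> \<xi>" "\<xi> < r_star" "\<xi> < 1" and rs: "0 < r_star" "r_star < 1"
    using assms by auto
  have den_mono: "denom f0 \<omega> s < denom f0 \<omega> t" if "0 \<le> s" "s < t" "t \<le> r_star" for s t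
    by (rule denom_strict_mono[OF assms(3) f0 r_star(2) that])
  have den: "0 < denom f0 \<omega> \<xi>"
    using denom_0_pos[OF assms(3) f0(1)] den_mono[of 0 \<xi>] \<xi> by (cases "\<xi> = 0") auto
  have lam_eq: "lam = \<mu> * g f0 \<omega> \<xi>" using xi(2) assms(1) by simp
  then have lam: "0 < lam" using assms(1,3) den by (simp add: g_eq_denom)
  have low: "u_low x = profile \<omega> lam f0 \<xi> x" if "x \<in> {0..1}" for x
    by (rule monotone_solution_eq_profile[OF assms(1) f0 assms(3) \<xi>(1,3) lam_eq den u_low that])
  have at_interface: "profile \<omega> lam f0 q q = \<mu> * (denom f0 \<omega> q / denom f0 \<omega> \<xi>)" for q
    unfolding profile_at_interface using assms(3) den
    by (simp add: lam_eq g_eq_denom)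
  \<comment> \<open>The end point \<open>r_star\<close> is included, so the comparison can be
    carried up to the profile frozen at \<open>r_star\<close> itself.\<close>
  have gt: "\<mu> < profile \<omega> lam f0 q q" if "\<xi> < q" "q \<le> r_star" for q
    using mult_strict_left_mono[OF den_mono[OF \<xi>(1) that] assms(1)] den
    by (simp add: at_interface pos_less_divide_eq)
  \<comment> \<open>Halving the gap at \<open>x = 0\<close> leaves a strict inequality for the
    limit, which therefore holds already at a finite time.\<close>
  define \<epsilon> where "\<epsilon> = (profile \<omega> lam f0 r_star 0 - profile \<omega> lam f0 \<xi> 0) / 2"
  have \<epsilon>: "0 < \<epsilon>"
    unfolding \<epsilon>_def using profile_0_less[OF assms(3) lam f0(2) \<xi>(1,2)] rs by simp
  have "\<exists>u0 u. u0 \<in> borel_measurable (lebesgue_on {0<..<1}) \<and>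
        Linf_norm (\<lambda>x. u0 x - u_low x) < ereal \<delta> \<and>
        parabolic_solution \<omega> lam (reaction_graph f0 \<mu>) u0 u \<and>
        (\<exists>t>0. Linf_norm (\<lambda>x. u t x - u_low x) \<ge> ereal \<epsilon>)" if \<delta>: "0 < \<delta>" for \<delta>
  proof -
    \<comment> \<open>A pointwise bound by \<open>\<delta> / 2\<close> gives only a weak inequality
      for the essential supremum; the strict bound by \<open>\<delta>\<close> survives it.\<close>
    have half: "0 < \<delta> / 2" using \<delta> by simp
    obtain s where s_between: "\<xi> < s" "s < r_star"
      and close: "\<And>x. x \<in> {0..1} \<Longrightarrow> \<bar>profile \<omega> lam f0 s x - profile \<omega> lam f0 \<xi> x\<bar> < \<delta> / 2"
      by (rule profile_uniformly_close[OF \<xi>(1,2) less_imp_le[OF rs(2)] half]) (rule that)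
    interpret subsolution \<omega> lam f0 \<mu> s
      by unfold_locales (use assms(3) lam f0 s_between \<xi> rs gt[of s] in auto)
    let ?L = "lebesgue_on {0<..<1}"
    have pm: "profile \<omega> lam f0 r \<in> borel_measurable ?L" for r
      by (rule lebesgue_on_borel(1)) auto
    have "Linf_norm (\<lambda>x. profile \<omega> lam f0 s x - u_low x) \<le> ereal (\<delta> / 2)"
      unfolding Linf_norm_def
    proof (rule esssup_I)
      have meas: "(\<lambda>x. ereal \<bar>profile \<omega> lam f0 s x - profile \<omega> lam f0 \<xi> x\<bar>) \<in> borel_measurable ?L"
        using pm by measurable
      have eq: "\<And>x. x \<in> space ?L \<Longrightarrow> ereal \<bar>profile \<omega> lam f0 s x - u_low x\<bar> = ereal \<bar>profile \<omega> lam f0 s x - profile \<omega> lam f0 \<xi> x\<bar>"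
        using low by (simp add: space_restrict_space)
      show "(\<lambda>x. ereal \<bar>profile \<omega> lam f0 s x - u_low x\<bar>) \<in> borel_measurable ?L"
        by (rule measurable_cong[THEN iffD2, OF _ meas]) (rule eq)
      show "AE x in ?L. ereal \<bar>profile \<omega> lam f0 s x - u_low x\<bar> \<le> ereal (\<delta> / 2)"
        using close low by (intro AE_I2) (auto simp: space_restrict_space intro!: less_imp_le)
    qed
    also have "\<dots> < ereal \<delta>" using \<delta> by simp
    finally have near: "Linf_norm (\<lambda>x. profile \<omega> lam f0 s x - u_low x) < ereal \<delta>" .
    have "profile \<omega> lam f0 r_star 0 \<le> sol_inf 0"
      by (rule sol_inf_passes) (use s_between rs gt in auto)
    then have "profile \<omega> lam f0 \<xi> 0 + \<epsilon> < sol_inf 0" using \<epsilon> by (simp add: \<epsilon>_def field_simps)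
    moreover have "(\<lambda>N. sol (real N) 0) \<longlonglongrightarrow> sol_inf 0" by (rule sol_LIMSEQ_time) simp
    ultimately have "\<forall>\<^sub>F N in sequentially. profile \<omega> lam f0 \<xi> 0 + \<epsilon> < sol (real N) 0"
      by (intro order_tendstoD(1))
    then have "\<forall>\<^sub>F N in sequentially. profile \<omega> lam f0 \<xi> 0 + \<epsilon> < sol (real N) 0 \<and> 0 < N"
      using eventually_gt_at_top[of 0] by (rule eventually_conj)
    then obtain N where N: "profile \<omega> lam f0 \<xi> 0 + \<epsilon> < sol (real N) 0" "0 < N"
      by (auto simp: eventually_sequentially)
    have "ereal \<epsilon> \<le> Linf_norm (\<lambda>x. sol (real N) x - u_low x)"
    proof (rule Linf_norm_ge_of_isCont)
      show "isCont (\<lambda>x. sol (real N) x - profile \<omega> lam f0 \<xi> x) x" for x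
        using continuous_on_profile_snd[of UNIV] isCont_sol
        by (intro continuous_intros) (auto simp: continuous_on_eq_continuous_at)
    qed (use N low in auto)
    then have "\<exists>t>0. ereal \<epsilon> \<le> Linf_norm (\<lambda>x. sol t x - u_low x)"
      using N(2) by (intro exI[of _ "real N"]) simp
    then show ?thesis using near parabolic_solution_sol pm by blast
  qed
  then show ?thesis unfolding unstable_Linf_def using \<epsilon> by blast
qed

end
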